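(* Let $\psi$ be a Bernstein function and let $-A$ be the generator of a bounded $C_0$-semigroup $(e^{-tA})_{t\ge0}$ on a Banach space $X$ satisfying the Yosida condition $Y(c_0,c_1)$. Then $-\psi(A)$ generates a bounded $C_0$-semigroup $(e^{-t\psi(A)})_{t\ge0}$ on $X$ satisfying the following Yosida condition: for every $t>0$ one has $e^{-t\psi(A)}(X)\subset\mathrm{dom}(\psi(A))$ and $$\|\psi(A)e^{-t\psi(A)}\|\le M(A)\bigl(\psi(0)+4\,C[c_0;\psi]\bigr)e^{-t\psi(0)}+2\max(2M(A),c_1)\,t^{-1}.$$ If $-A$ generates a sectorially bounded holomorphic $C_0$-semigroup on $X$, then the same is true for $-\psi(A)$.
   Context: A positive (meaning $\ge 0$) function $g\in C^\infty(0,\infty)$ is completely monotone if $(-1)^n g^{(n)}(\tau)\ge 0$ for all $\tau>0$, $n\in\mathbb{N}$. A positive $\psi\in C^\infty(0,\infty)$ is a Bernstein function if $\psi'$ is completely monotone; equivalently there are unique $a,b\ge 0$ and a positive Radon measure $\gamma$ on $(0,\infty)$ with $\int_{0+}^\infty \frac{s}{1+s}\,\gamma(ds)<\infty$ such that $\psi(\tau)=a+b\tau+\int_{0+}^\infty(1-e^{-s\tau})\,\gamma(ds)$, $\tau>0$. We write $\psi(0)=\psi(0+)=a$. $C[c_0;\psi]:=\int_0^\infty e^{-s/c_0}\psi'(s)\,ds$ for $c_0>0$, and $C[0;\psi]:=0$. Let $-A$ generate a bounded $C_0$-semigroup $(e^{-tA})_{t\ge0}$ on $X$. If $f$ is the Laplace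 transform of a bounded Radon measure $\mu$ on $[0,\infty)$, then $f(A)x:=\int_0^\infty e^{-sA}x\,\mu(ds)$. For a Bernstein function $\psi$ the function $\psi(z)/(1+z)$ is such a Laplace transform and $\psi(A):=(1+A)[\psi(z)(1+z)^{-1}](A)$, a closed operator; equivalently, $\psi(A)$ is the closure of $x\mapsto ax+bAx+\int_{0+}^\infty(1-e^{-sA})x\,\gamma(ds)$ defined on $\mathrm{dom}(A)$. The semigroup generated by $-\psi(A)$ is $e^{-t\psi(A)}=\int_0^\infty e^{-sA}\mu_t(ds)$, where $(\mu_t)_{t\ge0}$ is the vaguely continuous convolution semigroup of subprobability measures on $[0,\infty)$ with $\int_0^\infty e^{-s\tau}\mu_t(ds)=e^{-t\psi(\tau)}$, $\tau>0$. $M(A):=\sup_{t\ge0}\|e^{-tA}\|$. A bounded $C_0$-semigroup $(e^{-tA})_{t\ge0}$ satisfies the Yosida condition $Y(c_0,c_1)$, where $c_0\ge0$, $c_1>0$, if $e^{-tA}(X)\subset\mathrm{dom}(A)$ for all $t>0$ and $\|Ae^{-tA}\|\le c_0+c_1/t$ for all $t>0$. (A bounded $C_0$-semigroup is holomorphic if and only if it satisfies such a condition for some $c_0,c_1$.) With $\Sigma_\theta=\{z\in\mathbb{C}:|\arg z|<\theta\}$, a $C_0$-semigroup is a sectorially bounded holomorphic semigroup if for some $\beta\in(0,\pi/2]$ it extends holomorphically to $\Sigma_\beta$ and is bounded on $\Sigma_\theta$ for every $\theta\in(0,\beta)$. Equivalently, $e^{-tA}(X)\subset\mathrm{dom}(A)$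 for every $t>0$, and $\sup_{t\ge0}\|e^{-tA}\|$ and $\sup_{t>0}\|tAe^{-tA}\|$ are finite. *)

theory Defs
  imports "HOL-Analysis.Analysis"
begin

section \<open>Complex Banach spaces\<close>

class complex_banach = banach +
  fixes scaleC :: "complex \<Rightarrow> 'a \<Rightarrow> 'a"  (infixr "*\<^sub>C" 75)
  assumes scaleC_add_right: "a *\<^sub>C (x + y) = a *\<^sub>C x + a *\<^sub>C y"
    and scaleC_add_left: "(a + b) *\<^sub>C x = a *\<^sub>C x + b *\<^sub>C x"
    and scaleC_scaleC: "a *\<^sub>C (b *\<^sub>C x) = (a * b) *\<^sub>C x"
    and scaleC_of_real: "complex_of_real r *\<^sub>C x = r *\<^sub>R x"
    and norm_scaleC: "norm (a *\<^sub>C x) = cmod a * norm x"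

instantiation complex :: complex_banach
begin
definition scaleC_complex :: "complex \<Rightarrow> complex \<Rightarrow> complex"
  where "scaleC_complex a x = a * x"
instance
  by standard
    (auto simp: scaleC_complex_def algebra_simps norm_mult scaleR_conv_of_real)
end

lemma bounded_linear_scaleC: "bounded_linear (\<lambda>x::'a::complex_banach. a *\<^sub>C x)"
proof (rule bounded_linear_intro[where K = "cmod a"])
  fix r :: real and x :: 'a
  have "a *\<^sub>C (r *\<^sub>R x) = (a * complex_of_real r) *\<^sub>C x"
    by (simp only: scaleC_of_real[symmetric] scaleC_scaleC)
  also have "\<dots> = r *\<^sub>R (a *\<^sub>C x)"
    by (simp only: scaleC_of_real[symmetric] scaleC_scaleC mult.commute)
  finally show "a *\<^sub>C (r *\<^sub>R x) = r *\<^sub>R (a *\<^sub>C x)" .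
qed (simp_all add: scaleC_add_right norm_scaleC mult.commute)

text \<open>Bounded operators form a complex Banach space in the operator norm, so the notion of
  holomorphy below applies to operator-valued functions.\<close>

instantiation blinfun :: (real_normed_vector, complex_banach) complex_banach
begin
lift_definition scaleC_blinfun :: "complex \<Rightarrow> ('a \<Rightarrow>\<^sub>L 'b) \<Rightarrow> ('a \<Rightarrow>\<^sub>L 'b)"
  is "\<lambda>a f x. a *\<^sub>C f x"
  by (rule bounded_linear_compose[OF bounded_linear_scaleC])
instance
proof
  fix a b :: complex and r :: real and f g :: "'a \<Rightarrow>\<^sub>L 'b"
  show "a *\<^sub>C (f + g) = a *\<^sub>C f + a *\<^sub>C g"
    by transfer (simp add: scaleC_add_right)
  show "(a + b) *\<^sub>C f = a *\<^sub>C f + b *\<^sub>C f"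
    by transfer (simp add: scaleC_add_left)
  show "a *\<^sub>C (b *\<^sub>C f) = (a * b) *\<^sub>C f"
    by transfer (simp add: scaleC_scaleC)
  show "complex_of_real r *\<^sub>C f = r *\<^sub>R f"
    by transfer (simp add: scaleC_of_real)
  have le: "norm (c *\<^sub>C h) \<le> cmod c * norm h" for c and h :: "'a \<Rightarrow>\<^sub>L 'b"
  proof (rule norm_blinfun_bound)
    fix x
    have "norm (blinfun_apply (c *\<^sub>C h) x) = cmod c * norm (blinfun_apply h x)"
      by (simp add: scaleC_blinfun.rep_eq norm_scaleC)
    also have "\<dots> \<le> cmod c * (norm h * norm x)"
      by (rule mult_left_mono[OF norm_blinfun]) simp
    finally show "norm (blinfun_apply (c *\<^sub>C h) x) \<le> cmod c * norm h * norm x"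
      by (simp add: mult.assoc)
  qed simp
  show "norm (a *\<^sub>C f) = cmod a * norm f"
  proof (cases "a = 0")
    case True
    then show ?thesis using le[of a f] by simp
  next
    case False
    have "inverse a *\<^sub>C (a *\<^sub>C f) = complex_of_real 1 *\<^sub>C f"
      using False by transfer (simp add: scaleC_scaleC)
    also have "\<dots> = f"
      by transfer (simp only: scaleC_of_real scaleR_one)
    finally have "norm f \<le> inverse (cmod a) * norm (a *\<^sub>C f)"
      using le[of "inverse a" "a *\<^sub>C f"] by (simp add: norm_inverse)
    then have "cmod a * norm f \<le> norm (a *\<^sub>C f)"
      using False by (simp add: field_simps)
    with le[of a f] show ?thesis by (rule antisym)
  qed
qed
end

definition clinear_op :: "('a::complex_banach \<Rightarrow>\<^sub>L 'a) \<Rightarrow> bool"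
  where "clinear_op S \<longleftrightarrow> (\<forall>c x. S (c *\<^sub>C x) = c *\<^sub>C S x)"

definition vec_holomorphic_on :: "(complex \<Rightarrow> 'b::complex_banach) \<Rightarrow> complex set \<Rightarrow> bool"
  where "vec_holomorphic_on F U \<longleftrightarrow>
    (\<forall>z\<in>U. \<exists>D. ((\<lambda>w. inverse (w - z) *\<^sub>C (F w - F z)) \<longlongrightarrow> D) (at z within U))"


section \<open>Unbounded operators as graphs\<close>

definition op_neg :: "('a::real_vector \<times> 'a) set \<Rightarrow> ('a \<times> 'a) set"
  where "op_neg A = {(x, - y) | x y. (x, y) \<in> A}"

definition op_one_plus :: "('a::real_vector \<times> 'a) set \<Rightarrow> ('a \<times> 'a) set"
  where "op_one_plus A = {(x, x + y) | x y. (x, y) \<in> A}"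

definition op_apply :: "('a \<times> 'a) set \<Rightarrow> 'a \<Rightarrow> 'a"
  where "op_apply A x = (THE y. (x, y) \<in> A)"

text \<open>The bound on the operator norm of \<open>AS\<close>, for \<open>S\<close> mapping into the domain of \<open>A\<close>.
  Boundedness is required explicitly because \<^const>\<open>onorm\<close> is meaningless without it.\<close>

definition op_comp_norm_le :: "('a::real_normed_vector \<times> 'a) set \<Rightarrow> ('a \<Rightarrow>\<^sub>L 'a) \<Rightarrow> real \<Rightarrow> bool"
  where "op_comp_norm_le A S c \<longleftrightarrow>
    bounded_linear (\<lambda>x. op_apply A (S x)) \<and> onorm (\<lambda>x. op_apply A (S x)) \<le> c"


section \<open>Semigroups\<close>

text \<open>A semigroup is a function on all reals whose values at negative times are irrelevant.\<close>

definition C0_semigroup :: "(real \<Rightarrow> ('a::complex_banach \<Rightarrow>\<^sub>L 'a)) \<Rightarrow> bool"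
  where "C0_semigroup T \<longleftrightarrow>
    (\<forall>t\<ge>0. clinear_op (T t)) \<and>
    T 0 = id_blinfun \<and>
    (\<forall>s\<ge>0. \<forall>t\<ge>0. T (s + t) = T s o\<^sub>L T t) \<and>
    (\<forall>x. ((\<lambda>t. T t x) \<longlongrightarrow> x) (at_right 0))"

definition bounded_C0_semigroup :: "(real \<Rightarrow> ('a::complex_banach \<Rightarrow>\<^sub>L 'a)) \<Rightarrow> bool"
  where "bounded_C0_semigroup T \<longleftrightarrow> C0_semigroup T \<and> bounded (T ` {0..})"

definition generator :: "(real \<Rightarrow> ('a::real_normed_vector \<Rightarrow>\<^sub>L 'a)) \<Rightarrow> ('a \<times> 'a) set"
  where "generator T = {(x, y). ((\<lambda>t. (T t x - x) /\<^sub>R t) \<longlongrightarrow> y) (at_right 0)}"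

definition sg_bound :: "(real \<Rightarrow> ('a::real_normed_vector \<Rightarrow>\<^sub>L 'a)) \<Rightarrow> real"
  where "sg_bound T = (SUP t\<in>{0..}. norm (T t))"

text \<open>\<open>A\<close> is meant to be the negative of the generator of \<open>T\<close>.\<close>

definition yosida :: "(real \<Rightarrow> ('a::complex_banach \<Rightarrow>\<^sub>L 'a)) \<Rightarrow> ('a \<times> 'a) set \<Rightarrow> real \<Rightarrow> real \<Rightarrow> bool"
  where "yosida T A c0 c1 \<longleftrightarrow> c0 \<ge> 0 \<and> c1 > 0 \<and>
    (\<forall>t>0. range (T t) \<subseteq> Domain A \<and> op_comp_norm_le A (T t) (c0 + c1 / t))"

text \<open>The condition \<open>z \<noteq> 0\<close> is needed because \<^term>\<open>Arg 0 = 0\<close>.\<close>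

definition sector :: "real \<Rightarrow> complex set"
  where "sector \<theta> = {z. z \<noteq> 0 \<and> \<bar>Arg z\<bar> < \<theta>}"

definition sectorially_bounded_holomorphic :: "(real \<Rightarrow> ('a::complex_banach \<Rightarrow>\<^sub>L 'a)) \<Rightarrow> bool"
  where "sectorially_bounded_holomorphic T \<longleftrightarrow> C0_semigroup T \<and>
    (\<exists>\<beta> H. 0 < \<beta> \<and> \<beta> \<le> pi / 2 \<and>
      (\<forall>t>0. H (complex_of_real t) = T t) \<and>
      (\<forall>z\<in>sector \<beta>. clinear_op (H z)) \<and>
      vec_holomorphic_on H (sector \<beta>) \<and>
      (\<forall>\<theta>. 0 < \<theta> \<and> \<theta> < \<beta> \<longrightarrow> bounded (H ` sector \<theta>)))"


section \<open>Bernstein functions\<close>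

text \<open>Functions on \<open>(0, \<infinity>)\<close> are functions on all reals whose values outside are irrelevant.\<close>

definition smooth_pos :: "(real \<Rightarrow> real) \<Rightarrow> bool"
  where "smooth_pos f \<longleftrightarrow> (\<forall>n. ((deriv ^^ n) f) differentiable_on {0<..})"

definition completely_monotone :: "(real \<Rightarrow> real) \<Rightarrow> bool"
  where "completely_monotone g \<longleftrightarrow> smooth_pos g \<and>
    (\<forall>n. \<forall>\<tau>>0. 0 \<le> (- 1) ^ n * (deriv ^^ n) g \<tau>)"

definition bernstein :: "(real \<Rightarrow> real) \<Rightarrow> bool"
  where "bernstein \<psi> \<longleftrightarrow> smooth_pos \<psi> \<and> (\<forall>\<tau>>0. 0 \<le> \<psi> \<tau>) \<and> completely_monotone (deriv \<psi>)"

definition at_zero :: "(real \<Rightarrow> real) \<Rightarrow> real"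
  where "at_zero \<psi> = Lim (at_right 0) \<psi>"

definition C_const :: "real \<Rightarrow> (real \<Rightarrow> real) \<Rightarrow> real"
  where "C_const c0 \<psi> = (if c0 = 0 then 0
    else set_lebesgue_integral lborel {0<..} (\<lambda>s. exp (- s / c0) * deriv \<psi> s))"


section \<open>Functional calculus\<close>

text \<open>The Bochner integral. This is \<^const>\<open>has_bochner_integral\<close> without its restriction to second
  countable, that is separable, spaces.\<close>

definition has_vec_integral :: "'m measure \<Rightarrow> ('m \<Rightarrow> 'b::real_normed_vector) \<Rightarrow> 'b \<Rightarrow> bool"
  where "has_vec_integral M f y \<longleftrightarrow> f \<in> borel_measurable M \<and>
    (\<exists>s. (\<forall>i. Bochner_Integration.simple_bochner_integrable M (s i)) \<and>
      (\<lambda>i. \<integral>\<^sup>+x. ennreal (norm (f x - s i x)) \<partial>M) \<longlonglongrightarrow> 0 \<and>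
      (\<lambda>i. Bochner_Integration.simple_bochner_integral M (s i)) \<longlonglongrightarrow> y)"

definition finite_measure_on_halfline :: "real measure \<Rightarrow> bool"
  where "finite_measure_on_halfline \<mu> \<longleftrightarrow>
    finite_measure \<mu> \<and> sets \<mu> = sets (restrict_space borel {0..})"

text \<open>A bounded signed Radon measure on \<open>[0, \<infinity>)\<close> is represented as a difference
  \<open>\<mu> - \<nu>\<close> of two finite positive ones. The operator \<open>f(A)\<close> is given by its graph; it does not depend
  on the choice of \<open>\<mu>\<close> and \<open>\<nu>\<close>, and \<open>T\<close> is determined on \<open>[0, \<infinity>)\<close> by \<open>A\<close>.\<close>

definition is_laplace_transform :: "(real \<Rightarrow> real) \<Rightarrow> real measure \<Rightarrow> real measure \<Rightarrow> bool"
  where "is_laplace_transform f \<mu> \<nu> \<longleftrightarrow>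
    finite_measure_on_halfline \<mu> \<and> finite_measure_on_halfline \<nu> \<and>
    (\<forall>\<tau>>0. f \<tau> = (\<integral>s. exp (- s * \<tau>) \<partial>\<mu>) - (\<integral>s. exp (- s * \<tau>) \<partial>\<nu>))"

definition laplace_calculus :: "(real \<Rightarrow> real) \<Rightarrow> ('a::complex_banach \<times> 'a) set \<Rightarrow> ('a \<times> 'a) set"
  where "laplace_calculus f A = {(x, y). \<exists>T \<mu> \<nu> u v.
    bounded_C0_semigroup T \<and> generator T = op_neg A \<and>
    is_laplace_transform f \<mu> \<nu> \<and>
    has_vec_integral \<mu> (\<lambda>s. T s x) u \<and> has_vec_integral \<nu> (\<lambda>s. T s x) v \<and> y = u - v}"

text \<open>\<open>\<psi>(A) = (1 + A) [\<psi>(z)/(1 + z)](A)\<close> with its natural domain; for relations the factor applied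
  first stands on the left of \<^const>\<open>relcomp\<close>.\<close>

definition bernstein_calculus :: "(real \<Rightarrow> real) \<Rightarrow> ('a::complex_banach \<times> 'a) set \<Rightarrow> ('a \<times> 'a) set"
  where "bernstein_calculus \<psi> A = laplace_calculus (\<lambda>z. \<psi> z / (1 + z)) A O op_one_plus A"

end

theory Submission
  imports Defs "HOL-Probability.Probability" "HOL-Complex_Analysis.Complex_Analysis"
    "HOL-Real_Asymp.Real_Asymp"
begin

text \<open>For a bounded semigroup \<open>T\<close> and a finite measure \<open>\<mu>\<close> on \<open>[0, \<infinity>)\<close> let \<open>\<mu>(A)\<close> be the operator
\<open>x \<mapsto> \<integral> T s x \<mu>(ds)\<close>. A linear relation between Laplace transforms of measures carries over to the
operators, because a finite signed measure on the half-line is determined by its Laplace transform on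
\<open>(0, \<infinity>)\<close>, and products of transforms correspond to products of operators. The measures come from
Bernstein's theorem: a bounded completely monotone function is the Laplace transform of a finite
measure. In particular \<open>exp (- t \<psi>)\<close> is the transform of some \<open>\<mu>\<^sub>t\<close>, and \<open>S t = \<mu>\<^sub>t(A)\<close> is the
subordinate semigroup.

\<^bold>\<open>The generator.\<close> Put \<open>chi y = (1 - exp (- y)) / y = \<integral>\<^sub>0\<^sup>1 exp (- r y) dr\<close>, and let \<open>\<theta>\<^sub>h\<close> be the measure
with transform \<open>chi (h \<psi>)\<close>. If the transforms of \<open>\<kappa>\<close>, \<open>\<alpha>\<close>, \<open>\<beta>\<close> satisfy \<open>\<kappa> \<psi> = \<alpha> - \<beta>\<close>, then
\<open>(1 - S h) \<kappa>(A) = h \<theta>\<^sub>h(A) (\<alpha>(A) - \<beta>(A))\<close>, since the two sides have the same transform, and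
\<open>\<theta>\<^sub>h(A) \<rightarrow> 1\<close> strongly as \<open>h \<rightarrow> 0\<close>. Hence \<open>(1 - S h)/h\<close> can be evaluated in the limit on the range of
\<open>\<kappa>(A)\<close>. For \<open>\<kappa> = exp (- s) ds\<close>, so that \<open>\<kappa>(A) = (1 + A)\<^sup>-\<^sup>1\<close>, this shows that both the generator of \<open>S\<close>
and the operator \<open>\<psi>(A) = (1 + A) [\<psi>/(1 + z)](A)\<close> are described by the equation
\<open>[\<psi>/(1 + z)](A) x = (1 + A)\<^sup>-\<^sup>1 y\<close> (lemmas \<open>difference_quotient_identity\<close>, \<open>generator_S_iff\<close>, \<open>generator_S\<close>).

\<^bold>\<open>The Yosida bound.\<close> The norm of \<open>(1 - T s) T u\<close> is at most \<open>2 M\<close> and at most \<open>s (c0 + c1/u)\<close>, hence at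
most \<open>4 M s/(s + 1/c0) + 2 max(2 M, c1) s/(s + u)\<close>, where the first term is absent if
\<open>c0 = 0\<close>. Writing
\<open>s/(s + u) = \<integral>\<^sub>0\<^sup>\<infinity> s exp (- s \<tau>) exp (- u \<tau>) d\<tau>\<close> and using
\<open>\<integral> s exp (- s \<tau>) \<mu>\<^sub>h(ds) \<le> h \<psi>'(\<tau>)\<close>, one gets \<open>(1/h) \<integral> s/(s + u) \<mu>\<^sub>h(ds) \<le> \<integral>\<^sub>0\<^sup>\<infinity> \<psi>'(\<tau>) exp (- u \<tau>) d\<tau>\<close>. For
\<open>u = 1/c0\<close> the right-hand side is \<open>C[c0; \<psi>]\<close>; integrated against \<open>\<mu>\<^sub>t(du)\<close> it becomes
\<open>\<integral>\<^sub>0\<^sup>\<infinity> \<psi>' exp (- t \<psi>) \<le> 1/t\<close>. The terms with \<open>\<psi>(0)\<close> come from the total masses \<open>exp (- h \<psi>(0))\<close> of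
\<open>\<mu>\<^sub>h\<close> and \<open>exp (- t \<psi>(0))\<close> of \<open>\<mu>\<^sub>t\<close>. So \<open>(1 - S h) S t / h\<close> is bounded by the asserted constant, uniformly in
\<open>h\<close> (lemma \<open>S_increment_le\<close>). It converges on the dense domain of the generator, therefore everywhere.

\<^bold>\<open>The sectorial case.\<close> Cauchy's estimate turns sectorial boundedness of \<open>T\<close> into a Yosida condition
with \<open>c0 = 0\<close>, so that \<open>\<psi>(A) S t\<close> is \<open>O(1/t)\<close> for all \<open>t > 0\<close>. Powers of such an estimate make the
Taylor series of \<open>S\<close> at each \<open>t > 0\<close> converge on a disc of radius proportional to \<open>t\<close>, and the discs
cover a sector.

Vector-valued integrals, difference quotients and holomorphic functions are handled by applying
continuous functionals; the functionals come from the Hahn-Banach theorem in the form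
\<open>ex_norming_functional\<close>.\<close>

section \<open>Norming functionals\<close>

definition sublinear :: "('a::real_vector \<Rightarrow> real) \<Rightarrow> bool"
  where "sublinear p \<longleftrightarrow> (\<forall>x y. p (x + y) \<le> p x + p y) \<and> (\<forall>c>0. \<forall>x. p (c *\<^sub>R x) \<le> c * p x)"

lemma sublinear_add: "sublinear p \<Longrightarrow> p (x + y) \<le> p x + p y"
  and sublinear_scale: "sublinear p \<Longrightarrow> c > 0 \<Longrightarrow> p (c *\<^sub>R x) \<le> c * p x"
  by (auto simp: sublinear_def)

lemma sublinear_zero:
  assumes "sublinear p" shows "p 0 = 0"
  using sublinear_add[OF assms, of 0 0] sublinear_scale[OF assms, of "1/2" 0] by simp

lemma sublinear_minus:
  assumes "sublinear p" shows "- p (- x) \<le> p x"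
  using sublinear_add[OF assms, of x "- x"] sublinear_zero[OF assms] by simp

text \<open>Lowering \<open>q\<close> as far as possible in the direction \<open>- y\<close>: the infimum of \<open>q (x + t y) - t q y\<close> over
\<open>t \<ge> 0\<close> is again sublinear. At a minimal \<open>q\<close> nothing can be lowered, which makes \<open>q\<close> odd and hence linear;
applied to the norm itself, the construction forces the value at \<open>y\<close> to be \<open>norm y\<close>.\<close>

lemma sublinear_tilt:
  fixes q :: "'a::real_vector \<Rightarrow> real"
  assumes q: "sublinear q"
  obtains r where "sublinear r" "\<And>x. r x \<le> q x" "r (- y) \<le> - q y"
proof -
  define h where "h x t = q (x + t *\<^sub>R y) - t * q y" for x t
  define r where "r x = (INF t\<in>{0..}. h x t)" for x
  have lb: "- q (- x) \<le> h x t" if "t \<ge> 0" for x t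
  proof (cases "t = 0")
    case True
    then show ?thesis using sublinear_minus[OF q, of x] by (simp add: h_def)
  next
    case False
    have "- q (- (t *\<^sub>R y)) \<le> t * q y"
      using sublinear_minus[OF q, of "t *\<^sub>R y"] sublinear_scale[OF q, of t y] False that by simp
    have "t * q y = t * q ((1/t) *\<^sub>R (t *\<^sub>R y))" using False by simp
    also have "\<dots> \<le> q (t *\<^sub>R y)"
      using sublinear_scale[OF q, of "1/t" "t *\<^sub>R y"] False that by (simp add: field_simps)
    also have "\<dots> \<le> q (x + t *\<^sub>R y) + q (- x)"
      using sublinear_add[OF q, of "x + t *\<^sub>R y" "- x"] by simp
    finally show ?thesis by (simp add: h_def)
  qed
  have bdd: "bdd_below (h x ` {0..})" for x
    using lb by (intro bdd_belowI2[where m = "- q (- x)"]) auto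
  have le: "r x \<le> h x t" if "t \<ge> 0" for x t
    unfolding r_def using that by (intro cINF_lower bdd) auto
  have ge: "b \<le> r x" if "\<And>t. t \<ge> 0 \<Longrightarrow> b \<le> h x t" for b x
    unfolding r_def using that by (intro cINF_greatest) auto
  have "r (x + x') \<le> r x + r x'" for x x'
  proof -
    have "r (x + x') - h x t \<le> h x' t'" if "t \<ge> 0" "t' \<ge> 0" for t t'
    proof -
      have "h (x + x') (t + t') \<le> h x t + h x' t'"
        using sublinear_add[OF q, of "x + t *\<^sub>R y" "x' + t' *\<^sub>R y"]
        by (simp add: h_def algebra_simps)
      then show ?thesis using le[of "t + t'" "x + x'"] that by simp
    qed
    then have "r (x + x') - h x t \<le> r x'" if "t \<ge> 0" for t using that by (intro ge) auto
    then have "r (x + x') - r x' \<le> h x t" if "t \<ge> 0" for t using that by (simp add: algebra_simps)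
    then have "r (x + x') - r x' \<le> r x" by (rule ge)
    then show ?thesis by simp
  qed
  moreover have "r (c *\<^sub>R x) \<le> c * r x" if c: "c > 0" for c x
  proof -
    have "r (c *\<^sub>R x) / c \<le> r x"
    proof (rule ge)
      fix t :: real assume t: "t \<ge> 0"
      have "r (c *\<^sub>R x) \<le> h (c *\<^sub>R x) (c * t)" using t c by (intro le) simp
      also have "\<dots> \<le> c * h x t"
        using sublinear_scale[OF q c, of "x + t *\<^sub>R y"] by (simp add: h_def algebra_simps)
      finally show "r (c *\<^sub>R x) / c \<le> h x t" using c by (simp add: field_simps)
    qed
    then show ?thesis using c by (simp add: field_simps)
  qed
  ultimately have "sublinear r" by (simp add: sublinear_def)
  moreover have "r x \<le> q x" for x using le[of 0 x] by (simp add: h_def)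
  moreover have "r (- y) \<le> - q y"
    using le[of 1 "- y"] sublinear_zero[OF q] by (simp add: h_def)
  ultimately show thesis by (rule that)
qed

text \<open>Zorn's lemma applies because the pointwise infimum of a chain of sublinear functionals below
\<open>p\<close> is sublinear; it is finite since each of them is at least \<open>- p (- x)\<close>.\<close>

lemma ex_minimal_sublinear:
  fixes p :: "'a::real_vector \<Rightarrow> real"
  assumes p: "sublinear p"
  obtains q where "sublinear q" "\<And>x. q x \<le> p x"
    "\<And>r. sublinear r \<Longrightarrow> (\<And>x. r x \<le> q x) \<Longrightarrow> r = q"
proof -
  define A where "A = {q. sublinear q \<and> (\<forall>x. q x \<le> p x)}"
  define P where "P = (\<lambda>q r :: 'a \<Rightarrow> real. \<forall>x. r x \<le> q x)"
  have "\<exists>m\<in>A. \<forall>a\<in>A. P m a \<longrightarrow> a = m"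
  proof (rule predicate_Zorn)
    show "partial_order_on A (relation_of P A)"
      by (rule partial_order_on_relation_ofI) (auto simp: P_def fun_eq_iff intro: order_trans antisym)
  next
    fix C assume C: "C \<in> Chains (relation_of P A)"
    then have CA: "C \<subseteq> A" and lin: "\<And>q r. q \<in> C \<Longrightarrow> r \<in> C \<Longrightarrow> P q r \<or> P r q"
      by (auto simp: Chains_def relation_of_def)
    show "\<exists>u\<in>A. \<forall>a\<in>C. P a u"
    proof (cases "C = {}")
      case True
      then show ?thesis using p by (auto simp: A_def)
    next
      case False
      define u where "u x = (INF q\<in>C. q x)" for x
      have lb: "- p (- x) \<le> q x" if "q \<in> C" for q x
      proof -
        have "sublinear q" "q (- x) \<le> p (- x)" using that CA by (auto simp: A_def)
        then show ?thesis using sublinear_minus[of q x] by linarith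
      qed
      have bdd: "bdd_below ((\<lambda>q. q x) ` C)" for x
        using lb by (intro bdd_belowI2[where m = "- p (- x)"]) auto
      have le: "u x \<le> q x" if "q \<in> C" for x q
        unfolding u_def using that by (intro cINF_lower bdd) auto
      have ge: "b \<le> u x" if "\<And>q. q \<in> C \<Longrightarrow> b \<le> q x" for b x
        unfolding u_def using that False by (intro cINF_greatest) auto
      have sub: "sublinear q" if "q \<in> C" for q using that CA by (auto simp: A_def)
      have "u (x + y) \<le> u x + u y" for x y
      proof -
        have "u (x + y) - q x \<le> r y" if qr: "q \<in> C" "r \<in> C" for q r
        proof -
          obtain s where s: "s \<in> C" "s x \<le> q x" "s y \<le> r y"
            using lin[OF qr] qr by (auto simp: P_def)
          show ?thesis using le[OF s(1), of "x + y"] sublinear_add[OF sub[OF s(1)], of x y] s by simp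
        qed
        then have "u (x + y) - q x \<le> u y" if "q \<in> C" for q using that by (intro ge) auto
        then have "u (x + y) - u y \<le> q x" if "q \<in> C" for q using that by (simp add: algebra_simps)
        then have "u (x + y) - u y \<le> u x" by (rule ge)
        then show ?thesis by simp
      qed
      moreover have "u (c *\<^sub>R x) \<le> c * u x" if c: "c > 0" for c x
      proof -
        have "u (c *\<^sub>R x) / c \<le> u x"
        proof (rule ge)
          fix q assume "q \<in> C"
          then have "u (c *\<^sub>R x) \<le> c * q x"
            using le sublinear_scale[OF sub c] order_trans by blast
          then show "u (c *\<^sub>R x) / c \<le> q x" using c by (simp add: field_simps)
        qed
        then show ?thesis using c by (simp add: field_simps)
      qed
      ultimately have "sublinear u" by (simp add: sublinear_def)
      moreover obtain q0 where "q0 \<in> C" using False by auto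
      then have "u x \<le> p x" for x using le[of q0 x] CA by (auto simp: A_def intro: order_trans)
      ultimately show ?thesis using le by (auto simp: A_def P_def)
    qed
  qed
  then obtain q where q: "q \<in> A" "\<And>a. a \<in> A \<Longrightarrow> P q a \<Longrightarrow> a = q" by auto
  show thesis
  proof (rule that)
    show "sublinear q" "\<And>x. q x \<le> p x" using q(1) by (auto simp: A_def)
    show "r = q" if "sublinear r" "\<And>x. r x \<le> q x" for r
      using that q(1) by (intro q(2)) (auto simp: A_def P_def intro: order_trans)
  qed
qed

text \<open>This is the Hahn-Banach theorem for the norm. A minimal sublinear functional below the norm tilted
at \<open>z\<close> is linear, is bounded by the norm, and takes at \<open>- z\<close> a value at most \<open>- norm z\<close>.\<close>

theorem ex_norming_functional:
  fixes z :: "'a::real_normed_vector"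
  obtains \<phi> :: "'a \<Rightarrow>\<^sub>L real" where "\<And>x. \<bar>\<phi> x\<bar> \<le> norm x" "\<phi> z = norm z"
proof -
  have n: "sublinear (norm :: 'a \<Rightarrow> real)" by (auto simp: sublinear_def norm_triangle_ineq)
  obtain p :: "'a \<Rightarrow> real" where p: "sublinear p" "\<And>x. p x \<le> norm x" "p (- z) \<le> - norm z"
    using sublinear_tilt[OF n, of z] by blast
  obtain q where q: "sublinear q" "\<And>x. q x \<le> p x"
    "\<And>r. sublinear r \<Longrightarrow> (\<And>x. r x \<le> q x) \<Longrightarrow> r = q"
    using ex_minimal_sublinear[OF p(1)] by metis
  have odd: "q (- y) = - q y" for y
  proof -
    obtain r where r: "sublinear r" "\<And>x. r x \<le> q x" "r (- y) \<le> - q y"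
      using sublinear_tilt[OF q(1), of y] by blast
    have "r = q" using q(3)[OF r(1,2)] .
    then show ?thesis using r(3) sublinear_minus[OF q(1), of y] by simp
  qed
  have add: "q (x + y) = q x + q y" for x y
    using sublinear_add[OF q(1), of "x + y" "- y"] sublinear_add[OF q(1), of x y] odd[of y] by simp
  have pos: "q (c *\<^sub>R x) = c * q x" if c: "c > 0" for c x
  proof (rule antisym)
    show "q (c *\<^sub>R x) \<le> c * q x" by (rule sublinear_scale[OF q(1) c])
    show "c * q x \<le> q (c *\<^sub>R x)"
      using sublinear_scale[OF q(1), of "1/c" "c *\<^sub>R x"] c by (simp add: field_simps)
  qed
  have scale: "q (c *\<^sub>R x) = c * q x" for c x
  proof (cases "c > 0 \<or> c = 0")
    case True
    then show ?thesis using pos sublinear_zero[OF q(1)] by auto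
  next
    case False
    then show ?thesis using pos[of "- c" x] odd[of "c *\<^sub>R x"] by simp
  qed
  have bound: "\<bar>q x\<bar> \<le> norm x" for x
    using order_trans[OF q(2) p(2), of x] order_trans[OF q(2) p(2), of "- x"] odd[of x] by simp
  have bl: "bounded_linear q"
    by (rule bounded_linear_intro[where K = 1]) (use add scale bound in auto)
  have "q z = norm z"
    using order_trans[OF q(2) p(3)] bound[of z] odd[of z] by simp
  then show thesis
    using bound by (intro that[of "Blinfun q"]) (auto simp: bounded_linear_Blinfun_apply[OF bl])
qed

lemma functional_eqI:
  fixes x y :: "'a::real_normed_vector"
  assumes "\<And>\<phi> :: 'a \<Rightarrow>\<^sub>L real. \<phi> x = \<phi> y"
  shows "x = y"
proof -
  obtain \<phi> :: "'a \<Rightarrow>\<^sub>L real" where "\<phi> (x - y) = norm (x - y)" by (rule ex_norming_functional)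
  then show ?thesis using assms[of \<phi>] by (simp add: blinfun.diff_right)
qed

lemma functional_norm_leI:
  fixes x :: "'a::real_normed_vector"
  assumes "\<And>\<phi> :: 'a \<Rightarrow>\<^sub>L real. (\<And>y. \<bar>\<phi> y\<bar> \<le> norm y) \<Longrightarrow> \<phi> x \<le> B"
  shows "norm x \<le> B"
  using assms ex_norming_functional[of x] by metis

section \<open>Vector-valued integrals over the half-line\<close>

abbreviation "halfline \<equiv> finite_measure_on_halfline"

lemma halfline_finite: "halfline \<mu> \<Longrightarrow> finite_measure \<mu>"
  and halfline_sets: "halfline \<mu> \<Longrightarrow> sets \<mu> = sets (restrict_space borel {0..})"
  by (auto simp: finite_measure_on_halfline_def)

lemma halfline_space: "halfline \<mu> \<Longrightarrow> space \<mu> = {0..}"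
  using sets_eq_imp_space_eq[OF halfline_sets] by (simp add: space_restrict_space)

lemma halfline_measurable:
  assumes "halfline \<mu>" "continuous_on {0..} f"
  shows "f \<in> borel_measurable \<mu>"
  using borel_measurable_continuous_on_restrict[OF assms(2)] halfline_sets[OF assms(1)]
  by (simp cong: measurable_cong_sets)

lemma halfline_integrable:
  fixes g :: "real \<Rightarrow> real"
  assumes \<mu>: "halfline \<mu>" and "continuous_on {0..} g" "\<And>s. s \<ge> 0 \<Longrightarrow> \<bar>g s\<bar> \<le> B"
  shows "integrable \<mu> g"
  using assms halfline_measurable[OF assms(1,2)] halfline_space[OF \<mu>]
  by (intro finite_measure.integrable_const_bound[OF halfline_finite[OF \<mu>], of _ B]) auto

text \<open>Applying a functional turns the integral into an ordinary Lebesgue integral, so every identity or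
estimate for vector-valued integrals follows from the scalar one by norming functionals. Contractive
functionals come first: for them the approximation error does not increase, and the general case is a
multiple.\<close>

lemma has_vec_integral_functional:
  fixes \<phi> :: "'b::real_normed_vector \<Rightarrow>\<^sub>L real"
  assumes "has_vec_integral M f y"
  shows "has_bochner_integral M (\<lambda>x. \<phi> (f x)) (\<phi> y)"
proof -
  from assms obtain s where f: "f \<in> borel_measurable M"
    and s: "\<And>i. Bochner_Integration.simple_bochner_integrable M (s i)"
    and fs: "(\<lambda>i. \<integral>\<^sup>+x. ennreal (norm (f x - s i x)) \<partial>M) \<longlonglongrightarrow> 0"
    and sy: "(\<lambda>i. Bochner_Integration.simple_bochner_integral M (s i)) \<longlonglongrightarrow> y"
    unfolding has_vec_integral_def by blast
  have contraction: "has_bochner_integral M (\<lambda>x. \<psi> (f x)) (\<psi> y)"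
    if "\<And>x. \<bar>\<psi> x\<bar> \<le> norm x" for \<psi> :: "'b \<Rightarrow>\<^sub>L real"
  proof (rule has_bochner_integral.intros)
    show "(\<lambda>x. \<psi> (f x)) \<in> borel_measurable M"
      by (rule measurable_compose[OF f borel_measurable_continuous_onI])
         (intro continuous_intros)
    show "Bochner_Integration.simple_bochner_integrable M (\<lambda>x. \<psi> (s i x))" for i
      by (rule simple_bochner_integrable_compose2[of "\<lambda>x _. \<psi> x", OF _ s s]) simp
    show "(\<lambda>i. \<integral>\<^sup>+x. ennreal (norm (\<psi> (f x) - \<psi> (s i x))) \<partial>M) \<longlonglongrightarrow> 0"
      using that
      by (intro tendsto_sandwich[OF _ _ tendsto_const fs] always_eventually allI nn_integral_mono)
         (auto simp: blinfun.diff_right[symmetric] intro: ennreal_leI)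
    have "Bochner_Integration.simple_bochner_integral M (\<lambda>x. \<psi> (s i x))
        = \<psi> (Bochner_Integration.simple_bochner_integral M (s i))" for i
      by (intro simple_bochner_integral_linear s linear_conv_bounded_linear[THEN iffD2]
          bounded_linear.linear blinfun.bounded_linear_right)
    then show "(\<lambda>i. Bochner_Integration.simple_bochner_integral M (\<lambda>x. \<psi> (s i x))) \<longlonglongrightarrow> \<psi> y"
      using sy by (simp add: blinfun.tendsto)
  qed
  define K where "K = norm \<phi> + 1"
  have K: "K > 0" by (simp add: K_def add_nonneg_pos)
  have "\<bar>((1 / K) *\<^sub>R \<phi>) x\<bar> \<le> norm x" for x
  proof -
    have "\<bar>\<phi> x\<bar> \<le> norm \<phi> * norm x" using norm_blinfun[of \<phi> x] by simp
    also have "\<dots> \<le> K * norm x" by (intro mult_right_mono) (auto simp: K_def)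
    finally show ?thesis using K by (simp add: blinfun.scaleR_left field_simps)
  qed
  from has_bochner_integral_mult_right[OF contraction[OF this], of K]
  show ?thesis using K by (simp add: blinfun.scaleR_left)
qed

text \<open>In a nonseparable space a difference of Borel functions can fail to be Borel, but a simple function
splits the domain into finitely many pieces on which the subtrahend is constant.\<close>

lemma borel_measurable_norm_diff_simple:
  fixes f s :: "'m \<Rightarrow> 'b::real_normed_vector"
  assumes f: "f \<in> borel_measurable M" and s: "simple_function M s"
  shows "(\<lambda>x. norm (f x - s x)) \<in> borel_measurable M"
proof -
  have fin: "finite (s ` space M)" using s by (rule simple_functionD)
  have "(\<lambda>x. norm (f x - c)) \<in> borel_measurable M" for c
    by (rule measurable_compose[OF f borel_measurable_continuous_onI]) (intro continuous_intros)
  moreover have "s -` {c} \<inter> space M \<in> sets M" for c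
    using s by (rule simple_functionD)
  ultimately have "(\<lambda>x. \<Sum>c\<in>s ` space M. indicator (s -` {c} \<inter> space M) x * norm (f x - c))
      \<in> borel_measurable M"
    by (intro borel_measurable_sum borel_measurable_times borel_measurable_indicator) auto
  moreover have "norm (f x - s x) = (\<Sum>c\<in>s ` space M. indicator (s -` {c} \<inter> space M) x * norm (f x - c))"
    if x: "x \<in> space M" for x
  proof -
    have "(\<Sum>c\<in>s ` space M. indicator (s -` {c} \<inter> space M) x * norm (f x - c))
      = (\<Sum>c\<in>s ` space M. if c = s x then norm (f x - c) else 0)"
      using x by (intro sum.cong) auto
    then show ?thesis using x fin by simp
  qed
  ultimately show ?thesis by (simp cong: measurable_cong)
qed

lemma simple_integral_dist_le:
  fixes f :: "'m \<Rightarrow> 'b::real_normed_vector"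
  assumes f: "f \<in> borel_measurable M"
    and s: "Bochner_Integration.simple_bochner_integrable M s"
    and t: "Bochner_Integration.simple_bochner_integrable M t"
  shows "ennreal (norm (Bochner_Integration.simple_bochner_integral M s
      - Bochner_Integration.simple_bochner_integral M t))
    \<le> (\<integral>\<^sup>+x. norm (f x - s x) \<partial>M) + (\<integral>\<^sup>+x. norm (f x - t x) \<partial>M)"
proof -
  have sf: "simple_function M s" "simple_function M t"
    using s t by (auto elim: simple_bochner_integrable.cases)
  note m = borel_measurable_norm_diff_simple[OF f sf(1)] borel_measurable_norm_diff_simple[OF f sf(2)]
  have "ennreal (norm (Bochner_Integration.simple_bochner_integral M s
      - Bochner_Integration.simple_bochner_integral M t))
    = norm (Bochner_Integration.simple_bochner_integral M (\<lambda>x. s x - t x))"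
    using s t by (subst simple_bochner_integral_diff) auto
  also have "\<dots> \<le> Bochner_Integration.simple_bochner_integral M (\<lambda>x. norm (s x - t x))"
    using simple_bochner_integrable_compose2[of "(-)" M s t] s t
    by (auto intro!: simple_bochner_integral_norm_bound ennreal_leI)
  also have "\<dots> = (\<integral>\<^sup>+x. norm (s x - t x) \<partial>M)"
    using simple_bochner_integrable_compose2[of "\<lambda>x y. norm (x - y)" M s t] s t
    by (auto intro!: simple_bochner_integral_eq_nn_integral)
  also have "\<dots> \<le> (\<integral>\<^sup>+x. ennreal (norm (f x - s x)) + ennreal (norm (f x - t x)) \<partial>M)"
  proof (rule nn_integral_mono)
    fix x
    have "norm (s x - t x) \<le> norm (f x - s x) + norm (f x - t x)"
      by (metis dual_order.refl norm_diff_triangle_le norm_minus_commute)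
    then show "ennreal (norm (s x - t x)) \<le> ennreal (norm (f x - s x)) + ennreal (norm (f x - t x))"
      by (simp flip: ennreal_plus)
  qed
  also have "\<dots> = (\<integral>\<^sup>+x. norm (f x - s x) \<partial>M) + (\<integral>\<^sup>+x. norm (f x - t x) \<partial>M)"
    using m by (intro nn_integral_add) auto
  finally show ?thesis .
qed

text \<open>The step functions \<open>f (r i x)\<close>, with \<open>r i x\<close> the dyadic approximation of \<open>x\<close> cut off at \<open>i\<close>, converge
boundedly to \<open>f\<close>; by completeness their integrals converge.\<close>

lemma ex_vec_integral:
  fixes f :: "real \<Rightarrow> 'b::banach"
  assumes \<mu>: "halfline \<mu>" and cont: "continuous_on {0..} f"
    and bound: "\<And>s. s \<ge> 0 \<Longrightarrow> norm (f s) \<le> B"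
  shows "\<exists>y. has_vec_integral \<mu> f y"
proof -
  interpret finite_measure \<mu> using \<mu> by (rule halfline_finite)
  have sp: "space \<mu> = {0..}" using \<mu> by (rule halfline_space)
  have f: "f \<in> borel_measurable \<mu>" using \<mu> cont by (rule halfline_measurable)
  have idm: "(\<lambda>x. x) \<in> borel_measurable \<mu>" using \<mu> by (rule halfline_measurable) simp
  define r where "r i x = real_of_int (min (int i * 2 ^ i) \<lfloor>2 ^ i * x\<rfloor>) / 2 ^ i" for i :: nat and x :: real
  define s where "s i x = f (r i x)" for i x
  have r_meas: "r i \<in> borel_measurable \<mu>" for i
  proof -
    have "r i \<in> borel_measurable borel" unfolding r_def by measurable
    from measurable_compose[OF idm this] show ?thesis by simp
  qed
  have r_nonneg: "r i x \<ge> 0" if "x \<ge> 0" for i x using that by (auto simp: r_def)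
  have r_fin: "finite (r i ` space \<mu>)" for i
  proof (rule finite_subset)
    show "r i ` space \<mu> \<subseteq> (\<lambda>k. real_of_int k / 2 ^ i) ` {0..int i * 2 ^ i}"
      by (auto simp: r_def sp)
  qed simp
  have r_sf: "simple_function \<mu> (r i)" for i
    by (rule simple_function_borel_measurable[OF r_meas r_fin])
  have s_sf: "simple_function \<mu> (s i)" for i
    unfolding s_def using r_sf by (rule simple_function_compose1)
  have s_int: "Bochner_Integration.simple_bochner_integrable \<mu> (s i)" for i
    using s_sf by (intro simple_bochner_integrable.intros) (auto simp: emeasure_eq_measure)
  have r_lim: "(\<lambda>i. r i x) \<longlonglongrightarrow> x" if x: "x \<ge> 0" for x
  proof (rule tendsto_sandwich)
    have ev: "\<forall>\<^sub>F i in sequentially. x \<le> real i"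
      by (meson eventually_sequentiallyI order_trans real_nat_ceiling_ge of_nat_mono)
    have "min (int i * 2 ^ i) \<lfloor>2 ^ i * x\<rfloor> = \<lfloor>2 ^ i * x\<rfloor>" if "x \<le> real i" for i
    proof -
      have "2 ^ i * x \<le> 2 ^ i * real i" using that by (intro mult_left_mono) auto
      moreover have "real_of_int (int i * 2 ^ i) = 2 ^ i * real i" by (simp add: mult.commute)
      ultimately have "2 ^ i * x < real_of_int (int i * 2 ^ i) + 1" by linarith
      then have "\<lfloor>2 ^ i * x\<rfloor> \<le> int i * 2 ^ i" by (rule floor_le_iff[THEN iffD2])
      then show ?thesis by simp
    qed
    then have eq: "r i x = real_of_int \<lfloor>2 ^ i * x\<rfloor> / 2 ^ i" if "x \<le> real i" for i
      using that by (simp add: r_def)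
    have "x - (1/2) ^ i \<le> r i x" if "x \<le> real i" for i
    proof -
      have "2 ^ i * x - 1 \<le> real_of_int \<lfloor>2 ^ i * x\<rfloor>" by linarith
      then have "(2 ^ i * x - 1) / 2 ^ i \<le> real_of_int \<lfloor>2 ^ i * x\<rfloor> / 2 ^ i"
        by (rule divide_right_mono) simp
      then show ?thesis using eq[OF that] by (simp add: diff_divide_distrib power_one_over)
    qed
    then show "\<forall>\<^sub>F i in sequentially. x - (1/2) ^ i \<le> r i x"
      using ev by (auto elim: eventually_mono)
    have "r i x \<le> x" if "x \<le> real i" for i
      using eq[OF that] of_int_floor_le[of "2 ^ i * x"] by (simp add: divide_le_eq mult.commute)
    then show "\<forall>\<^sub>F i in sequentially. r i x \<le> x"
      using ev by (auto elim: eventually_mono)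
    have "(\<lambda>i. (1/2::real) ^ i) \<longlonglongrightarrow> 0" by (rule LIMSEQ_power_zero) simp
    from tendsto_diff[OF tendsto_const this, of x] show "(\<lambda>i. x - (1/2) ^ i) \<longlonglongrightarrow> x" by simp
  qed simp
  have lim0: "(\<lambda>i. \<integral>\<^sup>+x. ennreal (norm (f x - s i x)) \<partial>\<mu>) \<longlonglongrightarrow> (\<integral>\<^sup>+x. 0 \<partial>\<mu>)"
  proof (rule nn_integral_dominated_convergence[where w = "\<lambda>_. ennreal (2 * B)"])
    show "(\<lambda>x. ennreal (norm (f x - s i x))) \<in> borel_measurable \<mu>" for i
      using borel_measurable_norm_diff_simple[OF f s_sf[of i]] by measurable
    show "AE x in \<mu>. ennreal (norm (f x - s i x)) \<le> ennreal (2 * B)" for i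
    proof (rule AE_I2)
      fix x assume "x \<in> space \<mu>"
      then have x: "x \<ge> 0" by (simp add: sp)
      have "norm (f x - s i x) \<le> norm (f x) + norm (s i x)" by (rule norm_triangle_ineq4)
      then show "ennreal (norm (f x - s i x)) \<le> ennreal (2 * B)"
        using bound[OF x] bound[OF r_nonneg[OF x, of i]] by (intro ennreal_leI) (simp add: s_def)
    qed
    show "(\<integral>\<^sup>+x. ennreal (2 * B) \<partial>\<mu>) < \<infinity>"
      by (simp add: emeasure_eq_measure ennreal_mult_less_top)
    show "AE x in \<mu>. (\<lambda>i. ennreal (norm (f x - s i x))) \<longlonglongrightarrow> 0"
    proof (rule AE_I2)
      fix x assume "x \<in> space \<mu>"
      then have x: "x \<ge> 0" by (simp add: sp)
      have "(\<lambda>i. f (r i x)) \<longlonglongrightarrow> f x"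
        by (rule continuous_on_tendsto_compose[OF cont r_lim[OF x]]) (use x r_nonneg in auto)
      then have "(\<lambda>i. f x - s i x) \<longlonglongrightarrow> 0"
        using tendsto_diff[OF tendsto_const[of "f x"]] by (fastforce simp: s_def)
      then have "(\<lambda>i. norm (f x - s i x)) \<longlonglongrightarrow> 0" by (rule tendsto_norm_zero)
      then show "(\<lambda>i. ennreal (norm (f x - s i x))) \<longlonglongrightarrow> 0"
        using tendsto_ennrealI by fastforce
    qed
  qed simp_all
  define a where "a i = (\<integral>\<^sup>+x. ennreal (norm (f x - s i x)) \<partial>\<mu>)" for i
  have a0: "a \<longlonglongrightarrow> 0" using lim0 by (simp add: a_def[abs_def])
  have "Cauchy (\<lambda>i. Bochner_Integration.simple_bochner_integral \<mu> (s i))"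
  proof (rule metric_CauchyI)
    fix e :: real assume e: "e > 0"
    then have "\<forall>\<^sub>F i in sequentially. a i < ennreal (e / 2)"
      by (intro order_tendstoD(2)[OF a0]) simp
    then obtain N where N: "\<And>n. n \<ge> N \<Longrightarrow> a n < ennreal (e / 2)"
      by (auto simp: eventually_sequentially)
    show "\<exists>N. \<forall>m\<ge>N. \<forall>n\<ge>N. dist (Bochner_Integration.simple_bochner_integral \<mu> (s m))
        (Bochner_Integration.simple_bochner_integral \<mu> (s n)) < e"
    proof (intro exI[of _ N] allI impI)
      fix m n assume mn: "m \<ge> N" "n \<ge> N"
      have "ennreal (norm (Bochner_Integration.simple_bochner_integral \<mu> (s m)
          - Bochner_Integration.simple_bochner_integral \<mu> (s n))) \<le> a m + a n"
        unfolding a_def by (rule simple_integral_dist_le[OF f s_int s_int])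
      also have "\<dots> < ennreal (e / 2) + ennreal (e / 2)"
        using N mn by (intro add_strict_mono) auto
      also have "\<dots> = ennreal e" using e by (simp flip: ennreal_plus)
      finally show "dist (Bochner_Integration.simple_bochner_integral \<mu> (s m))
        (Bochner_Integration.simple_bochner_integral \<mu> (s n)) < e"
        using e by (simp add: dist_norm ennreal_less_iff)
    qed
  qed
  then obtain y where "(\<lambda>i. Bochner_Integration.simple_bochner_integral \<mu> (s i)) \<longlonglongrightarrow> y"
    using Cauchy_convergent convergent_def by blast
  then show ?thesis
    unfolding has_vec_integral_def using f s_int lim0 by (intro exI conjI exI[of _ s]) auto
qed

section \<open>Uniqueness of Laplace transforms\<close>

definition laplace :: "real measure \<Rightarrow> real \<Rightarrow> real"
  where "laplace \<mu> \<tau> = (\<integral>s. exp (- s * \<tau>) \<partial>\<mu>)"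

lemma halfline_AE: "halfline \<mu> \<Longrightarrow> (\<And>s. s \<ge> 0 \<Longrightarrow> P s) \<Longrightarrow> AE s in \<mu>. P s"
  by (rule AE_I2) (simp add: halfline_space)

lemma integrable_exp_mult:
  fixes g :: "real \<Rightarrow> real"
  assumes \<mu>: "halfline \<mu>" and "continuous_on {0..} g" "\<And>s. s \<ge> 0 \<Longrightarrow> \<bar>g s\<bar> \<le> B" and "\<tau> \<ge> 0"
  shows "integrable \<mu> (\<lambda>s. exp (- s * \<tau>) * g s)"
proof (rule halfline_integrable[OF \<mu>])
  show "continuous_on {0..} (\<lambda>s. exp (- s * \<tau>) * g s)" by (intro continuous_intros assms)
  fix s :: real assume s: "s \<ge> 0"
  have "exp (- s * \<tau>) * \<bar>g s\<bar> \<le> 1 * B"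
    using assms s by (intro mult_mono) auto
  then show "\<bar>exp (- s * \<tau>) * g s\<bar> \<le> B" by (simp add: abs_mult)
qed

lemma integrable_exp:
  assumes "halfline \<mu>" "\<tau> \<ge> 0" shows "integrable \<mu> (\<lambda>s. exp (- s * \<tau>))"
  using integrable_exp_mult[OF assms(1), of "\<lambda>_. 1" 1 \<tau>] assms by simp

text \<open>The factor \<open>exp (- s \<tau>)\<close> tends to \<open>1\<close> boundedly. It serves as a regulariser: functions with this factor
vanish at infinity and can be approximated by exponential sums.\<close>

lemma integral_exp_mult_tendsto:
  fixes g :: "real \<Rightarrow> real"
  assumes \<mu>: "halfline \<mu>" and g: "continuous_on {0..} g" "\<And>s. s \<ge> 0 \<Longrightarrow> \<bar>g s\<bar> \<le> B"
  shows "((\<lambda>\<tau>. \<integral>s. exp (- s * \<tau>) * g s \<partial>\<mu>) \<longlongrightarrow> (\<integral>s. g s \<partial>\<mu>)) (at_right 0)"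
proof (rule tendsto_at_right_sequentially[of 0 1])
  fix t :: "nat \<Rightarrow> real" assume t: "\<And>n. 0 < t n" "t \<longlonglongrightarrow> 0"
  interpret finite_measure \<mu> using \<mu> by (rule halfline_finite)
  show "(\<lambda>n. \<integral>s. exp (- s * t n) * g s \<partial>\<mu>) \<longlonglongrightarrow> (\<integral>s. g s \<partial>\<mu>)"
  proof (rule integral_dominated_convergence[where w = "\<lambda>_. B"])
    show "g \<in> borel_measurable \<mu>" using halfline_measurable[OF \<mu> g(1)] .
    show "(\<lambda>s. exp (- s * t n) * g s) \<in> borel_measurable \<mu>" for n
      using integrable_exp_mult[OF \<mu> g, of "t n"] t(1)[of n] by auto
    show "AE s in \<mu>. (\<lambda>n. exp (- s * t n) * g s) \<longlonglongrightarrow> g s"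
    proof (rule halfline_AE[OF \<mu>])
      fix s :: real
      have "(\<lambda>n. exp (- s * t n) * g s) \<longlonglongrightarrow> exp (- s * 0) * g s"
        by (intro tendsto_intros t)
      then show "(\<lambda>n. exp (- s * t n) * g s) \<longlonglongrightarrow> g s" by simp
    qed
    show "AE s in \<mu>. norm (exp (- s * t n) * g s) \<le> B" for n
    proof (rule halfline_AE[OF \<mu>])
      fix s :: real assume s: "s \<ge> 0"
      have "exp (- s * t n) * \<bar>g s\<bar> \<le> 1 * B"
        using s t(1)[of n] g by (intro mult_mono) auto
      then show "norm (exp (- s * t n) * g s) \<le> B" by (simp add: abs_mult)
    qed
  qed simp
qed simp

lemma laplace_tendsto_mass:
  assumes "halfline \<mu>" shows "(laplace \<mu> \<longlongrightarrow> measure \<mu> {0..}) (at_right 0)"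
  using integral_exp_mult_tendsto[OF assms, of "\<lambda>_. 1" 1] halfline_space[OF assms]
  by (simp add: laplace_def[abs_def])

lemma laplace_nonneg: "laplace \<mu> \<tau> \<ge> 0"
  by (simp add: laplace_def)

text \<open>In the variable \<open>y = exp (- s \<epsilon>)\<close> the function \<open>exp (- s \<epsilon>) g s\<close> becomes a continuous function \<open>h\<close> on
\<open>[0, 1]\<close> with \<open>h 0 = 0\<close>. Its Bernstein polynomials are combinations of the powers \<open>y\<^sup>k\<close> with \<open>k \<ge> 1\<close>, that is,
of exponentials \<open>exp (- s k \<epsilon>)\<close>, whose integrals vanish by hypothesis.\<close>

lemma signed_laplace_zero_imp_exp_integral_zero:
  fixes g :: "real \<Rightarrow> real"
  assumes I: "finite I" and \<mu>: "\<And>i. i \<in> I \<Longrightarrow> halfline (\<mu> i)"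
    and zero: "\<And>\<tau>. \<tau> > 0 \<Longrightarrow> (\<Sum>i\<in>I. c i * laplace (\<mu> i) \<tau>) = 0"
    and g: "continuous_on {0..} g" "\<And>s. s \<ge> 0 \<Longrightarrow> \<bar>g s\<bar> \<le> B" and \<epsilon>: "\<epsilon> > 0"
  shows "(\<Sum>i\<in>I. c i * (\<integral>s. exp (- s * \<epsilon>) * g s \<partial>\<mu> i)) = 0"
proof -
  have B: "B \<ge> 0" using g(2)[of 0] by simp
  define h where "h y = (if y \<le> 0 then 0 else y * g (- ln y / \<epsilon>))" for y :: real
  have h_exp: "h (exp (- s * \<epsilon>)) = exp (- s * \<epsilon>) * g s" for s
    using \<epsilon> by (simp add: h_def)
  have h_cont: "continuous_on {0..1} h"
  proof (rule continuous_on_eq_continuous_within[THEN iffD2], rule ballI)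
    fix y :: real assume y: "y \<in> {0..1}"
    show "continuous (at y within {0..1}) h"
    proof (cases "y = 0")
      case True
      have "((\<lambda>y. h y) \<longlongrightarrow> 0) (at 0 within {0..1})"
      proof (rule Lim_null_comparison)
        show "\<forall>\<^sub>F y in at 0 within {0..1}. norm (h y) \<le> y * B"
        proof (subst eventually_at_filter, rule always_eventually, safe)
          fix y :: real assume "y \<in> {0..1}" "y \<noteq> 0"
          then have "y > 0" "- ln y / \<epsilon> \<ge> 0" using \<epsilon> by (auto simp: divide_nonpos_pos)
          then show "norm (h y) \<le> y * B"
            using g(2)[of "- ln y / \<epsilon>"] by (simp add: h_def abs_mult)
        qed
        have "((\<lambda>y. y * B) \<longlongrightarrow> 0 * B) (at 0 within {0..1})" by (intro tendsto_intros)
        then show "((\<lambda>y. y * B) \<longlongrightarrow> 0) (at 0 within {0..1})" by simp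
      qed
      moreover have "h 0 = 0" by (simp add: h_def)
      ultimately show ?thesis using True by (simp add: continuous_within)
    next
      case False
      then have y0: "y > 0" using y by simp
      have "continuous_on {0<..1} (\<lambda>y. y * g (- ln y / \<epsilon>))"
        using \<epsilon> by (intro continuous_intros continuous_on_compose2[OF g(1)])
          (auto simp: divide_nonpos_pos)
      then have "continuous_on {0<..1} h"
        by (rule continuous_on_eq) (auto simp: h_def)
      then have "continuous (at y within {0<..1}) h"
        using y y0 by (auto simp: continuous_on_eq_continuous_within)
      moreover have "at y within {0<..1} = at y within {0..1}"
      proof (rule at_within_nhd)
        show "y \<in> {0<..}" using y0 by simp
      qed (use y0 in auto)
      ultimately show ?thesis by simp
    qed
  qed
  define A where "A = (\<Sum>i\<in>I. \<bar>c i\<bar> * measure (\<mu> i) {0..})"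
  have A: "A \<ge> 0" unfolding A_def by (intro sum_nonneg) auto
  define L where "L f = (\<Sum>i\<in>I. c i * (\<integral>s. f s \<partial>\<mu> i))" for f :: "real \<Rightarrow> real"
  have "\<bar>L (\<lambda>s. exp (- s * \<epsilon>) * g s)\<bar> \<le> e" if e: "e > 0" for e
  proof -
    define d where "d = e / (2 * (A + 1))"
    have d: "d > 0" using e A by (simp add: d_def)
    obtain N where N: "\<And>n x. N \<le> n \<and> x \<in> {0..1} \<longrightarrow>
        \<bar>h x - (\<Sum>k\<le>n. h (k / n) * Bernstein n k x)\<bar> < d"
      using Bernstein_Weierstrass[OF h_cont d] by blast
    \<comment> \<open>the degree must be positive for \<open>k / n\<close> to be a node\<close>
    define n where "n = max N 1"
    \<comment> \<open>the term \<open>k = 0\<close> of the Bernstein polynomial vanishes because \<open>h 0 = 0\<close>\<close>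
    define p where "p x = (\<Sum>k\<le>n. h (k / n) * Bernstein n k x)" for x
    have hp: "\<bar>h x - p x\<bar> < d" if "x \<in> {0..1}" for x
      using N[of n x] that by (simp add: p_def n_def)
    have int1: "integrable (\<mu> i) (\<lambda>s. exp (- s * \<epsilon>) * g s)" if "i \<in> I" for i
      using integrable_exp_mult[OF \<mu>[OF that] g] \<epsilon> by simp
    have pow: "exp (- s * \<epsilon>) ^ k = exp (- s * (real k * \<epsilon>))" for s k
      by (simp add: exp_of_nat_mult[symmetric] mult_ac)
    have bern_sum: "Bernstein n k y = (\<Sum>j\<le>n-k. real (n choose k) * (real ((n-k) choose j) * (-1) ^ j) * y ^ (k + j))"
      for k and y :: real
    proof -
      have "(1 - y) ^ (n - k) = (\<Sum>j\<le>n-k. real ((n-k) choose j) * ((-1) ^ j * y ^ j))"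
        using binomial_ring[of "- y" 1 "n - k"] by (simp add: power_minus[of y])
      then show ?thesis by (simp add: Bernstein_def sum_distrib_left power_add mult_ac)
    qed
    have bern: "Bernstein n k (exp (- s * \<epsilon>))
        = (\<Sum>j\<le>n-k. real (n choose k) * (real ((n-k) choose j) * (-1) ^ j) * exp (- s * (real (k + j) * \<epsilon>)))"
      for k s
      unfolding bern_sum pow ..
    have intB: "integrable (\<mu> i) (\<lambda>s. h (k / n) * Bernstein n k (exp (- s * \<epsilon>)))" if "i \<in> I" for i k
      unfolding bern using \<mu>[OF that] \<epsilon>
      by (intro integrable_mult_right Bochner_Integration.integrable_sum integrable_exp) auto
    have LB: "L (\<lambda>s. h (k / n) * Bernstein n k (exp (- s * \<epsilon>))) = 0" for k
    proof (cases "k = 0")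
      case True
      then show ?thesis by (simp add: L_def h_def)
    next
      case False
      have "L (\<lambda>s. h (k / n) * Bernstein n k (exp (- s * \<epsilon>)))
         = (\<Sum>i\<in>I. c i * (h (k / n) * (\<Sum>j\<le>n-k. real (n choose k) * (real ((n-k) choose j) * (-1) ^ j)
              * laplace (\<mu> i) (real (k + j) * \<epsilon>))))"
        unfolding L_def
      proof (intro sum.cong refl arg_cong[of _ _ "\<lambda>u. _ * u"])
        fix i assume i: "i \<in> I"
        show "(\<integral>s. h (k / n) * Bernstein n k (exp (- s * \<epsilon>)) \<partial>\<mu> i)
          = h (k / n) * (\<Sum>j\<le>n-k. real (n choose k) * (real ((n-k) choose j) * (-1) ^ j)
              * laplace (\<mu> i) (real (k + j) * \<epsilon>))"
          unfolding bern laplace_def using integrable_exp[OF \<mu>[OF i]] \<epsilon>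
          by (simp only: integral_mult_right_zero Bochner_Integration.integral_sum integrable_mult_right
              mult_nonneg_nonneg of_nat_0_le_iff less_imp_le)
      qed
      also have "\<dots> = h (k / n) * (\<Sum>j\<le>n-k. real (n choose k) * (real ((n-k) choose j) * (-1) ^ j)
              * (\<Sum>i\<in>I. c i * laplace (\<mu> i) (real (k + j) * \<epsilon>)))"
        unfolding sum_distrib_left by (subst sum.swap) (simp add: mult_ac)
      also have "\<dots> = 0" using zero \<epsilon> False by simp
      finally show ?thesis .
    qed
    have intp: "integrable (\<mu> i) (\<lambda>s. p (exp (- s * \<epsilon>)))" if "i \<in> I" for i
      unfolding p_def using intB[OF that] by (intro Bochner_Integration.integrable_sum) auto
    have "L (\<lambda>s. p (exp (- s * \<epsilon>))) = (\<Sum>k\<le>n. L (\<lambda>s. h (k / n) * Bernstein n k (exp (- s * \<epsilon>))))"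
    proof -
      have "(\<integral>s. p (exp (- s * \<epsilon>)) \<partial>\<mu> i) = (\<Sum>k\<le>n. \<integral>s. h (k / n) * Bernstein n k (exp (- s * \<epsilon>)) \<partial>\<mu> i)"
        if "i \<in> I" for i
        unfolding p_def by (rule Bochner_Integration.integral_sum) (rule intB[OF that])
      then have "L (\<lambda>s. p (exp (- s * \<epsilon>))) = (\<Sum>i\<in>I. \<Sum>k\<le>n. c i * (\<integral>s. h (k / n) * Bernstein n k (exp (- s * \<epsilon>)) \<partial>\<mu> i))"
        unfolding L_def by (intro sum.cong refl) (simp add: sum_distrib_left)
      then show ?thesis unfolding L_def by (subst (asm) sum.swap)
    qed
    then have Lp: "L (\<lambda>s. p (exp (- s * \<epsilon>))) = 0" using LB by simp
    have "L (\<lambda>s. exp (- s * \<epsilon>) * g s) = L (\<lambda>s. exp (- s * \<epsilon>) * g s) - L (\<lambda>s. p (exp (- s * \<epsilon>)))"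
      using Lp by simp
    also have "\<dots> = (\<Sum>i\<in>I. c i * (\<integral>s. exp (- s * \<epsilon>) * g s - p (exp (- s * \<epsilon>)) \<partial>\<mu> i))"
      unfolding L_def sum_subtractf[symmetric]
      by (rule sum.cong[OF refl]) (simp only: Bochner_Integration.integral_diff[OF int1 intp] right_diff_distrib)
    also have "\<bar>\<dots>\<bar> \<le> (\<Sum>i\<in>I. \<bar>c i\<bar> * measure (\<mu> i) {0..} * d)"
    proof (intro order_trans[OF sum_abs] sum_mono)
      fix i assume i: "i \<in> I"
      interpret finite_measure "\<mu> i" using \<mu>[OF i] by (rule halfline_finite)
      have "\<bar>\<integral>s. exp (- s * \<epsilon>) * g s - p (exp (- s * \<epsilon>)) \<partial>\<mu> i\<bar> \<le> (\<integral>s. d \<partial>\<mu> i)"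
      proof (rule integral_abs_bound[THEN order_trans], rule integral_mono_AE)
        show "integrable (\<mu> i) (\<lambda>s. \<bar>exp (- s * \<epsilon>) * g s - p (exp (- s * \<epsilon>))\<bar>)"
          using int1[OF i] intp[OF i] by auto
        show "AE s in \<mu> i. \<bar>exp (- s * \<epsilon>) * g s - p (exp (- s * \<epsilon>))\<bar> \<le> d"
        proof (rule halfline_AE[OF \<mu>[OF i]])
          fix s :: real assume "s \<ge> 0"
          then have "exp (- s * \<epsilon>) \<in> {0..1}" using \<epsilon> by simp
          from hp[OF this] show "\<bar>exp (- s * \<epsilon>) * g s - p (exp (- s * \<epsilon>))\<bar> \<le> d"
            unfolding h_exp by linarith
        qed
      qed simp
      then have "\<bar>c i\<bar> * \<bar>\<integral>s. exp (- s * \<epsilon>) * g s - p (exp (- s * \<epsilon>)) \<partial>\<mu> i\<bar>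
          \<le> \<bar>c i\<bar> * (measure (\<mu> i) {0..} * d)"
        by (intro mult_left_mono) (auto simp: halfline_space[OF \<mu>[OF i]])
      then show "\<bar>c i * (\<integral>s. exp (- s * \<epsilon>) * g s - p (exp (- s * \<epsilon>)) \<partial>\<mu> i)\<bar>
          \<le> \<bar>c i\<bar> * measure (\<mu> i) {0..} * d"
        by (simp add: abs_mult mult_ac)
    qed
    also have "\<dots> = A * d" by (simp add: A_def sum_distrib_right)
    also have "\<dots> \<le> e" using A e by (simp add: d_def field_simps)
    finally show ?thesis .
  qed
  then have "\<bar>L (\<lambda>s. exp (- s * \<epsilon>) * g s)\<bar> \<le> 0"
    by (rule field_le_epsilon[of _ 0, simplified])
  then show ?thesis by (simp add: L_def)
qed

text \<open>Uniqueness of Laplace transforms, for a finite linear combination of measures: such a combination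
stands for a signed measure, and this form avoids Jordan decompositions.\<close>

theorem signed_laplace_zero_imp_integral_zero:
  fixes g :: "real \<Rightarrow> real"
  assumes "finite I" and \<mu>: "\<And>i. i \<in> I \<Longrightarrow> halfline (\<mu> i)"
    and "\<And>\<tau>. \<tau> > 0 \<Longrightarrow> (\<Sum>i\<in>I. c i * laplace (\<mu> i) \<tau>) = 0"
    and g: "continuous_on {0..} g" "\<And>s. s \<ge> 0 \<Longrightarrow> \<bar>g s\<bar> \<le> B"
  shows "(\<Sum>i\<in>I. c i * (\<integral>s. g s \<partial>\<mu> i)) = 0"
proof -
  have "((\<lambda>\<epsilon>. \<Sum>i\<in>I. c i * (\<integral>s. exp (- s * \<epsilon>) * g s \<partial>\<mu> i)) \<longlongrightarrow> (\<Sum>i\<in>I. c i * (\<integral>s. g s \<partial>\<mu> i))) (at_right 0)"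
    by (intro tendsto_intros integral_exp_mult_tendsto[OF \<mu> g]) auto
  moreover have "((\<lambda>\<epsilon>. \<Sum>i\<in>I. c i * (\<integral>s. exp (- s * \<epsilon>) * g s \<partial>\<mu> i)) \<longlongrightarrow> 0) (at_right 0)"
  proof (rule tendsto_eventually, rule eventually_mono[OF eventually_at_right_less])
    fix \<epsilon> :: real assume "0 < \<epsilon>"
    with assms show "(\<Sum>i\<in>I. c i * (\<integral>s. exp (- s * \<epsilon>) * g s \<partial>\<mu> i)) = 0"
      by (rule signed_laplace_zero_imp_exp_integral_zero)
  qed
  ultimately show ?thesis by (rule tendsto_unique[OF trivial_limit_at_right_real])
qed

section \<open>Convolutions and exponential measures\<close>

definition conv :: "real measure \<Rightarrow> real measure \<Rightarrow> real measure"
  where "conv \<mu> \<nu> = distr (\<mu> \<Otimes>\<^sub>M \<nu>) (restrict_space borel {0..}) (\<lambda>(s, u). s + u)"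

lemma conv_measurable:
  assumes \<mu>: "halfline \<mu>" and \<nu>: "halfline \<nu>"
  shows "(\<lambda>(s, u). s + u) \<in> measurable (\<mu> \<Otimes>\<^sub>M \<nu>) (restrict_space borel {0..})"
proof (rule measurable_restrict_space2)
  have "fst \<in> borel_measurable (\<mu> \<Otimes>\<^sub>M \<nu>)" "snd \<in> borel_measurable (\<mu> \<Otimes>\<^sub>M \<nu>)"
    using measurable_compose[OF measurable_fst halfline_measurable[OF \<mu>, of "\<lambda>x. x"], of \<nu>]
      measurable_compose[OF measurable_snd halfline_measurable[OF \<nu>, of "\<lambda>x. x"], of \<mu>] by auto
  then show "(\<lambda>(s, u). s + u) \<in> borel_measurable (\<mu> \<Otimes>\<^sub>M \<nu>)"
    unfolding case_prod_beta by (rule borel_measurable_add)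
qed (auto simp: space_pair_measure halfline_space[OF \<mu>] halfline_space[OF \<nu>])

lemma halfline_conv:
  assumes "halfline \<mu>" "halfline \<nu>"
  shows "halfline (conv \<mu> \<nu>)"
  using assms conv_measurable[OF assms]
  by (auto simp: finite_measure_on_halfline_def conv_def intro!: finite_measure.finite_measure_distr
      finite_measure_pair_measure)

lemma integral_conv:
  fixes g :: "real \<Rightarrow> real"
  assumes \<mu>: "halfline \<mu>" and \<nu>: "halfline \<nu>"
    and g: "continuous_on {0..} g" "\<And>s. s \<ge> 0 \<Longrightarrow> \<bar>g s\<bar> \<le> B"
  shows "(\<integral>v. g v \<partial>conv \<mu> \<nu>) = (\<integral>s. (\<integral>u. g (s + u) \<partial>\<nu>) \<partial>\<mu>)"
proof -
  interpret \<mu>: finite_measure \<mu> using \<mu> by (rule halfline_finite)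
  interpret \<nu>: finite_measure \<nu> using \<nu> by (rule halfline_finite)
  interpret pair_sigma_finite \<mu> \<nu> ..
  have fin: "finite_measure (\<mu> \<Otimes>\<^sub>M \<nu>)"
    by (intro finite_measure_pair_measure \<mu>.finite_measure_axioms \<nu>.finite_measure_axioms)
  have gm: "g \<in> borel_measurable (restrict_space borel {0..})"
    using g(1) by (rule borel_measurable_continuous_on_restrict)
  have int: "integrable (\<mu> \<Otimes>\<^sub>M \<nu>) (\<lambda>p. g (case p of (s, u) \<Rightarrow> s + u))"
  proof (rule finite_measure.integrable_const_bound[OF fin, of _ B])
    show "(\<lambda>p. g (case p of (s, u) \<Rightarrow> s + u)) \<in> borel_measurable (\<mu> \<Otimes>\<^sub>M \<nu>)"
      by (rule measurable_compose[OF conv_measurable[OF \<mu> \<nu>] gm])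
    show "AE p in \<mu> \<Otimes>\<^sub>M \<nu>. norm (g (case p of (s, u) \<Rightarrow> s + u)) \<le> B"
      by (rule AE_I2) (auto simp: space_pair_measure halfline_space[OF \<mu>] halfline_space[OF \<nu>] g)
  qed
  have "(\<integral>v. g v \<partial>conv \<mu> \<nu>) = (\<integral>p. g (case p of (s, u) \<Rightarrow> s + u) \<partial>(\<mu> \<Otimes>\<^sub>M \<nu>))"
    unfolding conv_def by (rule integral_distr[OF conv_measurable[OF \<mu> \<nu>] gm])
  also have "\<dots> = (\<integral>s. (\<integral>u. g (s + u) \<partial>\<nu>) \<partial>\<mu>)"
    using integral_fst'[OF int] by simp
  finally show ?thesis .
qed

lemma laplace_conv:
  assumes "halfline \<mu>" "halfline \<nu>" "\<tau> \<ge> 0"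
  shows "laplace (conv \<mu> \<nu>) \<tau> = laplace \<mu> \<tau> * laplace \<nu> \<tau>"
proof -
  have "laplace (conv \<mu> \<nu>) \<tau> = (\<integral>s. (\<integral>u. exp (- (s + u) * \<tau>) \<partial>\<nu>) \<partial>\<mu>)"
    unfolding laplace_def using assms
    by (intro integral_conv[where B = 1] continuous_intros) auto
  also have "\<dots> = (\<integral>s. (\<integral>u. exp (- s * \<tau>) * exp (- u * \<tau>) \<partial>\<nu>) \<partial>\<mu>)"
    by (simp add: exp_add[symmetric] algebra_simps)
  finally show ?thesis by (simp add: laplace_def)
qed

definition exp_measure :: "real \<Rightarrow> real measure"
  where "exp_measure c = density (restrict_space lborel {0..}) (\<lambda>s. ennreal (exp (- c * s)))"

lemma nn_integral_exp:
  fixes c :: real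
  assumes c: "c > 0"
  shows "(\<integral>\<^sup>+s. ennreal (exp (- c * s)) * indicator {0..} s \<partial>lborel) = ennreal (1 / c)"
proof -
  have "((\<lambda>s. - exp (- c * s) / c) \<longlongrightarrow> - 0 / c) at_top"
    using c by (intro tendsto_intros filterlim_compose[OF exp_at_bot]
        filterlim_tendsto_neg_mult_at_bot[OF tendsto_const] filterlim_ident) auto
  then have "(\<integral>\<^sup>+s. ennreal (exp (- c * s)) * indicator {0..} s \<partial>lborel) = 0 - (- exp (- c * 0) / c)"
    using c by (intro nn_integral_FTC_atLeast) (auto intro!: derivative_eq_intros)
  then show ?thesis by simp
qed

lemma integral_exp_measure:
  fixes g :: "real \<Rightarrow> real"
  assumes "continuous_on {0..} g"
  shows "(\<integral>s. g s \<partial>exp_measure c) = (\<integral>s. exp (- c * s) * g s \<partial>restrict_space lborel {0..})"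
proof -
  have "g \<in> borel_measurable (restrict_space lborel {0..})"
    using borel_measurable_continuous_on_restrict[OF assms] by (simp cong: measurable_cong_sets)
  moreover have "(\<lambda>s. exp (- c * s)) \<in> borel_measurable (restrict_space lborel {0..})"
    by (intro measurable_restrict_space1) measurable
  ultimately show ?thesis unfolding exp_measure_def by (subst integral_density) auto
qed

lemma halfline_exp_measure:
  assumes "c > 0" shows "halfline (exp_measure c)"
proof -
  have [measurable]: "(\<lambda>s. exp (- c * s)) \<in> borel_measurable (restrict_space lborel {0..})"
    by (intro measurable_restrict_space1) measurable
  have "emeasure (exp_measure c) (space (exp_measure c))
    = (\<integral>\<^sup>+s. ennreal (exp (- c * s)) \<partial>restrict_space lborel {0..})"
  proof -
    have "emeasure (exp_measure c) (space (restrict_space lborel {0..}))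
        = (\<integral>\<^sup>+s. ennreal (exp (- c * s)) \<partial>restrict_space lborel {0..})"
      unfolding exp_measure_def
      by (subst emeasure_density[OF _ sets.top]) (measurable, auto intro!: nn_integral_cong)
    then show ?thesis by (simp add: exp_measure_def)
  qed
  also have "\<dots> = ennreal (1 / c)"
    using nn_integral_exp[OF assms] by (subst nn_integral_restrict_space) auto
  finally have "finite_measure (exp_measure c)" by (intro finite_measureI) simp
  moreover have "sets (exp_measure c) = sets (restrict_space borel {0..})"
    by (simp add: exp_measure_def sets_restrict_space)
  ultimately show ?thesis by (simp add: finite_measure_on_halfline_def)
qed

lemma laplace_exp_measure:
  assumes "c > 0" "\<tau> \<ge> 0" shows "laplace (exp_measure c) \<tau> = 1 / (c + \<tau>)"
proof -
  have "laplace (exp_measure c) \<tau> = (\<integral>s. exp (- (c + \<tau>) * s) \<partial>restrict_space lborel {0..})"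
    unfolding laplace_def by (subst integral_exp_measure)
      (auto intro!: continuous_intros simp: exp_add[symmetric] algebra_simps)
  also have "\<dots> = enn2real (\<integral>\<^sup>+s. ennreal (exp (- (c + \<tau>) * s)) \<partial>restrict_space lborel {0..})"
    by (intro integral_eq_nn_integral measurable_restrict_space1) auto
  also have "\<dots> = enn2real (ennreal (1 / (c + \<tau>)))"
    using nn_integral_exp[of "c + \<tau>"] assms by (subst nn_integral_restrict_space) auto
  finally show ?thesis using assms by simp
qed

text \<open>The densities \<open>u\<^sup>+ exp (- s)\<close> and \<open>u\<^sup>- exp (- s)\<close> define finite measures with equal Laplace transforms.
Integrating \<open>u\<close> itself against both gives \<open>\<integral> u\<^sup>2 exp (- s) ds = 0\<close>.\<close>

lemma exp_integrals_zero_imp_zero: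
  fixes u :: "real \<Rightarrow> real"
  assumes u: "continuous_on {0..} u" "\<And>s. s \<ge> 0 \<Longrightarrow> \<bar>u s\<bar> \<le> B"
    and zero: "\<And>c. c > 0 \<Longrightarrow> (\<integral>s. u s \<partial>exp_measure c) = 0" and t: "t \<ge> 0"
  shows "u t = 0"
proof -
  define E where "E = exp_measure 1"
  have E: "halfline E" by (simp add: E_def halfline_exp_measure)
  define D where "D w = density E (\<lambda>s. ennreal (w s))" for w :: "real \<Rightarrow> real"
  have D: "halfline (D w)" "\<And>g. continuous_on {0..} g \<Longrightarrow> (\<integral>s. g s \<partial>D w) = (\<integral>s. w s * g s \<partial>E)"
    if w: "continuous_on {0..} w" "\<And>s. s \<ge> 0 \<Longrightarrow> 0 \<le> w s" "\<And>s. s \<ge> 0 \<Longrightarrow> w s \<le> B" for w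
  proof -
    have wm: "w \<in> borel_measurable E" by (rule halfline_measurable[OF E w(1)])
    have "integrable E w" using w by (intro halfline_integrable[OF E, of _ B]) auto
    then have "(\<integral>\<^sup>+s. ennreal (w s) \<partial>E) = ennreal (\<integral>s. w s \<partial>E)"
      by (rule nn_integral_eq_integral) (rule halfline_AE[OF E w(2)])
    moreover have "emeasure (D w) (space (D w)) = (\<integral>\<^sup>+s. ennreal (w s) \<partial>E)"
      using wm unfolding D_def by (subst emeasure_density) (auto intro!: nn_integral_cong)
    ultimately have "finite_measure (D w)" by (intro finite_measureI) simp
    then show "halfline (D w)" using halfline_sets[OF E] by (simp add: finite_measure_on_halfline_def D_def)
    show "(\<integral>s. g s \<partial>D w) = (\<integral>s. w s * g s \<partial>E)" if "continuous_on {0..} g" for g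
      unfolding D_def using wm halfline_measurable[OF E that] halfline_AE[OF E w(2)]
      by (subst integral_density) auto
  qed
  define p where "p s = max 0 (u s)" for s
  define n where "n s = max 0 (- u s)" for s
  have B: "B \<ge> 0" using u(2)[of 0] by simp
  have p: "continuous_on {0..} p" "\<And>s. s \<ge> 0 \<Longrightarrow> 0 \<le> p s" "\<And>s. s \<ge> 0 \<Longrightarrow> p s \<le> B"
    using u(2) B by (auto simp: p_def abs_le_iff intro!: continuous_intros u(1))
  have n: "continuous_on {0..} n" "\<And>s. s \<ge> 0 \<Longrightarrow> 0 \<le> n s" "\<And>s. s \<ge> 0 \<Longrightarrow> n s \<le> B"
    using u(2) B by (auto simp: n_def abs_le_iff intro!: continuous_intros u(1))
  have pn: "p s - n s = u s" for s by (simp add: p_def n_def)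
  define \<mu> where "\<mu> i = (if i = (0::nat) then D p else D n)" for i
  define c where "c i = (if i = (0::nat) then 1 else - 1 :: real)" for i
  have "(\<Sum>i\<in>{0, 1}. c i * (\<integral>s. u s \<partial>\<mu> i)) = 0"
  proof (rule signed_laplace_zero_imp_integral_zero)
    show "halfline (\<mu> i)" for i using D(1)[OF p] D(1)[OF n] by (simp add: \<mu>_def)
    fix \<tau> :: real assume \<tau>: "\<tau> > 0"
    have ex: "continuous_on {0..} (\<lambda>s. exp (- s * \<tau>))" by (intro continuous_intros)
    have "integrable E (\<lambda>s. exp (- s * \<tau>) * p s)" and "integrable E (\<lambda>s. exp (- s * \<tau>) * n s)"
      using integrable_exp_mult[OF E p(1), of B \<tau>] integrable_exp_mult[OF E n(1), of B \<tau>] p n \<tau> by auto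
    then have "(\<integral>s. exp (- s * \<tau>) * p s \<partial>E) - (\<integral>s. exp (- s * \<tau>) * n s \<partial>E) = (\<integral>s. exp (- s * \<tau>) * (p s - n s) \<partial>E)"
      by (simp only: right_diff_distrib Bochner_Integration.integral_diff)
    then have "(\<integral>s. p s * exp (- s * \<tau>) \<partial>E) - (\<integral>s. n s * exp (- s * \<tau>) \<partial>E) = (\<integral>s. exp (- s * \<tau>) * (p s - n s) \<partial>E)"
      by (simp only: mult.commute)
    also have "\<dots> = (\<integral>s. exp (- s * \<tau>) * u s \<partial>E)" by (simp only: pn)
    also have "\<dots> = (\<integral>s. u s \<partial>exp_measure (1 + \<tau>))"
    proof -
      have "exp (- 1 * s) * (exp (- s * \<tau>) * u s) = exp (- (1 + \<tau>) * s) * u s" for s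
      proof -
        have "exp (- 1 * s) * exp (- s * \<tau>) = exp (- (1 + \<tau>) * s)"
          unfolding exp_add[symmetric] by (simp add: algebra_simps)
        then show ?thesis by (simp only: mult.assoc[symmetric])
      qed
      moreover have "continuous_on {0..} (\<lambda>s. exp (- s * \<tau>) * u s)"
        by (intro continuous_intros u(1))
      ultimately show ?thesis
        unfolding E_def by (simp only: integral_exp_measure u(1))
    qed
    also have "\<dots> = 0" using zero \<tau> by simp
    finally show "(\<Sum>i\<in>{0, 1}. c i * laplace (\<mu> i) \<tau>) = 0"
      by (simp add: c_def \<mu>_def laplace_def D(2)[OF p ex, simplified] D(2)[OF n ex, simplified])
  qed (use u in auto)
  then have "(\<integral>s. p s * u s \<partial>E) - (\<integral>s. n s * u s \<partial>E) = 0"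
    by (simp add: c_def \<mu>_def D(2)[OF p u(1)] D(2)[OF n u(1)])
  moreover have int: "integrable E (\<lambda>s. w s * u s)"
    if w: "continuous_on {0..} w" "\<And>s. s \<ge> 0 \<Longrightarrow> \<bar>w s\<bar> \<le> B" for w
  proof (rule halfline_integrable[OF E])
    show "continuous_on {0..} (\<lambda>s. w s * u s)" by (intro continuous_intros w u(1))
    fix s :: real assume s: "s \<ge> 0"
    show "\<bar>w s * u s\<bar> \<le> B * B"
      unfolding abs_mult by (rule mult_mono[OF w(2)[OF s] u(2)[OF s] B]) simp
  qed
  have "integrable E (\<lambda>s. p s * u s)" "integrable E (\<lambda>s. n s * u s)"
    using p n by (intro int; simp)+
  ultimately have "(\<integral>s. p s * u s - n s * u s \<partial>E) = 0"
    by (simp only: Bochner_Integration.integral_diff)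
  then have "(\<integral>s. u s * u s \<partial>E) = 0" by (simp only: pn left_diff_distrib[symmetric])
  moreover have "integrable E (\<lambda>s. u s * u s)" by (rule int[OF u])
  ultimately have "AE s in E. u s * u s = 0"
    using integral_nonneg_eq_0_iff_AE[of E "\<lambda>s. u s * u s"] by simp
  then have "AE s in restrict_space lborel {0..}. u s = 0"
    unfolding E_def exp_measure_def
    by (subst (asm) AE_density) (auto intro!: measurable_restrict_space1)
  then have ae: "AE s in lborel. s \<in> {0..} \<longrightarrow> u s = 0"
    by (subst (asm) AE_restrict_space_iff) auto
  show ?thesis
  proof (rule ccontr)
    assume ne: "u t \<noteq> 0"
    have "\<forall>\<^sub>F s in at t within {0..}. u s \<noteq> 0"
      using u(1) t ne by (intro tendsto_imp_eventually_ne[of _ "u t"]) (auto simp: continuous_on_def)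
    then obtain d where d: "d > 0" "\<And>s. s \<ge> 0 \<Longrightarrow> s \<noteq> t \<Longrightarrow> dist s t < d \<Longrightarrow> u s \<noteq> 0"
      by (auto simp: eventually_at)
    have "u s \<noteq> 0" if "s \<in> {t..t + d/2}" for s
      using d that t ne by (cases "s = t") (auto simp: dist_real_def)
    then have "AE s in lborel. s \<notin> {t..t + d/2}"
      using ae t by (auto elim!: eventually_mono)
    then have "{t..t + d/2} \<in> null_sets lborel"
      by (subst AE_iff_null_sets) auto
    then show False using d(1) by (auto simp: null_sets_def)
  qed
qed

section \<open>Operators given by measures on the half-line\<close>

locale bounded_semigroup =
  fixes T :: "real \<Rightarrow> ('a::complex_banach \<Rightarrow>\<^sub>L 'a)"
  assumes bounded_semigroup: "bounded_C0_semigroup T"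
begin

abbreviation "M \<equiv> sg_bound T"

lemma norm_T_le: "t \<ge> 0 \<Longrightarrow> norm (T t) \<le> M"
proof -
  have "bounded (T ` {0..})" using bounded_semigroup by (simp add: bounded_C0_semigroup_def)
  then obtain a where "\<And>t. t \<ge> 0 \<Longrightarrow> norm (T t) \<le> a" by (auto simp: bounded_iff)
  then have "bdd_above ((\<lambda>t. norm (T t)) ` {0..})" by (intro bdd_aboveI2[where M = a]) auto
  then show "t \<ge> 0 \<Longrightarrow> norm (T t) \<le> M" unfolding sg_bound_def by (intro cSUP_upper) auto
qed

lemma M_nonneg: "M \<ge> 0"
  using norm_T_le[of 0] norm_ge_zero order_trans by blast

lemma norm_T_apply_le: "t \<ge> 0 \<Longrightarrow> norm (T t x) \<le> M * norm x"
  using norm_blinfun[of "T t" x] norm_T_le[of t] mult_right_mono[of "norm (T t)" M "norm x"] by simp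

lemma T_0: "T 0 x = x"
  and T_add: "s \<ge> 0 \<Longrightarrow> t \<ge> 0 \<Longrightarrow> T (s + t) x = T s (T t x)"
  and T_clinear: "t \<ge> 0 \<Longrightarrow> T t (c *\<^sub>C x) = c *\<^sub>C T t x"
  and T_lim: "((\<lambda>t. T t x) \<longlongrightarrow> x) (at_right 0)"
  using bounded_semigroup
  by (auto simp: bounded_C0_semigroup_def C0_semigroup_def clinear_op_def)

lemma M_ge_1: "x \<noteq> (0::'a) \<Longrightarrow> M \<ge> 1"
  using norm_T_apply_le[of 0 x] by (simp add: T_0)

lemma T_near_0:
  assumes "e > 0" obtains d where "d > 0" "\<And>s. 0 \<le> s \<Longrightarrow> s < d \<Longrightarrow> norm (T s x - x) < e"
proof -
  have "\<forall>\<^sub>F t in at_right 0. dist (T t x) x < e" using T_lim assms by (rule tendstoD)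
  then obtain d where "d > 0" "\<And>s. 0 < s \<Longrightarrow> s < d \<Longrightarrow> dist (T s x) x < e"
    by (auto simp: eventually_at_right_field)
  then show thesis using assms by (intro that[of d]) (auto simp: dist_norm T_0 le_less)
qed

lemma T_continuous: "continuous_on {0..} (\<lambda>t. T t x)"
  unfolding continuous_on_iff
proof (intro ballI allI impI)
  fix t e :: real assume t: "t \<in> {0..}" and e: "e > 0"
  have M1: "M + 1 > 0" using M_nonneg by simp
  obtain d where d: "d > 0" "\<And>s. 0 \<le> s \<Longrightarrow> s < d \<Longrightarrow> norm (T s x - x) < e / (M + 1)"
    using T_near_0[of "e / (M + 1)" x] e M1 by auto
  have le: "norm (T b x - T a x) < e" if "0 \<le> a" "a \<le> b" "b < a + d" for a b
  proof -
    have "T b x - T a x = T a (T (b - a) x - x)"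
      using T_add[of a "b - a" x] that by (simp add: blinfun.diff_right)
    then have "norm (T b x - T a x) \<le> M * norm (T (b - a) x - x)"
      using norm_T_apply_le that by simp
    also have "\<dots> \<le> (M + 1) * norm (T (b - a) x - x)" by (intro mult_right_mono) auto
    also have "\<dots> < e" using d(2)[of "b - a"] that M1 by (simp add: field_simps)
    finally show ?thesis .
  qed
  show "\<exists>d>0. \<forall>s\<in>{0..}. dist s t < d \<longrightarrow> dist (T s x) (T t x) < e"
  proof (intro exI[of _ d] conjI ballI impI d(1))
    fix s assume "s \<in> {0..}" "dist s t < d"
    then show "dist (T s x) (T t x) < e"
      using le[of s t] le[of t s] t by (cases "s \<le> t") (auto simp: dist_norm dist_real_def norm_minus_commute abs_if split: if_splits)
  qed
qed

lemma orbit_functional: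
  fixes \<phi> :: "'a \<Rightarrow>\<^sub>L real"
  shows "continuous_on {0..} (\<lambda>s. \<phi> (T s x))"
    and "s \<ge> 0 \<Longrightarrow> \<bar>\<phi> (T s x)\<bar> \<le> norm \<phi> * (M * norm x)"
proof -
  show "continuous_on {0..} (\<lambda>s. \<phi> (T s x))"
    by (rule bounded_linear.continuous_on[OF blinfun.bounded_linear_right T_continuous])
  assume "s \<ge> 0"
  then show "\<bar>\<phi> (T s x)\<bar> \<le> norm \<phi> * (M * norm x)"
    using norm_blinfun[of \<phi> "T s x"] mult_left_mono[OF norm_T_apply_le[of s x], of "norm \<phi>"] by simp
qed

definition measure_op :: "real measure \<Rightarrow> 'a \<Rightarrow>\<^sub>L 'a"
  where "measure_op \<mu> = Blinfun (\<lambda>x. SOME y. has_vec_integral \<mu> (\<lambda>s. T s x) y)"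

context
  fixes \<mu> assumes \<mu>: "halfline \<mu>"
begin

lemma orbit_integrable: "integrable \<mu> (\<lambda>s. blinfun_apply \<phi> (T s x) :: real)"
  using halfline_integrable[OF \<mu> orbit_functional] .

lemma integral_orbit_le:
  fixes \<phi> :: "'a \<Rightarrow>\<^sub>L real"
  shows "\<bar>\<integral>s. \<phi> (T s x) \<partial>\<mu>\<bar> \<le> norm \<phi> * (M * norm x) * measure \<mu> {0..}"
proof -
  interpret finite_measure \<mu> using \<mu> by (rule halfline_finite)
  have "\<bar>\<integral>s. \<phi> (T s x) \<partial>\<mu>\<bar> \<le> (\<integral>s. norm \<phi> * (M * norm x) \<partial>\<mu>)"
    using orbit_integrable halfline_AE[OF \<mu> orbit_functional(2)]
    by (intro integral_abs_bound[THEN order_trans] integral_mono_AE) auto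
  then show ?thesis by (simp add: halfline_space[OF \<mu>] mult_ac)
qed

lemma measure_op_vec: "has_vec_integral \<mu> (\<lambda>s. T s x) (measure_op \<mu> x)"
proof -
  define J where "J x = (SOME y. has_vec_integral \<mu> (\<lambda>s. T s x) y)" for x
  have J: "has_vec_integral \<mu> (\<lambda>s. T s x) (J x)" for x
    unfolding J_def by (rule someI_ex, rule ex_vec_integral[OF \<mu> T_continuous norm_T_apply_le])
  have JF: "\<phi> (J x) = (\<integral>s. \<phi> (T s x) \<partial>\<mu>)" for \<phi> :: "'a \<Rightarrow>\<^sub>L real" and x
    using has_vec_integral_functional[OF J[of x], of \<phi>] by (simp add: has_bochner_integral_integral_eq)
  have "bounded_linear J"
  proof (rule bounded_linear_intro[where K = "M * measure \<mu> {0..}"])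
    show "J (x + y) = J x + J y" for x y
      by (rule functional_eqI) (simp add: JF blinfun.add_right orbit_integrable)
    show "J (r *\<^sub>R x) = r *\<^sub>R J x" for r x
      by (rule functional_eqI) (simp add: JF blinfun.scaleR_right)
    show "norm (J x) \<le> norm x * (M * measure \<mu> {0..})" for x
    proof (rule functional_norm_leI)
      fix \<phi> :: "'a \<Rightarrow>\<^sub>L real" assume \<phi>: "\<And>y. \<bar>\<phi> y\<bar> \<le> norm y"
      have "norm \<phi> \<le> 1" using \<phi> by (intro norm_blinfun_bound) auto
      then have "norm \<phi> * (M * norm x) * measure \<mu> {0..} \<le> 1 * (M * norm x) * measure \<mu> {0..}"
        using M_nonneg by (intro mult_right_mono) auto
      then show "\<phi> (J x) \<le> norm x * (M * measure \<mu> {0..})"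
        using integral_orbit_le[of \<phi> x] by (simp add: JF mult_ac)
    qed
  qed
  then show ?thesis
    using J unfolding measure_op_def J_def[abs_def, symmetric] by (simp add: bounded_linear_Blinfun_apply)
qed

lemma measure_op_functional: "\<phi> (measure_op \<mu> x) = (\<integral>s. blinfun_apply \<phi> (T s x) \<partial>\<mu>)"
  for \<phi> :: "'a \<Rightarrow>\<^sub>L real"
  using has_vec_integral_functional[OF measure_op_vec[of x], of \<phi>] by (simp add: has_bochner_integral_integral_eq)

lemma norm_measure_op_le: "norm (measure_op \<mu> x) \<le> M * measure \<mu> {0..} * norm x"
proof (rule functional_norm_leI)
  fix \<phi> :: "'a \<Rightarrow>\<^sub>L real" assume \<phi>: "\<And>y. \<bar>\<phi> y\<bar> \<le> norm y"
  have "norm \<phi> \<le> 1" using \<phi> by (intro norm_blinfun_bound) auto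
  then have "norm \<phi> * (M * norm x) * measure \<mu> {0..} \<le> 1 * (M * norm x) * measure \<mu> {0..}"
    using M_nonneg by (intro mult_right_mono) auto
  then show "\<phi> (measure_op \<mu> x) \<le> M * measure \<mu> {0..} * norm x"
    using integral_orbit_le[of \<phi> x] by (simp add: measure_op_functional mult_ac)
qed

lemma measure_op_clinear: "measure_op \<mu> (c *\<^sub>C x) = c *\<^sub>C measure_op \<mu> x"
proof (rule functional_eqI)
  fix \<phi> :: "'a \<Rightarrow>\<^sub>L real"
  define \<psi> where "\<psi> = \<phi> o\<^sub>L Blinfun (\<lambda>x. c *\<^sub>C x)"
  have \<psi>: "\<psi> y = \<phi> (c *\<^sub>C y)" for y
    by (simp add: \<psi>_def bounded_linear_Blinfun_apply[OF bounded_linear_scaleC])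
  have "\<phi> (measure_op \<mu> (c *\<^sub>C x)) = (\<integral>s. \<psi> (T s x) \<partial>\<mu>)"
    unfolding measure_op_functional \<psi>
    by (rule Bochner_Integration.integral_cong) (auto simp: halfline_space[OF \<mu>] T_clinear)
  also have "\<dots> = \<psi> (measure_op \<mu> x)" by (rule measure_op_functional[symmetric])
  finally show "\<phi> (measure_op \<mu> (c *\<^sub>C x)) = \<phi> (c *\<^sub>C measure_op \<mu> x)" by (simp add: \<psi>)
qed

end

text \<open>Convolution of measures corresponds to composition of operators by the semigroup law and Fubini's
theorem for the scalar orbit.\<close>

lemma measure_op_conv:
  assumes \<mu>: "halfline \<mu>" and \<nu>: "halfline \<nu>"
  shows "measure_op (conv \<mu> \<nu>) x = measure_op \<mu> (measure_op \<nu> x)"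
proof (rule functional_eqI)
  fix \<phi> :: "'a \<Rightarrow>\<^sub>L real"
  have "\<phi> (measure_op (conv \<mu> \<nu>) x) = (\<integral>s. (\<integral>u. \<phi> (T (s + u) x) \<partial>\<nu>) \<partial>\<mu>)"
    using integral_conv[OF \<mu> \<nu> orbit_functional]
    by (simp add: measure_op_functional halfline_conv \<mu> \<nu>)
  also have "\<dots> = (\<integral>s. \<phi> (T s (measure_op \<nu> x)) \<partial>\<mu>)"
  proof (rule Bochner_Integration.integral_cong[OF refl])
    fix s assume "s \<in> space \<mu>"
    then have s: "s \<ge> 0" by (simp add: halfline_space[OF \<mu>])
    have "(\<integral>u. \<phi> (T (s + u) x) \<partial>\<nu>) = (\<integral>u. (\<phi> o\<^sub>L T s) (T u x) \<partial>\<nu>)"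
      by (rule Bochner_Integration.integral_cong) (auto simp: halfline_space[OF \<nu>] T_add s)
    also have "\<dots> = (\<phi> o\<^sub>L T s) (measure_op \<nu> x)" by (rule measure_op_functional[OF \<nu>, symmetric])
    finally show "(\<integral>u. \<phi> (T (s + u) x) \<partial>\<nu>) = \<phi> (T s (measure_op \<nu> x))" by simp
  qed
  also have "\<dots> = \<phi> (measure_op \<mu> (measure_op \<nu> x))" by (simp add: measure_op_functional[OF \<mu>])
  finally show "\<phi> (measure_op (conv \<mu> \<nu>) x) = \<phi> (measure_op \<mu> (measure_op \<nu> x))" .
qed

text \<open>The transfer principle: a linear relation between Laplace transforms holds between the operators.\<close>

lemma sum_measure_op_eq_zero:
  assumes "finite I" and \<mu>: "\<And>i. i \<in> I \<Longrightarrow> halfline (\<mu> i)"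
    and "\<And>\<tau>. \<tau> > 0 \<Longrightarrow> (\<Sum>i\<in>I. c i * laplace (\<mu> i) \<tau>) = 0"
  shows "(\<Sum>i\<in>I. c i *\<^sub>R measure_op (\<mu> i) x) = 0"
proof (rule functional_eqI)
  fix \<phi> :: "'a \<Rightarrow>\<^sub>L real"
  have "(\<Sum>i\<in>I. c i * (\<integral>s. \<phi> (T s x) \<partial>\<mu> i)) = 0"
    using assms orbit_functional by (rule signed_laplace_zero_imp_integral_zero)
  then show "\<phi> (\<Sum>i\<in>I. c i *\<^sub>R measure_op (\<mu> i) x) = \<phi> 0"
    by (simp add: blinfun.sum_right blinfun.scaleR_right measure_op_functional[OF \<mu>])
qed

text \<open>The transfer principle for four measures, the largest number that occurs.\<close>

lemma measure_op_combination_eq_zero: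
  assumes h: "halfline \<mu>1" "halfline \<mu>2" "halfline \<mu>3" "halfline \<mu>4"
    and l: "\<And>\<tau>. \<tau> > 0 \<Longrightarrow>
      c1 * laplace \<mu>1 \<tau> + c2 * laplace \<mu>2 \<tau> + c3 * laplace \<mu>3 \<tau> + c4 * laplace \<mu>4 \<tau> = 0"
  shows "c1 *\<^sub>R measure_op \<mu>1 x + c2 *\<^sub>R measure_op \<mu>2 x + c3 *\<^sub>R measure_op \<mu>3 x + c4 *\<^sub>R measure_op \<mu>4 x = 0"
proof -
  define \<mu> where "\<mu> i = (if i = 0 then \<mu>1 else if i = 1 then \<mu>2 else if i = 2 then \<mu>3 else \<mu>4)" for i :: nat
  define c where "c i = (if i = 0 then c1 else if i = 1 then c2 else if i = 2 then c3 else c4)" for i :: nat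
  have "(\<Sum>i\<in>{0, 1, 2, 3}. c i *\<^sub>R measure_op (\<mu> i) x) = 0"
  proof (rule sum_measure_op_eq_zero)
    show "halfline (\<mu> i)" for i using h by (simp add: \<mu>_def)
    show "(\<Sum>i\<in>{0, 1, 2, 3}. c i * laplace (\<mu> i) \<tau>) = 0" if "\<tau> > 0" for \<tau>
      using l[OF that] by (simp add: \<mu>_def c_def add.assoc)
  qed simp
  then show ?thesis by (simp add: \<mu>_def c_def add.assoc)
qed

lemma measure_op_eqI:
  assumes "halfline \<mu>" "halfline \<nu>" "\<And>\<tau>. \<tau> > 0 \<Longrightarrow> laplace \<mu> \<tau> = laplace \<nu> \<tau>"
  shows "measure_op \<mu> x = measure_op \<nu> x"
  using measure_op_combination_eq_zero[of \<mu> \<nu> \<mu> \<mu> 1 "-1" 0 0 x] assms by simp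

lemma measure_op_commute:
  assumes "halfline \<mu>" "halfline \<nu>"
  shows "measure_op \<mu> (measure_op \<nu> x) = measure_op \<nu> (measure_op \<mu> x)"
  unfolding measure_op_conv[OF assms, symmetric] measure_op_conv[OF assms(2,1), symmetric]
  using assms by (intro measure_op_eqI halfline_conv) (auto simp: laplace_conv)

definition point_mass :: "real \<Rightarrow> real measure"
  where "point_mass t = return (restrict_space borel {0..}) t"

lemma halfline_point_mass: "t \<ge> 0 \<Longrightarrow> halfline (point_mass t)"
  unfolding point_mass_def finite_measure_on_halfline_def
  by (auto intro!: prob_space.finite_measure prob_space_return simp: space_restrict_space)

lemma integral_point_mass:
  fixes g :: "real \<Rightarrow> real"
  assumes "t \<ge> 0" "continuous_on {0..} g" shows "(\<integral>s. g s \<partial>point_mass t) = g t"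
  unfolding point_mass_def using assms
  by (intro integral_return borel_measurable_continuous_on_restrict) (auto simp: space_restrict_space)

lemma laplace_point_mass: "t \<ge> 0 \<Longrightarrow> laplace (point_mass t) \<tau> = exp (- t * \<tau>)"
  unfolding laplace_def by (intro integral_point_mass continuous_intros)

lemma measure_op_point_mass:
  assumes "t \<ge> 0" shows "measure_op (point_mass t) x = T t x"
proof (rule functional_eqI)
  fix \<phi> :: "'a \<Rightarrow>\<^sub>L real"
  show "\<phi> (measure_op (point_mass t) x) = \<phi> (T t x)"
    unfolding measure_op_functional[OF halfline_point_mass[OF assms]]
    by (rule integral_point_mass[OF assms orbit_functional(1)])
qed

text \<open>Subprobability measures whose transforms at \<open>1\<close> tend to \<open>1\<close> concentrate at \<open>0\<close>:
for every \<open>e > 0\<close>, \<open>norm (T s x - x)\<close> is at most \<open>e/2\<close> plus a multiple of \<open>1 - exp (- s)\<close>, and the integral of the latter tends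
to \<open>0\<close>.\<close>

lemma measure_op_tendsto_id:
  assumes \<theta>: "\<forall>\<^sub>F h in F. halfline (\<theta> h) \<and> measure (\<theta> h) {0..} \<le> 1"
    and lim: "((\<lambda>h. laplace (\<theta> h) 1) \<longlongrightarrow> 1) F"
  shows "((\<lambda>h. measure_op (\<theta> h) x) \<longlongrightarrow> x) F"
proof (rule tendstoI)
  fix e :: real assume e: "e > 0"
  obtain d where d: "d > 0" "\<And>s. 0 \<le> s \<Longrightarrow> s < d \<Longrightarrow> norm (T s x - x) < e / 2"
    using T_near_0[of "e / 2" x] e by (metis half_gt_zero)
  have d1: "1 - exp (- d) > 0" using d(1) by simp
  define K where "K = (M + 1) * norm x / (1 - exp (- d))"
  have K: "K \<ge> 0" using d1 M_nonneg by (simp add: K_def)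
  have le: "norm (T s x - x) \<le> e / 2 + K * (1 - exp (- s))" if s: "s \<ge> 0" for s
  proof (cases "s < d")
    case True
    moreover have "K * (1 - exp (- s)) \<ge> 0" using K s by simp
    ultimately show ?thesis using d(2)[OF s] by linarith
  next
    case False
    have "norm (T s x - x) \<le> norm (T s x) + norm x" by (rule norm_triangle_ineq4)
    also have "\<dots> \<le> (M + 1) * norm x" using norm_T_apply_le[OF s, of x] by (simp add: algebra_simps)
    also have "\<dots> = K * (1 - exp (- d))" using d1 by (simp add: K_def)
    also have "\<dots> \<le> K * (1 - exp (- s))" using K False by (intro mult_left_mono) auto
    finally show ?thesis using e by simp
  qed
  have bound: "norm (measure_op \<mu> x - x) \<le> e / 2 + (K + norm x) * (1 - laplace \<mu> 1)"
    if \<mu>: "halfline \<mu>" and m: "measure \<mu> {0..} \<le> 1" for \<mu>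
  proof (rule functional_norm_leI)
    interpret finite_measure \<mu> using \<mu> by (rule halfline_finite)
    define m where "m = measure \<mu> {0..}"
    have sp: "measure \<mu> (space \<mu>) = m" using halfline_space[OF \<mu>] by (simp add: m_def)
    have i1: "integrable \<mu> (\<lambda>s. exp (- s * 1))" by (rule integrable_exp[OF \<mu>]) simp
    have Lm: "laplace \<mu> 1 \<le> m"
    proof -
      have "laplace \<mu> 1 \<le> (\<integral>s. 1 \<partial>\<mu>)" unfolding laplace_def
        using i1 by (intro integral_mono_AE halfline_AE[OF \<mu>]) auto
      then show ?thesis using sp by simp
    qed
    fix \<phi> :: "'a \<Rightarrow>\<^sub>L real" assume \<phi>: "\<And>y. \<bar>\<phi> y\<bar> \<le> norm y"
    have io: "integrable \<mu> (\<lambda>s. \<phi> (T s x))" by (rule orbit_integrable[OF \<mu>])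
    have "(\<integral>s. \<phi> (T s x) - \<phi> x \<partial>\<mu>) = \<phi> (measure_op \<mu> x) - m * \<phi> x"
      using io by (simp add: measure_op_functional[OF \<mu>] sp)
    then have "\<phi> (measure_op \<mu> x - x) = (\<integral>s. \<phi> (T s x) - \<phi> x \<partial>\<mu>) - (1 - m) * \<phi> x"
      by (simp add: blinfun.diff_right left_diff_distrib)
    moreover have "(\<integral>s. \<phi> (T s x) - \<phi> x \<partial>\<mu>) \<le> (\<integral>s. e / 2 + K * (1 - exp (- s * 1)) \<partial>\<mu>)"
    proof (rule integral_mono_AE)
      show "AE s in \<mu>. \<phi> (T s x) - \<phi> x \<le> e / 2 + K * (1 - exp (- s * 1))"
      proof (rule halfline_AE[OF \<mu>])
        fix s :: real assume "s \<ge> 0"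
        from le[OF this] \<phi>[of "T s x - x"] show "\<phi> (T s x) - \<phi> x \<le> e / 2 + K * (1 - exp (- s * 1))"
          by (simp add: blinfun.diff_right)
      qed
    qed (use io i1 in auto)
    moreover have "(\<integral>s. e / 2 + K * (1 - exp (- s * 1)) \<partial>\<mu>) = m * (e / 2) + K * (m - laplace \<mu> 1)"
      using i1 by (simp add: laplace_def sp)
    moreover have "m * (e / 2) \<le> 1 * (e / 2)" using m e by (intro mult_right_mono) (auto simp: m_def)
    moreover have "K * (m - laplace \<mu> 1) \<le> K * (1 - laplace \<mu> 1)"
      using m K by (intro mult_left_mono) (auto simp: m_def)
    moreover have "- ((1 - m) * \<phi> x) \<le> (1 - m) * norm x"
    proof -
      have "(1 - m) * (- \<phi> x) \<le> (1 - m) * norm x"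
        using \<phi>[of x] m by (intro mult_left_mono) (auto simp: m_def)
      then show ?thesis by simp
    qed
    moreover have "(1 - m) * norm x \<le> norm x * (1 - laplace \<mu> 1)"
      unfolding mult.commute[of "1 - m"] using Lm by (intro mult_left_mono) auto
    moreover have "(K + norm x) * (1 - laplace \<mu> 1) = K * (1 - laplace \<mu> 1) + norm x * (1 - laplace \<mu> 1)"
      by (rule distrib_right)
    ultimately show "\<phi> (measure_op \<mu> x - x) \<le> e / 2 + (K + norm x) * (1 - laplace \<mu> 1)"
      by linarith
  qed
  have "((\<lambda>h. e / 2 + (K + norm x) * (1 - laplace (\<theta> h) 1)) \<longlongrightarrow> e / 2 + (K + norm x) * (1 - 1)) F"
    by (intro tendsto_intros lim)
  then have "\<forall>\<^sub>F h in F. e / 2 + (K + norm x) * (1 - laplace (\<theta> h) 1) < e"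
    by (rule order_tendstoD) (use e in auto)
  with \<theta> show "\<forall>\<^sub>F h in F. dist (measure_op (\<theta> h) x) x < e"
  proof eventually_elim
    case (elim h)
    with bound[of "\<theta> h"] show ?case by (simp add: dist_norm)
  qed
qed

end

section \<open>Completely monotone functions\<close>

text \<open>The condition of complete monotonicity for the derivatives up to order \<open>n\<close>. The derivative is
existentially quantified, up to sign, so that closure under sums, products and compositions is a
plain induction on \<open>n\<close> without Leibniz or Faa di Bruno formulas.\<close>

primrec cm_upto :: "nat \<Rightarrow> (real \<Rightarrow> real) \<Rightarrow> bool" where
  "cm_upto 0 g \<longleftrightarrow> (\<forall>\<tau>>0. 0 \<le> g \<tau>)"
| "cm_upto (Suc n) g \<longleftrightarrow> (\<forall>\<tau>>0. 0 \<le> g \<tau>) \<and>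
    (\<exists>g'. (\<forall>\<tau>>0. (g has_real_derivative - g' \<tau>) (at \<tau>)) \<and> cm_upto n g')"

definition cm :: "(real \<Rightarrow> real) \<Rightarrow> bool"
  where "cm g \<longleftrightarrow> (\<forall>n. cm_upto n g)"

lemma cm_upto_nonneg: "cm_upto n g \<Longrightarrow> \<tau> > 0 \<Longrightarrow> 0 \<le> g \<tau>"
  by (cases n) auto

lemma cm_upto_Suc_imp: "cm_upto (Suc n) g \<Longrightarrow> cm_upto n g"
  by (induction n arbitrary: g) auto

lemma cm_upto_cong:
  assumes "\<And>\<tau>. \<tau> > 0 \<Longrightarrow> f \<tau> = g \<tau>" shows "cm_upto n f \<longleftrightarrow> cm_upto n g"
proof -
  have "(f has_real_derivative D) (at \<tau>) \<longleftrightarrow> (g has_real_derivative D) (at \<tau>)" if "\<tau> > 0" for D \<tau>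
  proof (rule DERIV_cong_ev[OF refl _ refl])
    show "\<forall>\<^sub>F x in nhds \<tau>. f x = g x"
      using eventually_nhds_in_open[of "{0<..}" \<tau>] that assms by (auto elim!: eventually_mono)
  qed
  then show ?thesis using assms by (cases n) auto
qed

lemma cm_nonneg: "cm g \<Longrightarrow> \<tau> > 0 \<Longrightarrow> 0 \<le> g \<tau>"
  unfolding cm_def using cm_upto_nonneg by blast

lemma cm_derivative:
  assumes "cm g"
  shows "\<And>\<tau>. \<tau> > 0 \<Longrightarrow> (g has_real_derivative - (- deriv g \<tau>)) (at \<tau>)"
    and "cm (\<lambda>\<tau>. - deriv g \<tau>)"
proof -
  have step: "\<exists>g'. (\<forall>\<tau>>0. (g has_real_derivative - g' \<tau>) (at \<tau>)) \<and> cm_upto n g'" for n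
    using assms unfolding cm_def by (meson cm_upto.simps(2))
  show "(g has_real_derivative - (- deriv g \<tau>)) (at \<tau>)" if "\<tau> > 0" for \<tau>
  proof -
    obtain g' where "\<forall>\<tau>>0. (g has_real_derivative - g' \<tau>) (at \<tau>)" using step[of 0] by blast
    then have "(g has_real_derivative - g' \<tau>) (at \<tau>)" using that by simp
    with DERIV_imp_deriv[OF this] show ?thesis by simp
  qed
  have "cm_upto n (\<lambda>\<tau>. - deriv g \<tau>)" for n
  proof -
    obtain g' where g': "\<And>\<tau>. \<tau> > 0 \<Longrightarrow> (g has_real_derivative - g' \<tau>) (at \<tau>)" "cm_upto n g'"
      using step[of n] by auto
    have "- deriv g \<tau> = g' \<tau>" if "\<tau> > 0" for \<tau>
      using DERIV_imp_deriv[OF g'(1)[OF that]] by simp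
    then show ?thesis using g'(2) cm_upto_cong[of "\<lambda>\<tau>. - deriv g \<tau>" g' n] by simp
  qed
  then show "cm (\<lambda>\<tau>. - deriv g \<tau>)" by (simp add: cm_def)
qed

lemma cm_sequence:
  assumes "cm g"
  obtains G where "G 0 = g" "\<And>n. cm (G n)"
    "\<And>n \<tau>. \<tau> > 0 \<Longrightarrow> (G n has_real_derivative - G (Suc n) \<tau>) (at \<tau>)"
proof -
  define G where "G n = ((\<lambda>f \<tau>. - deriv f \<tau>) ^^ n) g" for n
  have S: "G (Suc n) = (\<lambda>\<tau>. - deriv (G n) \<tau>)" for n by (simp add: G_def)
  have c: "cm (G n)" for n
    by (induction n) (use assms cm_derivative(2) S in \<open>auto simp: G_def\<close>)
  show thesis
    by (rule that[of G]) (use c cm_derivative(1)[OF c] S in \<open>auto simp: G_def\<close>)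
qed

lemma sequence_imp_cm_upto:
  assumes "\<And>n \<tau>. \<tau> > 0 \<Longrightarrow> 0 \<le> G n \<tau>"
    and "\<And>n \<tau>. \<tau> > 0 \<Longrightarrow> (G n has_real_derivative - G (Suc n) \<tau>) (at \<tau>)"
  shows "cm_upto k (G n)"
proof (induction k arbitrary: n)
  case 0
  then show ?case using assms by simp
next
  case (Suc k)
  show ?case using assms Suc[of "Suc n"] by (auto intro!: exI[of _ "G (Suc n)"])
qed

lemma sequence_imp_cm:
  assumes "\<And>n \<tau>. \<tau> > 0 \<Longrightarrow> 0 \<le> G n \<tau>"
    and "\<And>n \<tau>. \<tau> > 0 \<Longrightarrow> (G n has_real_derivative - G (Suc n) \<tau>) (at \<tau>)"
  shows "cm (G 0)"
  unfolding cm_def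
proof
  show "cm_upto k (G 0)" for k using assms by (rule sequence_imp_cm_upto[of G])
qed

lemma cm_const: "c \<ge> 0 \<Longrightarrow> cm (\<lambda>_. c)"
  using sequence_imp_cm[of "\<lambda>n _. if n = 0 then c else 0"] by simp

lemma cm_upto_add: "cm_upto n f \<Longrightarrow> cm_upto n g \<Longrightarrow> cm_upto n (\<lambda>\<tau>. f \<tau> + g \<tau>)"
proof (induction n arbitrary: f g)
  case (Suc n)
  then obtain f' g' where "\<And>\<tau>. \<tau> > 0 \<Longrightarrow> (f has_real_derivative - f' \<tau>) (at \<tau>)" "cm_upto n f'"
    "\<And>\<tau>. \<tau> > 0 \<Longrightarrow> (g has_real_derivative - g' \<tau>) (at \<tau>)" "cm_upto n g'" by auto
  then show ?case using Suc
    by (auto intro!: exI[of _ "\<lambda>\<tau>. f' \<tau> + g' \<tau>"] derivative_eq_intros)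
qed simp

lemma cm_upto_mult: "cm_upto n f \<Longrightarrow> cm_upto n g \<Longrightarrow> cm_upto n (\<lambda>\<tau>. f \<tau> * g \<tau>)"
proof (induction n arbitrary: f g)
  case (Suc n)
  then obtain f' g' where fg: "\<And>\<tau>. \<tau> > 0 \<Longrightarrow> (f has_real_derivative - f' \<tau>) (at \<tau>)" "cm_upto n f'"
    "\<And>\<tau>. \<tau> > 0 \<Longrightarrow> (g has_real_derivative - g' \<tau>) (at \<tau>)" "cm_upto n g'" by auto
  have "cm_upto n (\<lambda>\<tau>. f' \<tau> * g \<tau> + f \<tau> * g' \<tau>)"
    using Suc.prems[THEN cm_upto_Suc_imp] fg by (intro cm_upto_add Suc.IH)
  moreover have "((\<lambda>\<tau>. f \<tau> * g \<tau>) has_real_derivative - (f' \<tau> * g \<tau> + f \<tau> * g' \<tau>)) (at \<tau>)"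
    if "\<tau> > 0" for \<tau>
    using fg that by (auto intro!: derivative_eq_intros)
  ultimately show ?case using Suc.prems by (auto intro!: exI[of _ "\<lambda>\<tau>. f' \<tau> * g \<tau> + f \<tau> * g' \<tau>"])
qed auto

lemma cm_add: "cm f \<Longrightarrow> cm g \<Longrightarrow> cm (\<lambda>\<tau>. f \<tau> + g \<tau>)"
  and cm_mult: "cm f \<Longrightarrow> cm g \<Longrightarrow> cm (\<lambda>\<tau>. f \<tau> * g \<tau>)"
  by (auto simp: cm_def cm_upto_add cm_upto_mult)

lemma cm_upto_antimono:
  assumes "cm_upto (Suc n) g" "0 < x" "x \<le> y" shows "g y \<le> g x"
proof -
  obtain g' where g': "\<And>\<tau>. \<tau> > 0 \<Longrightarrow> (g has_real_derivative - g' \<tau>) (at \<tau>)" "cm_upto n g'"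
    using assms(1) by auto
  show ?thesis
  proof (rule DERIV_nonpos_imp_nonincreasing[OF assms(3)])
    fix z assume "x \<le> z" "z \<le> y"
    then have "z > 0" using assms by simp
    then show "\<exists>l. (g has_real_derivative l) (at z) \<and> l \<le> 0"
      using g' cm_upto_nonneg[OF g'(2)] by (intro exI[of _ "- g' z"]) auto
  qed
qed

lemma cm_antimono: "cm g \<Longrightarrow> 0 < x \<Longrightarrow> x \<le> y \<Longrightarrow> g y \<le> g x"
  using cm_upto_antimono[of 0 g x y] by (auto simp: cm_def simp del: cm_upto.simps)

lemma has_real_derivative_shift:
  assumes "(f has_real_derivative D) (at (c + x))"
  shows "((\<lambda>x. f (c + x)) has_real_derivative D) (at (x::real))"
proof -
  have "((\<lambda>x. c + x) has_real_derivative 1) (at x)" by (auto intro!: derivative_eq_intros)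
  from DERIV_chain2[where f = f and g = "\<lambda>x. c + x", OF _ this] assms show ?thesis by simp
qed

lemma cm_upto_difference:
  assumes "c \<ge> 0" shows "cm_upto (Suc n) g \<Longrightarrow> cm_upto n (\<lambda>\<tau>. g \<tau> - g (c + \<tau>))"
proof (induction n arbitrary: g)
  case 0
  then show ?case using cm_upto_antimono[of 0 g] assms by simp
next
  case (Suc n)
  then obtain g' where g': "\<And>\<tau>. \<tau> > 0 \<Longrightarrow> (g has_real_derivative - g' \<tau>) (at \<tau>)" "cm_upto (Suc n) g'"
    by auto
  have "((\<lambda>\<tau>. g \<tau> - g (c + \<tau>)) has_real_derivative - (g' \<tau> - g' (c + \<tau>))) (at \<tau>)" if "\<tau> > 0" for \<tau>
  proof -
    have "((\<lambda>\<tau>. g (c + \<tau>)) has_real_derivative - g' (c + \<tau>)) (at \<tau>)"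
      using g'(1)[of "c + \<tau>"] that assms by (intro has_real_derivative_shift) simp
    from DERIV_diff[OF g'(1)[OF that] this] show ?thesis by simp
  qed
  moreover have "0 \<le> g \<tau> - g (c + \<tau>)" if "\<tau> > 0" for \<tau>
    using cm_upto_antimono[OF Suc.prems that, of "c + \<tau>"] assms by simp
  ultimately show ?case using Suc.IH[OF g'(2)] by (auto intro!: exI[of _ "\<lambda>\<tau>. g' \<tau> - g' (c + \<tau>)"])
qed

lemma cm_difference: "c \<ge> 0 \<Longrightarrow> cm g \<Longrightarrow> cm (\<lambda>\<tau>. g \<tau> - g (c + \<tau>))"
  using cm_upto_difference by (auto simp: cm_def simp del: cm_upto.simps)

lemma cm_inverse_shift:
  assumes "c > 0" shows "cm (\<lambda>\<tau>. 1 / (c + \<tau>))"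
proof -
  define G where "G n \<tau> = fact n / (c + \<tau>) ^ Suc n" for n and \<tau> :: real
  have "cm (G 0)"
  proof (rule sequence_imp_cm)
    fix n and \<tau> :: real assume "\<tau> > 0"
    then have pos: "c + \<tau> > 0" using assms by simp
    then show "0 \<le> G n \<tau>" by (simp add: G_def)
    have "(G n has_real_derivative
        - (fact n * (real (Suc n) * (c + \<tau>) ^ n) / ((c + \<tau>) ^ Suc n * (c + \<tau>) ^ Suc n))) (at \<tau>)"
      unfolding G_def[abs_def] using pos by (auto intro!: derivative_eq_intros simp del: power_Suc)
    also have "fact n * (real (Suc n) * (c + \<tau>) ^ n) / ((c + \<tau>) ^ Suc n * (c + \<tau>) ^ Suc n) = G (Suc n) \<tau>"
      using pos by (simp add: G_def divide_simps)
    finally show "(G n has_real_derivative - G (Suc n) \<tau>) (at \<tau>)" .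
  qed
  then show ?thesis by (simp add: G_def[abs_def])
qed

text \<open>Differentiation under the integral sign. It is used twice, for \<open>exp (- r y)\<close> and for \<open>\<psi>'(1 + r z)\<close>.\<close>

lemma averaged_sequence_derivative:
  fixes F :: "nat \<Rightarrow> real \<Rightarrow> real"
  assumes U: "convex U" "open U" and V: "\<And>r z. r \<in> {0..1} \<Longrightarrow> z \<in> U \<Longrightarrow> c + r * z \<in> V"
    and F: "\<And>n y. y \<in> V \<Longrightarrow> (F n has_real_derivative - F (Suc n) y) (at y)" and z: "z \<in> U"
  shows "((\<lambda>z. integral {0..1} (\<lambda>r. r ^ n * F n (c + r * z))) has_real_derivative
    - integral {0..1} (\<lambda>r. r ^ Suc n * F (Suc n) (c + r * z))) (at z)"
proof -
  have cF: "continuous_on V (F n)" for n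
    using F by (meson continuous_at_imp_continuous_on DERIV_isCont)
  have "((\<lambda>z. integral (cbox 0 1) (\<lambda>r. r ^ n * F n (c + r * z))) has_real_derivative
      integral (cbox 0 1) (\<lambda>r. - (r ^ Suc n * F (Suc n) (c + r * z)))) (at z within U)"
  proof (rule leibniz_rule_field_derivative[where f = "\<lambda>z r. r ^ n * F n (c + r * z)"
        and fx = "\<lambda>z r. - (r ^ Suc n * F (Suc n) (c + r * z))"])
    fix x t :: real assume x: "x \<in> U" "t \<in> cbox 0 1"
    have "((\<lambda>x. F n (c + t * x)) has_real_derivative - F (Suc n) (c + t * x) * t) (at x)"
      by (rule DERIV_chain2[where f = "F n" and g = "\<lambda>x. c + t * x"])
        (use F V x in \<open>auto intro!: derivative_eq_intros\<close>)
    from DERIV_cmult[OF this, of "t ^ n"]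
    show "((\<lambda>x. t ^ n * F n (c + t * x)) has_real_derivative - (t ^ Suc n * F (Suc n) (c + t * x))) (at x within U)"
      by (rule has_field_derivative_at_within[OF DERIV_cong]) (simp add: mult_ac)
  next
    show "(\<lambda>r. r ^ n * F n (c + r * x)) integrable_on cbox 0 1" if "x \<in> U" for x
      using that V by (intro integrable_continuous continuous_intros continuous_on_compose2[OF cF]) auto
    show "continuous_on (U \<times> cbox 0 1) (\<lambda>(z, r). - (r ^ Suc n * F (Suc n) (c + r * z)))"
      using V unfolding case_prod_beta
      by (intro continuous_intros continuous_on_compose2[OF cF]) auto
  qed (use z U in auto)
  then show ?thesis using z U by (simp add: at_within_open[of z U])
qed

lemma integral_nonneg':
  fixes f :: "real \<Rightarrow> real"
  assumes "\<And>x. x \<in> S \<Longrightarrow> 0 \<le> f x" shows "0 \<le> integral S f"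
  using assms by (cases "f integrable_on S") (auto simp: integral_nonneg not_integrable_integral)

text \<open>This is \<open>(1 - exp (- y)) / y\<close>, with the value \<open>1\<close> at \<open>0\<close>. As an average of exponentials it is visibly completely
monotone.\<close>

definition chi :: "real \<Rightarrow> real"
  where "chi y = integral {0..1} (\<lambda>r. exp (- (r * y)))"

lemma chi_mult: "chi y * y = 1 - exp (- y)"
proof -
  have "((\<lambda>r. exp (- (r * y)) * y) has_integral (- exp (- (1 * y)) - - exp (- (0 * y)))) {0..1}"
    by (rule fundamental_theorem_of_calculus)
      (auto intro!: derivative_eq_intros simp flip: has_real_derivative_iff_has_vector_derivative)
  from integral_unique[OF this] show ?thesis by (simp add: chi_def)
qed

text \<open>\<open>F 0\<close> is completely monotone on the whole line, with \<open>F n\<close> its derivatives up to sign. The point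
\<open>0\<close> matters, since a Bernstein function may take the value \<open>0\<close>.\<close>

lemma cm_compose:
  assumes F: "\<And>n y. (F n has_real_derivative - F (Suc n) y) (at y)" "\<And>n y. F n y \<ge> 0"
    and \<psi>: "\<And>\<tau>. \<tau> > 0 \<Longrightarrow> (\<psi> has_real_derivative \<psi>' \<tau>) (at \<tau>)" "cm \<psi>'"
  shows "cm (\<lambda>\<tau>. F 0 (\<psi> \<tau>))"
proof -
  have "cm_upto k (\<lambda>\<tau>. F n (\<psi> \<tau>))" for k n
  proof (induction k arbitrary: n)
    case (Suc k)
    have "((\<lambda>\<tau>. F n (\<psi> \<tau>)) has_real_derivative - (F (Suc n) (\<psi> \<tau>) * \<psi>' \<tau>)) (at \<tau>)" if "\<tau> > 0" for \<tau>
      using DERIV_chain2[OF F(1) \<psi>(1)[OF that], of n] by simp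
    moreover have "cm_upto k (\<lambda>\<tau>. F (Suc n) (\<psi> \<tau>) * \<psi>' \<tau>)"
      using Suc \<psi>(2) by (intro cm_upto_mult) (auto simp: cm_def)
    ultimately show ?case using F(2) by (auto intro!: exI[of _ "\<lambda>\<tau>. F (Suc n) (\<psi> \<tau>) * \<psi>' \<tau>"])
  qed (simp add: F(2))
  then show ?thesis by (simp add: cm_def)
qed

lemma cm_exp_compose:
  assumes "\<And>\<tau>. \<tau> > 0 \<Longrightarrow> (\<psi> has_real_derivative \<psi>' \<tau>) (at \<tau>)" "cm \<psi>'" "t \<ge> 0"
  shows "cm (\<lambda>\<tau>. exp (- t * \<psi> \<tau>))"
proof -
  have "cm (\<lambda>\<tau>. (\<lambda>n y. t ^ n * exp (- t * y)) 0 (\<psi> \<tau>))"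
    by (rule cm_compose[where F = "\<lambda>n y. t ^ n * exp (- t * y)"])
      (use assms in \<open>auto intro!: derivative_eq_intros\<close>)
  then show ?thesis by simp
qed

lemma cm_chi_compose:
  assumes \<psi>: "\<And>\<tau>. \<tau> > 0 \<Longrightarrow> (\<psi> has_real_derivative \<psi>' \<tau>) (at \<tau>)" "cm \<psi>'" and "h \<ge> 0"
  shows "cm (\<lambda>\<tau>. chi (h * \<psi> \<tau>))"
proof -
  define F where "F n y = integral {0..1} (\<lambda>r. r ^ n * exp (- (0 + r * y)))" for n :: nat and y :: real
  have "cm (\<lambda>\<tau>. F 0 (h * \<psi> \<tau>))"
  proof (rule cm_compose[where F = F and \<psi> = "\<lambda>\<tau>. h * \<psi> \<tau>" and \<psi>' = "\<lambda>\<tau>. h * \<psi>' \<tau>"])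
    show "(F n has_real_derivative - F (Suc n) y) (at y)" for n y
      unfolding F_def[abs_def]
      by (rule averaged_sequence_derivative[where F = "\<lambda>n y. exp (- y)" and U = UNIV and V = UNIV])
        (auto intro!: derivative_eq_intros)
    show "F n y \<ge> 0" for n y unfolding F_def by (rule integral_nonneg') auto
    show "cm (\<lambda>\<tau>. h * \<psi>' \<tau>)" using assms by (intro cm_mult cm_const)
    show "((\<lambda>\<tau>. h * \<psi> \<tau>) has_real_derivative h * \<psi>' \<tau>) (at \<tau>)" if "\<tau> > 0" for \<tau>
      using DERIV_cmult[OF \<psi>(1)[OF that]] .
  qed
  then show ?thesis by (simp add: F_def chi_def)
qed

lemma cm_average:
  assumes "cm g" shows "cm (\<lambda>z. integral {0..1} (\<lambda>r. g (1 + r * z)))"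
proof -
  obtain G where G: "G 0 = g" "\<And>n. cm (G n)"
    "\<And>n \<tau>. \<tau> > 0 \<Longrightarrow> (G n has_real_derivative - G (Suc n) \<tau>) (at \<tau>)"
    using cm_sequence[OF assms] by blast
  define F where "F n z = integral {0..1} (\<lambda>r. r ^ n * G n (1 + r * z))" for n and z :: real
  have pos: "1 + r * z > 0" if "r \<in> {0..1}" "z > 0" for r z :: real
    using that by (simp add: add_pos_nonneg)
  have "cm (F 0)"
  proof (rule sequence_imp_cm)
    fix n and z :: real assume z: "z > 0"
    show "0 \<le> F n z" unfolding F_def
      using pos z by (intro integral_nonneg') (auto intro!: mult_nonneg_nonneg cm_nonneg[OF G(2)])
    show "(F n has_real_derivative - F (Suc n) z) (at z)"
      unfolding F_def[abs_def]
      by (rule averaged_sequence_derivative[where U = "{0<..}" and V = "{0<..}"]) (use G pos z in auto)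
  qed
  then show ?thesis by (simp add: F_def[abs_def] G)
qed

section \<open>Bernstein's theorem\<close>

text \<open>A completely monotone function is represented by its Taylor series at \<open>a\<close> on all of \<open>(0, a]\<close>. All terms
of the series at a point left of \<open>a\<close>, and the integral remainder, are nonnegative. Since
\<open>b - t \<le> (b/c) (c - t)\<close> for \<open>0 \<le> t \<le> b < c\<close>, the remainder at distance \<open>b\<close> is at most \<open>(b/c)\<^sup>n\<close> times the one at
distance \<open>c\<close>, which in turn is bounded by the value of the function.\<close>

lemma cm_taylor_sums:
  assumes G: "\<And>n. cm (G n)" "\<And>n \<tau>. \<tau> > 0 \<Longrightarrow> (G n has_real_derivative - G (Suc n) \<tau>) (at \<tau>)"
    and b: "0 \<le> b" "b < a"
  shows "(\<lambda>k. b ^ k / fact k * G k a) sums G 0 (a - b)"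
proof -
  define R where "R n b = integral {0..b} (\<lambda>t. (b - t) ^ n / fact n * G (Suc n) (a - t))" for n b
  have taylor: "G 0 (a - b) = (\<Sum>k<Suc n. b ^ k / fact k * G k a) + R n b"
    and int: "(\<lambda>t. (b - t) ^ n / fact n * G (Suc n) (a - t)) integrable_on {0..b}"
    if b: "0 \<le> b" "b < a" for b n
  proof -
    have D: "((\<lambda>t. G m (a - t)) has_vector_derivative G (Suc m) (a - t)) (at t within {0..b})"
      if t: "0 \<le> t" "t \<le> b" for m t
    proof -
      have d: "((\<lambda>t. a - t) has_real_derivative - 1) (at t)" by (auto intro!: derivative_eq_intros)
      have pos: "a - t > 0" using t b by simp
      have "((\<lambda>t. G m (a - t)) has_real_derivative - G (Suc m) (a - t) * (- 1)) (at t)"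
        by (rule DERIV_chain2[where f = "G m" and g = "\<lambda>t. a - t", OF G(2)[OF pos] d])
      then have "((\<lambda>t. G m (a - t)) has_real_derivative G (Suc m) (a - t)) (at t)"
        by (simp only: minus_mult_minus mult_1_right)
      then show ?thesis
        unfolding has_real_derivative_iff_has_vector_derivative by (rule has_vector_derivative_at_within)
    qed
    have "G 0 (a - b) = (\<Sum>k<Suc n. ((b - 0) ^ k / fact k) *\<^sub>R G k (a - 0))
        + integral {0..b} (\<lambda>t. ((b - t) ^ (Suc n - 1) / fact (Suc n - 1)) *\<^sub>R G (Suc n) (a - t))"
      by (rule Taylor_integral[where Df = "\<lambda>m t. G m (a - t)" and f = "\<lambda>t. G 0 (a - t)"])
        (use D b in auto)
    then show "G 0 (a - b) = (\<Sum>k<Suc n. b ^ k / fact k * G k a) + R n b"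
      unfolding R_def by (simp only: diff_0_right diff_Suc_1 real_scaleR_def)
    have "(\<lambda>t. ((b - t) ^ (Suc n - 1) / fact (Suc n - 1)) *\<^sub>R G (Suc n) (a - t)) integrable_on {0..b}"
      by (rule Taylor_integrable[where Df = "\<lambda>m t. G m (a - t)" and f = "\<lambda>t. G 0 (a - t)"])
        (use D b in auto)
    then show "(\<lambda>t. (b - t) ^ n / fact n * G (Suc n) (a - t)) integrable_on {0..b}"
      by (simp only: diff_Suc_1 real_scaleR_def)
  qed
  have Gpos: "G n y \<ge> 0" if "y > 0" for n y using cm_nonneg[OF G(1) that] .
  have Rnn: "R n b \<ge> 0" if "0 \<le> b" "b < a" for n b
    unfolding R_def using that Gpos by (intro integral_nonneg') auto
  \<comment> \<open>comparison of the remainders at \<open>b < c < a\<close>: \<open>b - t \<le> (b/c) (c - t)\<close>\<close>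
  define c where "c = (a + b) / 2"
  have c: "b < c" "c < a" "0 < c" using b by (auto simp: c_def)
  have Rle: "R n b \<le> (b / c) ^ n * G 0 (a - c)" for n
  proof -
    have intc: "(\<lambda>t. (b / c) ^ n * ((c - t) ^ n / fact n * G (Suc n) (a - t))) integrable_on {0..c}"
      using integrable_on_mult_right[OF int[of c n]] c by simp
    have "R n b \<le> integral {0..b} (\<lambda>t. (b / c) ^ n * ((c - t) ^ n / fact n * G (Suc n) (a - t)))"
      unfolding R_def
    proof (rule integral_le[OF int[OF b]])
      show "(\<lambda>t. (b / c) ^ n * ((c - t) ^ n / fact n * G (Suc n) (a - t))) integrable_on {0..b}"
        by (rule integrable_on_subinterval[OF intc]) (use c in auto)
      fix t assume t: "t \<in> {0..b}"
      have "b - t \<le> b / c * (c - t)"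
      proof -
        have "b * t \<le> c * t" using t c by (intro mult_right_mono) auto
        then have "(b - t) * c \<le> b * (c - t)" by (simp add: algebra_simps)
        then show ?thesis using c by (simp add: pos_le_divide_eq)
      qed
      then have "(b - t) ^ n \<le> (b / c * (c - t)) ^ n" using t by (intro power_mono) auto
      then have "(b - t) ^ n / fact n * G (Suc n) (a - t) \<le> (b / c * (c - t)) ^ n / fact n * G (Suc n) (a - t)"
        using t b by (intro mult_right_mono divide_right_mono Gpos) auto
      then show "(b - t) ^ n / fact n * G (Suc n) (a - t) \<le> (b / c) ^ n * ((c - t) ^ n / fact n * G (Suc n) (a - t))"
        unfolding power_mult_distrib by (simp only: mult.assoc times_divide_eq_right times_divide_eq_left)
    qed
    also have "\<dots> \<le> integral {0..c} (\<lambda>t. (b / c) ^ n * ((c - t) ^ n / fact n * G (Suc n) (a - t)))"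
    proof (rule integral_subset_le)
      show "(\<lambda>t. (b / c) ^ n * ((c - t) ^ n / fact n * G (Suc n) (a - t))) integrable_on {0..b}"
        by (rule integrable_on_subinterval[OF intc]) (use c in auto)
      show "\<forall>t\<in>{0..c}. 0 \<le> (b / c) ^ n * ((c - t) ^ n / fact n * G (Suc n) (a - t))"
        using b c Gpos by auto
    qed (use c intc in auto)
    also have "\<dots> = (b / c) ^ n * R n c" by (simp add: R_def)
    also have "\<dots> \<le> (b / c) ^ n * G 0 (a - c)"
    proof (rule mult_left_mono)
      have "(\<Sum>k<Suc n. c ^ k / fact k * G k a) \<ge> 0"
        using c b Gpos by (intro sum_nonneg) auto
      then show "R n c \<le> G 0 (a - c)" using taylor[of c n] c by simp
    qed (use b c in auto)
    finally show ?thesis .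
  qed
  have "(\<lambda>n. (b / c) ^ n * G 0 (a - c)) \<longlonglongrightarrow> 0 * G 0 (a - c)"
    using b c by (intro tendsto_mult[OF LIMSEQ_power_zero tendsto_const]) (auto simp: divide_less_eq)
  then have lim: "(\<lambda>n. (b / c) ^ n * G 0 (a - c)) \<longlonglongrightarrow> 0" by simp
  have "(\<lambda>n. R n b) \<longlonglongrightarrow> 0"
    by (rule tendsto_sandwich[OF always_eventually always_eventually tendsto_const lim])
      (use Rnn[OF b] Rle in auto)
  moreover have "(\<Sum>k<Suc n. b ^ k / fact k * G k a) = G 0 (a - b) - R n b" for n
    using taylor[OF b, of n] by linarith
  ultimately have "(\<lambda>n. \<Sum>k<Suc n. b ^ k / fact k * G k a) \<longlonglongrightarrow> G 0 (a - b)"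
    using tendsto_diff[OF tendsto_const[of "G 0 (a - b)"], of "\<lambda>n. R n b" 0] by (simp only: diff_0_right)
  then show ?thesis unfolding sums_def by (rule LIMSEQ_imp_Suc)
qed

lemma cm_le_limit:
  assumes "cm g" "(g \<longlongrightarrow> L) (at_right 0)" "x > 0" shows "g x \<le> L"
proof (rule tendsto_lowerbound[OF assms(2)])
  show "\<forall>\<^sub>F y in at_right 0. g x \<le> g y"
    using eventually_at_right_real[OF assms(3)] by eventually_elim (auto intro: cm_antimono[OF assms(1)])
qed simp

text \<open>Write the Taylor series at \<open>a\<close> as \<open>g (a - a x) = \<Sum> p\<^sub>k x\<^sup>k\<close> with \<open>p\<^sub>k \<ge> 0\<close>. With \<open>x = exp (- \<tau>/a)\<close> this says that the
measure with mass \<open>p\<^sub>k\<close> at \<open>k/a\<close> has the Laplace transform \<open>g (a (1 - exp (- \<tau>/a)))\<close>, which tends to \<open>g \<tau>\<close> as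
\<open>a \<rightarrow> \<infinity>\<close>. The test function \<open>exp (- \<tau> max 0 s)\<close> is bounded and continuous on the whole line, as weak
convergence of distributions requires.\<close>

lemma ex_taylor_distribution:
  assumes g: "cm g" "(g \<longlongrightarrow> 1) (at_right 0)" and a: "a > 0"
  obtains \<sigma> where "real_distribution \<sigma>" "AE s in \<sigma>. 0 \<le> s"
    "\<And>\<tau>. \<tau> > 0 \<Longrightarrow> (\<integral>s. exp (- \<tau> * max 0 s) \<partial>\<sigma>) = g (a * (1 - exp (- \<tau> / a)))"
proof -
  obtain G where G: "G 0 = g" "\<And>n. cm (G n)"
    "\<And>n \<tau>. \<tau> > 0 \<Longrightarrow> (G n has_real_derivative - G (Suc n) \<tau>) (at \<tau>)"
    using cm_sequence[OF g(1)] by blast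
  define p where "p k = a ^ k / fact k * G k a" for k
  have p0: "p k \<ge> 0" for k using a cm_nonneg[OF G(2) a] by (simp add: p_def)
  have sums_x: "(\<lambda>k. p k * x ^ k) sums g (a - a * x)" if "0 \<le> x" "x < 1" for x
  proof -
    have "(\<lambda>k. (a * x) ^ k / fact k * G k a) sums G 0 (a - a * x)"
      using that a by (intro cm_taylor_sums[of G] G(2,3)) auto
    then show ?thesis by (simp add: p_def power_mult_distrib mult_ac G(1))
  qed
  have part: "(\<Sum>k<n. p k) \<le> 1" for n
  proof (rule tendsto_upperbound)
    show "((\<lambda>x. \<Sum>k<n. p k * x ^ k) \<longlongrightarrow> (\<Sum>k<n. p k)) (at_left 1)"
      by (auto intro!: tendsto_eq_intros)
    have "(\<Sum>k<n. p k * x ^ k) \<le> 1" if x: "0 < x" "x < 1" for x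
    proof -
      have "(\<Sum>k<n. p k * x ^ k) \<le> (\<Sum>k. p k * x ^ k)"
        using sums_x[of x] x p0 by (intro sum_le_suminf) (auto simp: sums_iff)
      also have "\<dots> = g (a - a * x)" using sums_x[of x] x by (simp add: sums_iff)
      also have "\<dots> \<le> 1" using x a by (intro cm_le_limit[OF g]) simp
      finally show ?thesis .
    qed
    then show "\<forall>\<^sub>F x in at_left 1. (\<Sum>k<n. p k * x ^ k) \<le> 1"
      using eventually_at_left_real[of 0 "1::real"] by (auto elim: eventually_mono)
  qed simp
  have summ: "summable p" using part p0 by (intro summableI_nonneg_bounded)
  have "suminf p = 1"
  proof (rule antisym)
    show "suminf p \<le> 1" using part summ by (intro suminf_le_const)
    show "1 \<le> suminf p"
    proof (rule tendsto_upperbound[OF g(2)])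
      have "g y \<le> suminf p" if y: "0 < y" "y < a" for y
      proof -
        have s: "(\<lambda>k. p k * (1 - y / a) ^ k) sums g y"
          using sums_x[of "1 - y / a"] y a by (simp add: algebra_simps)
        have "p k * (1 - y / a) ^ k \<le> p k" for k
          using p0[of k] y a mult_left_mono[of "(1 - y / a) ^ k" 1 "p k"] by (simp add: power_le_one)
        from sums_le[OF this s summable_sums[OF summ]] show ?thesis .
      qed
      then show "\<forall>\<^sub>F y in at_right 0. g y \<le> suminf p"
        using eventually_at_right_real[OF a] by (auto elim: eventually_mono)
    qed simp
  qed
  define P where "P = density (count_space UNIV) (\<lambda>k::nat. ennreal (p k))"
  have "emeasure P (space P) = (\<Sum>k. ennreal (p k))"
    by (simp add: P_def emeasure_density nn_integral_count_space_nat)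
  also have "\<dots> = ennreal (suminf p)" using p0 summ by (rule suminf_ennreal2)
  finally have "prob_space P" using \<open>suminf p = 1\<close> by (intro prob_spaceI) simp
  then interpret P: prob_space P .
  define \<sigma> where "\<sigma> = distr P borel (\<lambda>k. real k / a)"
  have m: "(\<lambda>k. real k / a) \<in> borel_measurable P" by (simp add: P_def)
  have rd: "real_distribution \<sigma>"
    unfolding \<sigma>_def by (intro P.real_distribution_distr m)
  have AE: "AE s in \<sigma>. 0 \<le> s"
    unfolding \<sigma>_def using a m by (subst AE_distr_iff) auto
  have "(\<integral>s. exp (- \<tau> * max 0 s) \<partial>\<sigma>) = g (a * (1 - exp (- \<tau> / a)))" if \<tau>: "\<tau> > 0" for \<tau>
  proof -
    have s: "(\<lambda>k. p k * exp (- \<tau> / a) ^ k) sums g (a - a * exp (- \<tau> / a))"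
      using \<tau> a by (intro sums_x) auto
    have e: "p k * exp (- \<tau> / a) ^ k = p k * exp (- \<tau> * max 0 (real k / a))" for k
      using a by (simp add: exp_of_nat_mult[symmetric] max_def)
    have "(\<integral>s. exp (- \<tau> * max 0 s) \<partial>\<sigma>) = (\<integral>k. exp (- \<tau> * max 0 (real k / a)) \<partial>P)"
      unfolding \<sigma>_def using m by (intro integral_distr) auto
    also have "\<dots> = (\<integral>k. p k * exp (- \<tau> * max 0 (real k / a)) \<partial>count_space UNIV)"
      unfolding P_def using p0 by (subst integral_density) auto
    also have "\<dots> = (\<Sum>k. p k * exp (- \<tau> * max 0 (real k / a)))"
      using s p0 unfolding e
      by (intro integral_count_space_nat) (auto simp: integrable_count_space_nat_iff sums_iff)
    also have "\<dots> = g (a - a * exp (- \<tau> / a))" using s unfolding e by (simp add: sums_iff)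
    finally show ?thesis by (simp add: algebra_simps)
  qed
  with rd AE show thesis by (rule that)
qed

text \<open>The Taylor distributions at \<open>a = 1, 2, \<dots>\<close> are tight, because their transforms at \<open>\<tau>\<close> are at least \<open>g \<tau>\<close>,
which is near \<open>1\<close> for small \<open>\<tau>\<close>. A weak limit along a subsequence has the transform \<open>g\<close>.\<close>

lemma bernstein_theorem_normalised:
  assumes g: "cm g" "(g \<longlongrightarrow> 1) (at_right 0)"
  obtains \<mu> where "halfline \<mu>" "\<And>\<tau>. \<tau> > 0 \<Longrightarrow> laplace \<mu> \<tau> = g \<tau>"
proof -
  define x where "x n \<tau> = real (Suc n) * (1 - exp (- \<tau> / real (Suc n)))" for n \<tau>
  have "\<exists>\<sigma>. real_distribution \<sigma> \<and> (AE s in \<sigma>. 0 \<le> s) \<and>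
    (\<forall>\<tau>>0. (\<integral>s. exp (- \<tau> * max 0 s) \<partial>\<sigma>) = g (x n \<tau>))" for n
    unfolding x_def by (rule ex_taylor_distribution[OF g, of "real (Suc n)"]) auto
  then have "\<exists>\<sigma>. \<forall>n. real_distribution (\<sigma> n) \<and> (AE s in \<sigma> n. 0 \<le> s) \<and>
    (\<forall>\<tau>>0. (\<integral>s. exp (- \<tau> * max 0 s) \<partial>\<sigma> n) = g (x n \<tau>))"
    by (intro choice allI)
  then obtain \<sigma> where \<sigma>: "\<And>n. real_distribution (\<sigma> n)" "\<And>n. AE s in \<sigma> n. 0 \<le> s"
    "\<And>n \<tau>. \<tau> > 0 \<Longrightarrow> (\<integral>s. exp (- \<tau> * max 0 s) \<partial>\<sigma> n) = g (x n \<tau>)"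
    by blast
  have x0: "x n \<tau> > 0" if "\<tau> > 0" for n \<tau> using that by (simp add: x_def)
  have xle: "x n \<tau> \<le> \<tau>" if "\<tau> > 0" for n \<tau>
  proof -
    have "1 - exp (- \<tau> / real (Suc n)) \<le> \<tau> / real (Suc n)"
      using exp_ge_add_one_self[of "- \<tau> / real (Suc n)"] by simp
    then have "real (Suc n) * (1 - exp (- \<tau> / real (Suc n))) \<le> real (Suc n) * (\<tau> / real (Suc n))"
      by (rule mult_left_mono) simp
    then show ?thesis by (simp add: x_def)
  qed
  have xlim: "(\<lambda>n. x n \<tau>) \<longlonglongrightarrow> \<tau>" for \<tau>
    unfolding x_def by real_asymp
  have e_cont: "isCont (\<lambda>s. exp (- \<tau> * max 0 s)) s" for \<tau> s :: real
    by (intro continuous_intros)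
  have e_int: "integrable N (\<lambda>s. exp (- \<tau> * max 0 s))" if "real_distribution N" "\<tau> > 0" for N and \<tau> :: real
  proof -
    interpret real_distribution N by fact
    show ?thesis using that(2) by (intro integrable_const_bound[where B = 1]) auto
  qed
  have tight: "tight \<sigma>"
    unfolding tight_def
  proof (intro conjI allI impI \<sigma>(1))
    fix \<epsilon> :: real assume \<epsilon>: "\<epsilon> > 0"
    have "\<forall>\<^sub>F \<tau> in at_right 0. 1 - \<epsilon> / 2 < g \<tau>"
      by (rule order_tendstoD(1)[OF g(2)]) (use \<epsilon> in simp)
    from eventually_happens[OF eventually_conj[OF this eventually_at_right_less[of 0]]]
    obtain \<tau> where \<tau>: "\<tau> > 0" "1 - \<epsilon> / 2 < g \<tau>" by auto
    \<comment> \<open>beyond this \<open>R\<close> the function \<open>1 - exp (- \<tau> s)\<close> is at least \<open>1/2\<close>\<close>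
    define R where "R = ln 2 / \<tau>"
    have R: "R > 0" "exp (- \<tau> * R) = 1 / 2" using \<tau> by (auto simp: R_def exp_minus)
    have "measure (\<sigma> n) {-1<..R} > 1 - \<epsilon>" for n
    proof -
      interpret N: real_distribution "\<sigma> n" by (rule \<sigma>)
      have ei: "integrable (\<sigma> n) (\<lambda>s. exp (- \<tau> * max 0 s))" by (rule e_int[OF \<sigma>(1) \<tau>(1)])
      have "(\<integral>s. 1 - indicator {-1<..R} s \<partial>\<sigma> n) \<le> (\<integral>s. 2 * (1 - exp (- \<tau> * max 0 s)) \<partial>\<sigma> n)"
      proof (rule integral_mono_AE)
        show "AE s in \<sigma> n. 1 - indicator {-1<..R} s \<le> 2 * (1 - exp (- \<tau> * max 0 s))"
          using \<sigma>(2)[of n]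
        proof eventually_elim
          case (elim s)
          show ?case
          proof (cases "s \<le> R")
            case True
            then show ?thesis using elim \<tau> by (simp add: max_def)
          next
            case False
            then have "exp (- \<tau> * s) \<le> exp (- \<tau> * R)" using \<tau> by simp
            then have "exp (- \<tau> * s) \<le> 1 / 2" unfolding R(2) .
            moreover have "max 0 s = s" "indicator {-1<..R} s = (0 :: real)" using False elim by auto
            ultimately show ?thesis by simp
          qed
        qed
      qed (use ei in \<open>auto simp: integrable_indicator_iff N.emeasure_eq_measure\<close>)
      also have "\<dots> = 2 * (1 - g (x n \<tau>))"
        using ei \<sigma>(3)[OF \<tau>(1), of n] N.prob_space by simp
      also have "\<dots> \<le> 2 * (1 - g \<tau>)"
        using cm_antimono[OF g(1) x0[OF \<tau>(1)] xle[OF \<tau>(1)]] by simp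
      also have "(\<integral>s. 1 - indicator {-1<..R} s \<partial>\<sigma> n) = 1 - measure (\<sigma> n) {-1<..R}"
        using N.prob_space by (subst Bochner_Integration.integral_diff)
          (auto simp: integrable_indicator_iff N.emeasure_eq_measure)
      finally show ?thesis using \<tau>(2) by simp
    qed
    then show "\<exists>a b. a < b \<and> (\<forall>n. 1 - \<epsilon> < measure (\<sigma> n) {a<..b})"
      using R by (intro exI[of _ "-1"] exI[of _ R]) auto
  qed
  obtain r N where r: "strict_mono (r :: nat \<Rightarrow> nat)" and N: "real_distribution N"
    and w: "weak_conv_m (\<sigma> \<circ> id \<circ> r) N"
    using tight_imp_convergent_subsubsequence[OF tight strict_mono_id] by blast
  interpret N: real_distribution N by fact
  have conv: "(\<lambda>n. \<integral>s. f s \<partial>\<sigma> (r n)) \<longlonglongrightarrow> (\<integral>s. f s \<partial>N)"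
    if "\<And>s. isCont f s" "\<And>s. \<bar>f s\<bar> \<le> 1" for f :: "real \<Rightarrow> real"
    using weak_conv_imp_integral_bdd_continuous_conv[of "\<sigma> \<circ> id \<circ> r" N f 1] w \<sigma>(1) N that by (simp add: comp_def)
  have AEN: "AE s in N. 0 \<le> s"
  proof -
    define f where "f s = min 1 (max 0 (- s))" for s :: real
    have f: "isCont f s" "\<bar>f s\<bar> \<le> 1" "0 \<le> f s" for s
      by (auto simp: f_def[abs_def] intro!: continuous_intros)
    have "(\<integral>s. f s \<partial>\<sigma> (r n)) = 0" for n
      by (rule integral_eq_zero_AE) (use \<sigma>(2)[of "r n"] in eventually_elim, simp add: f_def)
    then have "(\<integral>s. f s \<partial>N) = 0" using conv[OF f(1,2)] by (simp add: LIMSEQ_const_iff)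
    moreover have "f \<in> borel_measurable borel"
      using f(1) by (intro borel_measurable_continuous_onI continuous_at_imp_continuous_on) auto
    then have "integrable N f" using f by (intro N.integrable_const_bound[where B = 1]) auto
    ultimately have "AE s in N. f s = 0" using f(3) by (subst (asm) integral_nonneg_eq_0_iff_AE) auto
    then show ?thesis by eventually_elim (auto simp: f_def min_def max_def split: if_splits)
  qed
  have lapN: "(\<integral>s. exp (- \<tau> * max 0 s) \<partial>N) = g \<tau>" if \<tau>: "\<tau> > 0" for \<tau>
  proof -
    have "(\<lambda>n. g (x (r n) \<tau>)) \<longlonglongrightarrow> (\<integral>s. exp (- \<tau> * max 0 s) \<partial>N)"
    proof -
      have "(\<lambda>n. \<integral>s. exp (- \<tau> * max 0 s) \<partial>\<sigma> (r n)) \<longlonglongrightarrow> (\<integral>s. exp (- \<tau> * max 0 s) \<partial>N)"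
        by (rule conv[OF e_cont]) (use \<tau> in simp)
      then show ?thesis by (simp only: \<sigma>(3)[OF \<tau>])
    qed
    moreover have "(\<lambda>n. g (x (r n) \<tau>)) \<longlonglongrightarrow> g \<tau>"
      using DERIV_isCont[OF cm_derivative(1)[OF g(1) \<tau>]] LIMSEQ_subseq_LIMSEQ[OF xlim r]
      by (intro isCont_tendsto_compose[of _ g]) (auto simp: comp_def)
    ultimately show ?thesis by (rule LIMSEQ_unique)
  qed
  define \<mu> where "\<mu> = restrict_space N {0..}"
  show thesis
  proof (rule that[of \<mu>])
    show "halfline \<mu>"
      unfolding finite_measure_on_halfline_def \<mu>_def
      by (auto intro!: finite_measure_restrict_space N.finite_measure_axioms simp: sets_restrict_space)
    fix \<tau> :: real assume \<tau>: "\<tau> > 0"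
    have "laplace \<mu> \<tau> = (\<integral>s. indicator {0..} s *\<^sub>R exp (- s * \<tau>) \<partial>N)"
      unfolding laplace_def \<mu>_def by (rule integral_restrict_space) simp
    also have "\<dots> = (\<integral>s. exp (- \<tau> * max 0 s) \<partial>N)"
      using AEN by (intro integral_cong_AE) (auto elim!: eventually_mono simp: mult.commute max_def)
    finally show "laplace \<mu> \<tau> = g \<tau>" using lapN[OF \<tau>] by simp
  qed
qed

lemma halfline_scale:
  assumes \<mu>: "halfline \<mu>" and c: "c \<ge> 0"
  shows "halfline (density \<mu> (\<lambda>_. ennreal c))" "laplace (density \<mu> (\<lambda>_. ennreal c)) \<tau> = c * laplace \<mu> \<tau>"
proof -
  interpret finite_measure \<mu> using \<mu> by (rule halfline_finite)
  have "emeasure (density \<mu> (\<lambda>_. ennreal c)) (space \<mu>) = ennreal c * emeasure \<mu> (space \<mu>)"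
    by (subst emeasure_density) (auto simp: nn_integral_cmult_indicator)
  then have "finite_measure (density \<mu> (\<lambda>_. ennreal c))"
    by (intro finite_measureI) (simp add: ennreal_mult_eq_top_iff emeasure_eq_measure)
  then show "halfline (density \<mu> (\<lambda>_. ennreal c))"
    using halfline_sets[OF \<mu>] by (simp add: finite_measure_on_halfline_def)
  have "(\<lambda>s. exp (- s * \<tau>)) \<in> borel_measurable \<mu>"
    by (intro halfline_measurable[OF \<mu>] continuous_intros)
  then show "laplace (density \<mu> (\<lambda>_. ennreal c)) \<tau> = c * laplace \<mu> \<tau>"
    unfolding laplace_def using c by (subst integral_density) auto
qed

text \<open>A completely monotone function decreases from its limit at \<open>0\<close>, so it vanishes if the limit is \<open>0\<close>, and
otherwise it can be normalised by the limit.\<close>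

theorem bernstein_theorem:
  assumes g: "cm g" "(g \<longlongrightarrow> L) (at_right 0)"
  obtains \<mu> where "halfline \<mu>" "\<And>\<tau>. \<tau> > 0 \<Longrightarrow> laplace \<mu> \<tau> = g \<tau>" "measure \<mu> {0..} = L"
proof -
  have L: "L \<ge> 0" using cm_le_limit[OF g, of 1] cm_nonneg[OF g(1), of 1] by simp
  have "\<exists>\<mu>. halfline \<mu> \<and> (\<forall>\<tau>>0. laplace \<mu> \<tau> = g \<tau>)"
  proof (cases "L = 0")
    case True
    have "g \<tau> = 0" if "\<tau> > 0" for \<tau>
      using cm_le_limit[OF g that] cm_nonneg[OF g(1) that] True by simp
    then show ?thesis
      using halfline_scale[OF halfline_exp_measure[of 1], of 0] by (auto simp del: ennreal_0)
  next
    case False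
    have "((\<lambda>\<tau>. 1 / L * g \<tau>) \<longlongrightarrow> 1 / L * L) (at_right 0)" by (intro tendsto_intros g)
    then have "((\<lambda>\<tau>. 1 / L * g \<tau>) \<longlongrightarrow> 1) (at_right 0)" using False by simp
    moreover have "cm (\<lambda>\<tau>. 1 / L * g \<tau>)" using L by (intro cm_mult cm_const g(1)) simp
    ultimately obtain \<mu> where \<mu>: "halfline \<mu>" "\<And>\<tau>. \<tau> > 0 \<Longrightarrow> laplace \<mu> \<tau> = 1 / L * g \<tau>"
      using bernstein_theorem_normalised by blast
    have "laplace (density \<mu> (\<lambda>_. ennreal L)) \<tau> = g \<tau>" if "\<tau> > 0" for \<tau>
      using halfline_scale(2)[OF \<mu>(1) L] \<mu>(2)[OF that] False by simp
    then show ?thesis using halfline_scale(1)[OF \<mu>(1) L] by blast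
  qed
  then obtain \<mu> where \<mu>: "halfline \<mu>" "\<And>\<tau>. \<tau> > 0 \<Longrightarrow> laplace \<mu> \<tau> = g \<tau>" by blast
  have "(g \<longlongrightarrow> measure \<mu> {0..}) (at_right 0)"
    using laplace_tendsto_mass[OF \<mu>(1)]
  proof (rule Lim_transform_eventually)
    show "\<forall>\<^sub>F \<tau> in at_right 0. laplace \<mu> \<tau> = g \<tau>"
      using eventually_at_right_less[of 0] by eventually_elim (rule \<mu>)
  qed
  then have "measure \<mu> {0..} = L" using g(2) by (rule tendsto_unique[rotated]) simp
  with \<mu> show thesis by (rule that)
qed

lemma increasing_nonneg_tendsto:
  fixes f :: "real \<Rightarrow> real"
  assumes mono: "\<And>x y. 0 < x \<Longrightarrow> x \<le> y \<Longrightarrow> f x \<le> f y" and nonneg: "\<And>x. x > 0 \<Longrightarrow> 0 \<le> f x"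
  obtains a where "0 \<le> a" "(f \<longlongrightarrow> a) (at_right 0)"
proof -
  define a where "a = (INF x\<in>{0<..}. f x)"
  have bdd: "bdd_below (f ` {0<..})" using nonneg by (intro bdd_belowI2[where m = 0]) auto
  have le: "a \<le> f x" if "x > 0" for x unfolding a_def using that bdd by (intro cINF_lower) auto
  have nn: "0 \<le> a" unfolding a_def using nonneg by (intro cINF_greatest) auto
  have "(f \<longlongrightarrow> a) (at_right 0)"
  proof (rule order_tendstoI)
    fix y assume "y < a"
    with le show "\<forall>\<^sub>F x in at_right 0. y < f x"
      by (intro eventually_mono[OF eventually_at_right_less[of 0]]) force
  next
    fix y assume "a < y"
    then obtain z where z: "z > 0" "f z < y"
      unfolding a_def using bdd by (subst (asm) cINF_less_iff) auto
    show "\<forall>\<^sub>F x in at_right 0. f x < y"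
      using eventually_at_right_real[OF z(1)]
    proof eventually_elim
      case (elim x)
      then show ?case using mono[of x z] z by simp
    qed
  qed
  with nn show thesis by (rule that)
qed

lemma bernstein_theorem_bounded:
  assumes g: "cm g" and B: "\<And>\<tau>. \<tau> > 0 \<Longrightarrow> g \<tau> \<le> B"
  obtains \<mu> where "halfline \<mu>" "\<And>\<tau>. \<tau> > 0 \<Longrightarrow> laplace \<mu> \<tau> = g \<tau>"
proof -
  obtain a where "((\<lambda>\<tau>. B - g \<tau>) \<longlongrightarrow> a) (at_right 0)"
    by (rule increasing_nonneg_tendsto[of "\<lambda>\<tau>. B - g \<tau>"]) (use cm_antimono[OF g] B in auto)
  from tendsto_diff[OF tendsto_const this, of B] have "(g \<longlongrightarrow> B - a) (at_right 0)" by simp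
  from bernstein_theorem[OF g this] that show thesis by blast
qed

lemma chi_DERIV: "\<exists>D. (chi has_real_derivative D) (at y)"
proof -
  have "((\<lambda>z. integral {0..1} (\<lambda>r. r ^ 0 * exp (- (0 + r * z)))) has_real_derivative
      - integral {0..1} (\<lambda>r. r ^ Suc 0 * exp (- (0 + r * y)))) (at y)"
    by (rule averaged_sequence_derivative[where F = "\<lambda>n y. exp (- y)" and U = UNIV and V = UNIV])
      (auto intro!: derivative_eq_intros)
  then show ?thesis by (auto simp: chi_def[abs_def])
qed

lemma isCont_chi: "isCont chi y"
  using chi_DERIV DERIV_isCont by blast

lemma chi_0: "chi 0 = 1"
  by (simp add: chi_def)

lemma chi_le_1: "y \<ge> 0 \<Longrightarrow> chi y \<le> 1"
proof -
  assume y: "y \<ge> 0"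
  have "chi y \<le> integral {0..1} (\<lambda>r::real. 1)"
    unfolding chi_def using y
    by (intro integral_le integrable_continuous_interval continuous_intros) auto
  then show ?thesis by simp
qed

section \<open>Bernstein functions and their measures\<close>

definition bernstein_fun :: "(real \<Rightarrow> real) \<Rightarrow> bool"
  where "bernstein_fun \<psi> \<longleftrightarrow> (\<forall>\<tau>>0. 0 \<le> \<psi> \<tau>) \<and>
    (\<forall>\<tau>>0. (\<psi> has_real_derivative deriv \<psi> \<tau>) (at \<tau>)) \<and> cm (deriv \<psi>)"

lemma smooth_pos_deriv:
  assumes "smooth_pos f" "\<tau> > 0"
  shows "((deriv ^^ n) f has_real_derivative (deriv ^^ Suc n) f \<tau>) (at \<tau>)"
proof -
  have "(deriv ^^ n) f differentiable at \<tau>"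
    using assms by (auto simp: smooth_pos_def differentiable_on_def at_within_open[of _ "{0<..}"])
  then obtain D where "((deriv ^^ n) f has_real_derivative D) (at \<tau>)"
    by (auto simp: real_differentiable_def)
  with DERIV_imp_deriv[OF this] show ?thesis by simp
qed

lemma bernstein_imp_bernstein_fun:
  assumes "bernstein \<psi>" shows "bernstein_fun \<psi>"
proof -
  define G where "G n \<tau> = (- 1) ^ n * (deriv ^^ n) (deriv \<psi>) \<tau>" for n \<tau>
  have s: "smooth_pos \<psi>" "smooth_pos (deriv \<psi>)" and c: "\<And>n \<tau>. \<tau> > 0 \<Longrightarrow> 0 \<le> G n \<tau>"
    and nn: "\<And>\<tau>. \<tau> > 0 \<Longrightarrow> 0 \<le> \<psi> \<tau>"
    using assms by (auto simp: bernstein_def completely_monotone_def G_def)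
  have "cm (G 0)"
  proof (rule sequence_imp_cm[OF c])
    fix n and \<tau> :: real assume "\<tau> > 0"
    from DERIV_cmult[OF smooth_pos_deriv[OF s(2) this, of n], of "(- 1) ^ n"]
    show "(G n has_real_derivative - G (Suc n) \<tau>) (at \<tau>)" by (simp add: G_def[abs_def])
  qed
  moreover have "G 0 = deriv \<psi>" by (simp add: G_def[abs_def])
  ultimately have "cm (deriv \<psi>)" by simp
  then show ?thesis using smooth_pos_deriv[OF s(1), of _ 0] nn by (simp add: bernstein_fun_def)
qed

lemma bernstein_fun_ident: "bernstein_fun (\<lambda>\<tau>. \<tau>)"
proof -
  have "deriv (\<lambda>\<tau>::real. \<tau>) = (\<lambda>_. 1)" by (rule ext) (rule DERIV_imp_deriv, rule DERIV_ident)
  then show ?thesis using cm_const[of 1] by (auto simp: bernstein_fun_def intro: DERIV_ident)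
qed

context
  fixes \<psi> assumes \<psi>: "bernstein_fun \<psi>"
begin

lemma bf_nonneg: "\<tau> > 0 \<Longrightarrow> 0 \<le> \<psi> \<tau>"
  and bf_DERIV: "\<tau> > 0 \<Longrightarrow> (\<psi> has_real_derivative deriv \<psi> \<tau>) (at \<tau>)"
  and bf_cm: "cm (deriv \<psi>)"
  using \<psi> by (auto simp: bernstein_fun_def)

lemma bf_mono: assumes "0 < x" "x \<le> y" shows "\<psi> x \<le> \<psi> y"
proof (rule DERIV_nonneg_imp_nondecreasing[OF assms(2)])
  fix z assume "x \<le> z" "z \<le> y"
  then have "z > 0" using assms by simp
  then show "\<exists>l. (\<psi> has_real_derivative l) (at z) \<and> 0 \<le> l"
    using bf_DERIV cm_nonneg[OF bf_cm] by blast
qed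

lemma at_zero_tendsto: "(\<psi> \<longlongrightarrow> at_zero \<psi>) (at_right 0)"
  and at_zero_nonneg: "0 \<le> at_zero \<psi>"
proof -
  obtain a where a: "0 \<le> a" "(\<psi> \<longlongrightarrow> a) (at_right 0)"
    by (rule increasing_nonneg_tendsto[of \<psi>]) (auto intro: bf_mono bf_nonneg)
  have "at_zero \<psi> = a" unfolding at_zero_def by (rule tendsto_Lim) (use a in auto)
  with a show "(\<psi> \<longlongrightarrow> at_zero \<psi>) (at_right 0)" "0 \<le> at_zero \<psi>" by auto
qed

lemma ex_subordinator:
  assumes "t \<ge> 0"
  shows "\<exists>\<mu>. halfline \<mu> \<and> (\<forall>\<tau>>0. laplace \<mu> \<tau> = exp (- t * \<psi> \<tau>)) \<and> measure \<mu> {0..} = exp (- t * at_zero \<psi>)"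
proof -
  have "cm (\<lambda>\<tau>. exp (- t * \<psi> \<tau>))" by (rule cm_exp_compose[OF bf_DERIV bf_cm assms])
  moreover have "((\<lambda>\<tau>. exp (- t * \<psi> \<tau>)) \<longlongrightarrow> exp (- t * at_zero \<psi>)) (at_right 0)"
    by (intro tendsto_intros at_zero_tendsto)
  ultimately show ?thesis using bernstein_theorem by metis
qed

lemma ex_average:
  assumes "h \<ge> 0"
  shows "\<exists>\<theta>. halfline \<theta> \<and> (\<forall>\<tau>>0. laplace \<theta> \<tau> = chi (h * \<psi> \<tau>)) \<and> measure \<theta> {0..} \<le> 1"
proof -
  have "cm (\<lambda>\<tau>. chi (h * \<psi> \<tau>))" by (rule cm_chi_compose[OF bf_DERIV bf_cm assms])
  moreover have "((\<lambda>\<tau>. chi (h * \<psi> \<tau>)) \<longlongrightarrow> chi (h * at_zero \<psi>)) (at_right 0)"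
    by (rule isCont_tendsto_compose[OF isCont_chi]) (intro tendsto_intros at_zero_tendsto)
  moreover have "chi (h * at_zero \<psi>) \<le> 1" using assms at_zero_nonneg by (intro chi_le_1) simp
  ultimately show ?thesis using bernstein_theorem by metis
qed

text \<open>Shifting the argument makes \<open>\<psi>\<close> harmless at \<open>0\<close>:
\<open>\<psi>(z)/(1 + z) = \<psi>(1 + z)/(1 + z) - (\<psi>(1 + z) - \<psi>(z))/(1 + z)\<close>. The second fraction is completely monotone
and bounded. With \<open>J z = \<integral>\<^sub>0\<^sup>1 \<psi>'(1 + r z) dr\<close> one has \<open>\<psi>(1 + z) = \<psi> 1 + z J z\<close>, and therefore
\<open>\<psi>(1 + z)/(1 + z) = \<psi> 1/(1 + z) + J z - J z/(1 + z)\<close>.\<close>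

lemma ex_resolvent_quotient:
  shows "\<exists>\<alpha> \<beta>. halfline \<alpha> \<and> halfline \<beta> \<and> (\<forall>\<tau>>0. laplace \<alpha> \<tau> - laplace \<beta> \<tau> = \<psi> \<tau> / (1 + \<tau>))"
proof -
  define J where "J z = integral {0..1} (\<lambda>r. deriv \<psi> (1 + r * z))" for z
  have J: "J z * z = \<psi> (1 + z) - \<psi> 1" "J z \<le> deriv \<psi> 1" if z: "z > 0" for z
  proof -
    have pos: "1 + r * z > 0" if "r \<in> {0..1}" for r using that z by (simp add: add_pos_nonneg)
    have hi: "((\<lambda>r. deriv \<psi> (1 + r * z) * z) has_integral (\<psi> (1 + 1 * z) - \<psi> (1 + 0 * z))) {0..1}"
    proof (rule fundamental_theorem_of_calculus)
      fix r :: real assume r: "r \<in> {0..1}"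
      have "((\<lambda>r. 1 + r * z) has_real_derivative z) (at r)" by (auto intro!: derivative_eq_intros)
      from DERIV_chain2[where f = \<psi> and g = "\<lambda>r. 1 + r * z", OF bf_DERIV[OF pos[OF r]] this]
      show "((\<lambda>r. \<psi> (1 + r * z)) has_vector_derivative deriv \<psi> (1 + r * z) * z) (at r within {0..1})"
        unfolding has_real_derivative_iff_has_vector_derivative by (rule has_vector_derivative_at_within)
    qed simp
    from integral_unique[OF hi] show *: "J z * z = \<psi> (1 + z) - \<psi> 1" by (simp add: J_def)
    have "\<psi> (1 + 1 * z) - \<psi> (1 + 0 * z) \<le> deriv \<psi> 1 * z"
    proof (rule has_integral_le[OF hi])
      show "((\<lambda>r::real. deriv \<psi> 1 * z) has_integral deriv \<psi> 1 * z) {0..1}"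
        using has_integral_const_real[of "deriv \<psi> 1 * z" 0 1] by simp
      show "deriv \<psi> (1 + r * z) * z \<le> deriv \<psi> 1 * z" if "r \<in> {0..1}" for r
        using that z by (intro mult_right_mono cm_antimono[OF bf_cm]) auto
    qed
    then have "J z * z \<le> deriv \<psi> 1 * z" using * by simp
    then show "J z \<le> deriv \<psi> 1" using z by simp
  qed
  have cmJ: "cm J" unfolding J_def[abs_def] by (rule cm_average[OF bf_cm])
  have cmR: "cm (\<lambda>z. 1 / (1 + z))" by (rule cm_inverse_shift) simp
  define K where "K z = \<psi> (1 + z) - \<psi> z" for z
  have cmK: "cm K"
    unfolding cm_def
  proof
    fix n
    have "cm_upto (Suc n) K"
      unfolding cm_upto.simps
    proof (intro conjI allI impI exI[of _ "\<lambda>z. deriv \<psi> z - deriv \<psi> (1 + z)"])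
      fix z :: real assume z: "z > 0"
      show "0 \<le> K z" using bf_mono[of z "1 + z"] z by (simp add: K_def)
      have "((\<lambda>z. \<psi> (1 + z)) has_real_derivative deriv \<psi> (1 + z)) (at z)"
        by (rule has_real_derivative_shift) (use z in \<open>auto intro: bf_DERIV\<close>)
      from DERIV_diff[OF this bf_DERIV[OF z]]
      show "(K has_real_derivative - (deriv \<psi> z - deriv \<psi> (1 + z))) (at z)"
        by (simp add: K_def[abs_def])
    next
      show "cm_upto n (\<lambda>z. deriv \<psi> z - deriv \<psi> (1 + z))"
        using cm_difference[OF _ bf_cm, of 1] by (simp add: cm_def)
    qed
    then show "cm_upto n K" by (rule cm_upto_Suc_imp)
  qed
  have K_le: "K z \<le> \<psi> 2" if z: "z > 0" for z
  proof -
    have small: "K z \<le> \<psi> 2" if "0 < z" "z \<le> 1" for z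
      using bf_mono[of "1 + z" 2] bf_nonneg[of z] that by (simp add: K_def)
    show ?thesis
      using small[of z] small[of 1] cm_antimono[OF cmK, of 1 z] z by (cases "z \<le> 1") auto
  qed
  have frac: "1 / (1 + z) * y \<le> y" if "z > 0" "y \<ge> 0" for y z :: real
    using that by (simp add: divide_le_eq mult_left_le algebra_simps)
  obtain \<alpha> where \<alpha>: "halfline \<alpha>" "\<And>\<tau>. \<tau> > 0 \<Longrightarrow> laplace \<alpha> \<tau> = 1 / (1 + \<tau>) * \<psi> 1 + J \<tau>"
  proof (rule bernstein_theorem_bounded)
    show "cm (\<lambda>\<tau>. 1 / (1 + \<tau>) * \<psi> 1 + J \<tau>)"
      by (intro cm_add cm_mult cmR cmJ cm_const bf_nonneg) simp
    show "1 / (1 + \<tau>) * \<psi> 1 + J \<tau> \<le> \<psi> 1 + deriv \<psi> 1" if "\<tau> > 0" for \<tau>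
      using frac[OF that bf_nonneg[of 1]] J(2)[OF that] by simp
  qed blast
  obtain \<beta> where \<beta>: "halfline \<beta>" "\<And>\<tau>. \<tau> > 0 \<Longrightarrow> laplace \<beta> \<tau> = 1 / (1 + \<tau>) * J \<tau> + 1 / (1 + \<tau>) * K \<tau>"
  proof (rule bernstein_theorem_bounded)
    show "cm (\<lambda>\<tau>. 1 / (1 + \<tau>) * J \<tau> + 1 / (1 + \<tau>) * K \<tau>)"
      by (intro cm_add cm_mult cmR cmJ cmK)
    show "1 / (1 + \<tau>) * J \<tau> + 1 / (1 + \<tau>) * K \<tau> \<le> deriv \<psi> 1 + \<psi> 2" if "\<tau> > 0" for \<tau>
      using frac[OF that cm_nonneg[OF cmJ that]] frac[OF that cm_nonneg[OF cmK that]] J(2)[OF that] K_le[OF that]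
      by linarith
  qed blast
  have "laplace \<alpha> \<tau> - laplace \<beta> \<tau> = \<psi> \<tau> / (1 + \<tau>)" if \<tau>: "\<tau> > 0" for \<tau>
  proof -
    define i where "i = 1 / (1 + \<tau>)"
    have i: "i * (1 + \<tau>) = 1" using \<tau> by (simp add: i_def)
    have "(laplace \<alpha> \<tau> - laplace \<beta> \<tau>) * (1 + \<tau>) = (i * (1 + \<tau>)) * (\<psi> 1 - J \<tau> - K \<tau>) + J \<tau> * (1 + \<tau>)"
      unfolding \<alpha>(2)[OF \<tau>] \<beta>(2)[OF \<tau>] i_def[symmetric] by (simp add: algebra_simps)
    then have "(laplace \<alpha> \<tau> - laplace \<beta> \<tau>) * (1 + \<tau>) = \<psi> 1 + J \<tau> * \<tau> - K \<tau>"
      unfolding i by (simp add: algebra_simps)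
    also have "\<dots> = \<psi> \<tau>" using J(1)[OF \<tau>] by (simp add: K_def)
    finally show ?thesis using \<tau> by (simp add: field_simps)
  qed
  with \<alpha> \<beta> show ?thesis by blast
qed

end

section \<open>Resolvent and generator\<close>

context bounded_semigroup
begin

text \<open>Both sides have the transform \<open>(exp (- h \<psi>) - 1) \<kappa> = - h chi (h \<psi>) (\<psi> \<kappa>)\<close>. It plays the role
of the formula \<open>S h x - x = \<integral>\<^sub>0\<^sup>h (d/dr) S r x dr\<close>, without derivatives of orbits.\<close>

lemma difference_quotient_identity:
  assumes hl: "halfline \<kappa>" "halfline \<mu>" "halfline \<theta>" "halfline \<alpha>" "halfline \<beta>"
    and \<mu>: "\<And>\<tau>. \<tau> > 0 \<Longrightarrow> laplace \<mu> \<tau> = exp (- h * \<psi> \<tau>)"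
    and \<theta>: "\<And>\<tau>. \<tau> > 0 \<Longrightarrow> laplace \<theta> \<tau> = chi (h * \<psi> \<tau>)"
    and \<kappa>: "\<And>\<tau>. \<tau> > 0 \<Longrightarrow> laplace \<kappa> \<tau> * \<psi> \<tau> = a * laplace \<alpha> \<tau> - b * laplace \<beta> \<tau>"
  shows "measure_op \<mu> (measure_op \<kappa> x) - measure_op \<kappa> x
    = - (h *\<^sub>R measure_op \<theta> (a *\<^sub>R measure_op \<alpha> x - b *\<^sub>R measure_op \<beta> x))"
proof -
  have "1 *\<^sub>R measure_op (conv \<mu> \<kappa>) x + (- 1) *\<^sub>R measure_op \<kappa> x + (h * a) *\<^sub>R measure_op (conv \<theta> \<alpha>) x
      + (- (h * b)) *\<^sub>R measure_op (conv \<theta> \<beta>) x = 0"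
  proof (rule measure_op_combination_eq_zero)
    fix \<tau> :: real assume \<tau>: "\<tau> > 0"
    have "1 * laplace (conv \<mu> \<kappa>) \<tau> + - 1 * laplace \<kappa> \<tau> + h * a * laplace (conv \<theta> \<alpha>) \<tau>
        + - (h * b) * laplace (conv \<theta> \<beta>) \<tau>
      = exp (- h * \<psi> \<tau>) * laplace \<kappa> \<tau> - laplace \<kappa> \<tau>
        + h * (chi (h * \<psi> \<tau>) * (a * laplace \<alpha> \<tau> - b * laplace \<beta> \<tau>))"
      using \<tau> hl by (simp add: laplace_conv \<mu> \<theta> algebra_simps)
    also have "\<dots> = laplace \<kappa> \<tau> * (exp (- (h * \<psi> \<tau>)) - 1 + chi (h * \<psi> \<tau>) * (h * \<psi> \<tau>))"
      unfolding \<kappa>[OF \<tau>, symmetric] by (simp add: algebra_simps)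
    also have "\<dots> = 0" by (simp add: chi_mult)
    finally show "1 * laplace (conv \<mu> \<kappa>) \<tau> + - 1 * laplace \<kappa> \<tau> + h * a * laplace (conv \<theta> \<alpha>) \<tau>
        + - (h * b) * laplace (conv \<theta> \<beta>) \<tau> = 0" .
  qed (use hl in \<open>auto intro: halfline_conv\<close>)
  then show ?thesis
    using hl by (simp add: measure_op_conv blinfun.diff_right blinfun.scaleR_right algebra_simps)
qed

abbreviation resolvent_op :: "real \<Rightarrow> 'a \<Rightarrow>\<^sub>L 'a"
  where "resolvent_op c \<equiv> measure_op (exp_measure c)"

text \<open>The constant \<open>c\<close> stands for \<open>\<psi> 1\<close>.\<close>

lemma average_tendsto_id:
  assumes \<theta>: "\<And>h. h \<ge> 0 \<Longrightarrow> halfline (\<theta> h)" "\<And>h. h \<ge> 0 \<Longrightarrow> measure (\<theta> h) {0..} \<le> 1"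
    and l: "\<And>h. h \<ge> 0 \<Longrightarrow> laplace (\<theta> h) 1 = chi (h * c)"
  shows "((\<lambda>h. measure_op (\<theta> h) x) \<longlongrightarrow> x) (at_right 0)"
proof (rule measure_op_tendsto_id)
  show "\<forall>\<^sub>F h in at_right 0. halfline (\<theta> h) \<and> measure (\<theta> h) {0..} \<le> 1"
    using eventually_at_right_less[of 0] by eventually_elim (use \<theta> in auto)
  have "((\<lambda>h. chi (h * c)) \<longlongrightarrow> chi (0 * c)) (at_right 0)"
    by (rule isCont_tendsto_compose[OF isCont_chi]) (intro tendsto_intros)
  then have "((\<lambda>h. chi (h * c)) \<longlongrightarrow> 1) (at_right 0)" by (simp add: chi_0)
  then show "((\<lambda>h. laplace (\<theta> h) 1) \<longlongrightarrow> 1) (at_right 0)"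
  proof (rule Lim_transform_eventually)
    show "\<forall>\<^sub>F h in at_right 0. chi (h * c) = laplace (\<theta> h) 1"
      using eventually_at_right_less[of 0] by eventually_elim (use l in auto)
  qed
qed

text \<open>The difference quotient identity for \<open>\<psi> z = z\<close>, where \<open>z/(c + z) = 1 - c/(c + z)\<close>; the measure with
transform \<open>1\<close> is the point mass at \<open>0\<close>.\<close>

lemma generator_resolvent:
  assumes c: "c > 0"
  shows "(resolvent_op c x, c *\<^sub>R resolvent_op c x - x) \<in> generator T"
proof -
  obtain \<theta> where \<theta>: "\<And>h. h \<ge> 0 \<Longrightarrow> halfline (\<theta> h)" "\<And>h. h \<ge> 0 \<Longrightarrow> measure (\<theta> h) {0..} \<le> 1"
    "\<And>h \<tau>. h \<ge> 0 \<Longrightarrow> \<tau> > 0 \<Longrightarrow> laplace (\<theta> h) \<tau> = chi (h * \<tau>)"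
    using ex_average[OF bernstein_fun_ident] by metis
  have eq: "(T h (resolvent_op c x) - resolvent_op c x) /\<^sub>R h
      = - measure_op (\<theta> h) (x - c *\<^sub>R resolvent_op c x)" if h: "h > 0" for h
  proof -
    have "measure_op (point_mass h) (resolvent_op c x) - resolvent_op c x
      = - (h *\<^sub>R measure_op (\<theta> h) (1 *\<^sub>R measure_op (point_mass 0) x - c *\<^sub>R resolvent_op c x))"
    proof (rule difference_quotient_identity[where \<psi> = "\<lambda>\<tau>. \<tau>"])
      show "laplace (exp_measure c) \<tau> * \<tau> = 1 * laplace (point_mass 0) \<tau> - c * laplace (exp_measure c) \<tau>"
        if "\<tau> > 0" for \<tau>
        using that c by (simp add: laplace_exp_measure laplace_point_mass field_simps)
    qed (use h c \<theta> in \<open>auto simp: halfline_exp_measure halfline_point_mass laplace_point_mass\<close>)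
    then show ?thesis using h by (simp add: measure_op_point_mass T_0)
  qed
  have "((\<lambda>h. - measure_op (\<theta> h) (x - c *\<^sub>R resolvent_op c x)) \<longlongrightarrow> - (x - c *\<^sub>R resolvent_op c x)) (at_right 0)"
    by (intro tendsto_minus average_tendsto_id[where c = 1]) (use \<theta> in auto)
  then have "((\<lambda>h. (T h (resolvent_op c x) - resolvent_op c x) /\<^sub>R h) \<longlongrightarrow> - (x - c *\<^sub>R resolvent_op c x)) (at_right 0)"
  proof (rule Lim_transform_eventually)
    show "\<forall>\<^sub>F h in at_right 0. - measure_op (\<theta> h) (x - c *\<^sub>R resolvent_op c x)
        = (T h (resolvent_op c x) - resolvent_op c x) /\<^sub>R h"
      using eventually_at_right_less[of 0] by eventually_elim (use eq in auto)
  qed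
  then show ?thesis by (simp add: generator_def)
qed

lemma generator_unique: "(x, y) \<in> generator T \<Longrightarrow> (x, z) \<in> generator T \<Longrightarrow> y = z"
  unfolding generator_def using tendsto_unique[OF trivial_limit_at_right_real] by blast

lemma T_measure_op_commute:
  assumes "t \<ge> 0" "halfline \<mu>" shows "T t (measure_op \<mu> x) = measure_op \<mu> (T t x)"
  using measure_op_commute[OF halfline_point_mass[OF assms(1)] assms(2), of x] assms
  by (simp add: measure_op_point_mass)

lemma generator_measure_op:
  assumes "(x, y) \<in> generator T" "halfline \<mu>"
  shows "(measure_op \<mu> x, measure_op \<mu> y) \<in> generator T"
proof -
  have "((\<lambda>h. measure_op \<mu> ((T h x - x) /\<^sub>R h)) \<longlongrightarrow> measure_op \<mu> y) (at_right 0)"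
    using assms(1) by (intro blinfun.tendsto tendsto_const) (simp add: generator_def)
  then have "((\<lambda>h. (T h (measure_op \<mu> x) - measure_op \<mu> x) /\<^sub>R h) \<longlongrightarrow> measure_op \<mu> y) (at_right 0)"
  proof (rule Lim_transform_eventually)
    show "\<forall>\<^sub>F h in at_right 0. measure_op \<mu> ((T h x - x) /\<^sub>R h) = (T h (measure_op \<mu> x) - measure_op \<mu> x) /\<^sub>R h"
      using eventually_at_right_less[of 0]
      by eventually_elim (simp add: T_measure_op_commute assms(2) blinfun.diff_right blinfun.scaleR_right)
  qed
  then show ?thesis by (simp add: generator_def)
qed

lemma generator_iff_resolvent:
  assumes c: "c > 0"
  shows "(x, y) \<in> generator T \<longleftrightarrow> x = resolvent_op c (c *\<^sub>R x - y)"
proof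
  assume "(x, y) \<in> generator T"
  from generator_unique[OF generator_measure_op[OF this halfline_exp_measure[OF c]] generator_resolvent[OF c]]
  show "x = resolvent_op c (c *\<^sub>R x - y)" by (simp add: blinfun.diff_right blinfun.scaleR_right)
next
  assume x: "x = resolvent_op c (c *\<^sub>R x - y)"
  show "(x, y) \<in> generator T" using generator_resolvent[OF c, of "c *\<^sub>R x - y"] x[symmetric] by simp
qed

lemma resolvent_op_inj:
  assumes c: "c > 0" and eq: "resolvent_op c x = resolvent_op c y" shows "x = y"
proof -
  have "resolvent_op c (x - y) = 0" using eq by (simp add: blinfun.diff_right)
  with generator_resolvent[OF c, of "x - y"] have "(0, - (x - y)) \<in> generator T" by simp
  moreover have "(0, 0) \<in> generator T" by (simp add: generator_def)
  ultimately have "- (x - y) = 0" by (rule generator_unique)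
  then show ?thesis by simp
qed

end

text \<open>The generator determines the resolvents, which are the Laplace transforms of the orbits.\<close>

theorem semigroup_determined_by_generator:
  fixes T U :: "real \<Rightarrow> 'a::complex_banach \<Rightarrow>\<^sub>L 'a"
  assumes "bounded_C0_semigroup T" "bounded_C0_semigroup U" and gen: "generator T = generator U" and t: "t \<ge> 0"
  shows "T t x = U t x"
proof (rule functional_eqI)
  interpret T: bounded_semigroup T by unfold_locales fact
  interpret U: bounded_semigroup U by unfold_locales fact
  fix \<phi> :: "'a \<Rightarrow>\<^sub>L real"
  define B where "B = norm \<phi> * (sg_bound T * norm x) + norm \<phi> * (sg_bound U * norm x)"
  have "\<phi> (T t x) - \<phi> (U t x) = 0"
  proof (rule exp_integrals_zero_imp_zero[where u = "\<lambda>s. \<phi> (T s x) - \<phi> (U s x)" and B = B, OF _ _ _ t])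
    show "continuous_on {0..} (\<lambda>s. \<phi> (T s x) - \<phi> (U s x))"
      by (intro continuous_on_diff T.orbit_functional U.orbit_functional)
    show "\<bar>\<phi> (T s x) - \<phi> (U s x)\<bar> \<le> B" if "s \<ge> 0" for s
      using T.orbit_functional(2)[OF that, of \<phi> x] U.orbit_functional(2)[OF that, of \<phi> x] by (simp add: B_def)
    fix c :: real assume c: "c > 0"
    let ?r = "T.resolvent_op c x"
    have "(?r, c *\<^sub>R ?r - x) \<in> generator U" using T.generator_resolvent[OF c] gen by simp
    then have "?r = U.resolvent_op c x" using U.generator_iff_resolvent[OF c] by simp
    then have "\<phi> (T.resolvent_op c x) = \<phi> (U.resolvent_op c x)" by simp
    then show "(\<integral>s. \<phi> (T s x) - \<phi> (U s x) \<partial>exp_measure c) = 0"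
      using T.orbit_integrable[OF halfline_exp_measure[OF c]] U.orbit_integrable[OF halfline_exp_measure[OF c]]
      by (simp add: T.measure_op_functional U.measure_op_functional halfline_exp_measure c)
  qed
  then show "\<phi> (T t x) = \<phi> (U t x)" by simp
qed

section \<open>The subordinate semigroup and its generator\<close>

locale subordination = bounded_semigroup T
  for T :: "real \<Rightarrow> ('a::complex_banach \<Rightarrow>\<^sub>L 'a)" +
  fixes \<psi> :: "real \<Rightarrow> real"
  assumes \<psi>: "bernstein_fun \<psi>"
begin

definition \<mu> :: "real \<Rightarrow> real measure"
  where "\<mu> t = (SOME \<mu>. halfline \<mu> \<and> (\<forall>\<tau>>0. laplace \<mu> \<tau> = exp (- t * \<psi> \<tau>)) \<and>
    measure \<mu> {0..} = exp (- t * at_zero \<psi>))"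

definition \<theta> :: "real \<Rightarrow> real measure"
  where "\<theta> h = (SOME \<theta>. halfline \<theta> \<and> (\<forall>\<tau>>0. laplace \<theta> \<tau> = chi (h * \<psi> \<tau>)) \<and> measure \<theta> {0..} \<le> 1)"

lemma \<mu>:
  assumes "t \<ge> 0"
  shows "halfline (\<mu> t)" "\<tau> > 0 \<Longrightarrow> laplace (\<mu> t) \<tau> = exp (- t * \<psi> \<tau>)"
    "measure (\<mu> t) {0..} = exp (- t * at_zero \<psi>)"
  using someI_ex[OF ex_subordinator[OF \<psi> assms]] unfolding \<mu>_def by auto

lemma \<theta>:
  assumes "h \<ge> 0"
  shows "halfline (\<theta> h)" "\<tau> > 0 \<Longrightarrow> laplace (\<theta> h) \<tau> = chi (h * \<psi> \<tau>)" "measure (\<theta> h) {0..} \<le> 1"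
  using someI_ex[OF ex_average[OF \<psi> assms]] unfolding \<theta>_def by auto

definition S :: "real \<Rightarrow> 'a \<Rightarrow>\<^sub>L 'a"
  where "S t = measure_op (\<mu> t)"

lemma norm_S_le: "t \<ge> 0 \<Longrightarrow> norm (S t x) \<le> M * exp (- t * at_zero \<psi>) * norm x"
  using norm_measure_op_le[OF \<mu>(1), of t x] \<mu>(3)[of t] by (simp add: S_def)

lemma norm_S_le_M: "t \<ge> 0 \<Longrightarrow> norm (S t x) \<le> M * norm x"
proof -
  assume t: "t \<ge> 0"
  have "M * exp (- t * at_zero \<psi>) * norm x \<le> M * 1 * norm x"
    using t at_zero_nonneg[OF \<psi>] M_nonneg by (intro mult_right_mono mult_left_mono) auto
  with norm_S_le[OF t, of x] show ?thesis by simp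
qed

lemma S_add: "s \<ge> 0 \<Longrightarrow> t \<ge> 0 \<Longrightarrow> S (s + t) x = S s (S t x)"
  unfolding S_def by (subst measure_op_conv[symmetric])
    (auto intro!: measure_op_eqI halfline_conv simp: \<mu> laplace_conv exp_add[symmetric] algebra_simps)

lemma S_0: "S 0 x = x"
  using measure_op_eqI[of "\<mu> 0" "point_mass 0" x]
  by (simp add: S_def \<mu> halfline_point_mass laplace_point_mass measure_op_point_mass T_0)

lemma S_tendsto: "((\<lambda>t. S t x) \<longlongrightarrow> x) (at_right 0)"
  unfolding S_def
proof (rule measure_op_tendsto_id)
  show "\<forall>\<^sub>F h in at_right 0. halfline (\<mu> h) \<and> measure (\<mu> h) {0..} \<le> 1"
    using eventually_at_right_less[of 0]
    by eventually_elim (simp add: \<mu> at_zero_nonneg[OF \<psi>])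
  have "((\<lambda>h. exp (- h * \<psi> 1)) \<longlongrightarrow> exp (- 0 * \<psi> 1)) (at_right 0)" by (intro tendsto_intros)
  then have "((\<lambda>h. exp (- h * \<psi> 1)) \<longlongrightarrow> 1) (at_right 0)" by simp
  then show "((\<lambda>h. laplace (\<mu> h) 1) \<longlongrightarrow> 1) (at_right 0)"
  proof (rule Lim_transform_eventually)
    show "\<forall>\<^sub>F h in at_right 0. exp (- h * \<psi> 1) = laplace (\<mu> h) 1"
      using eventually_at_right_less[of 0] by eventually_elim (simp add: \<mu>)
  qed
qed

lemma S_bounded_C0_semigroup: "bounded_C0_semigroup S"
  unfolding bounded_C0_semigroup_def C0_semigroup_def clinear_op_def
proof (intro conjI allI impI)
  show "S t (c *\<^sub>C x) = c *\<^sub>C S t x" if "0 \<le> t" for t c x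
    using measure_op_clinear[OF \<mu>(1)[OF that]] by (simp add: S_def)
  show "S 0 = id_blinfun" by (rule blinfun_eqI) (simp add: S_0)
  show "S (s + t) = S s o\<^sub>L S t" if "0 \<le> s" "0 \<le> t" for s t
    by (rule blinfun_eqI) (simp add: S_add that)
  show "((\<lambda>t. S t x) \<longlongrightarrow> x) (at_right 0)" for x by (rule S_tendsto)
  have "norm (S t) \<le> M" if "t \<ge> 0" for t
    using norm_S_le_M[OF that] M_nonneg by (intro norm_blinfun_bound)
  then show "bounded (S ` {0..})" unfolding bounded_iff by auto
qed

sublocale S: bounded_semigroup S
  by unfold_locales (rule S_bounded_C0_semigroup)

lemma \<theta>_tendsto: "((\<lambda>h. measure_op (\<theta> h) x) \<longlongrightarrow> x) (at_right 0)"
  by (rule average_tendsto_id[where c = "\<psi> 1"]) (use \<theta> in auto)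

lemma S_commute: "t \<ge> 0 \<Longrightarrow> halfline \<nu> \<Longrightarrow> S t (measure_op \<nu> x) = measure_op \<nu> (S t x)"
  unfolding S_def by (rule measure_op_commute[OF \<mu>(1)])

text \<open>With \<open>R = (1 + A)\<^sup>-\<^sup>1\<close> and \<open>B\<close> the operator of \<open>\<psi>/(1 + z)\<close>, the difference quotients satisfy
\<open>R ((S h x - x)/h) = - \<theta>\<^sub>h(A) B x\<close>. If \<open>B x = R y\<close>, then \<open>R\<close> can be cancelled, as it is injective and commutes with
\<open>\<theta>\<^sub>h(A)\<close>, and the quotients are equal to \<open>- \<theta>\<^sub>h(A) y\<close>.\<close>

lemma generator_S_iff:
  assumes ab: "halfline \<alpha>" "halfline \<beta>" "\<And>\<tau>. \<tau> > 0 \<Longrightarrow> laplace \<alpha> \<tau> - laplace \<beta> \<tau> = \<psi> \<tau> / (1 + \<tau>)"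
  shows "(x, - y) \<in> generator S \<longleftrightarrow> measure_op \<alpha> x - measure_op \<beta> x = resolvent_op 1 y"
proof -
  define B where "B x = measure_op \<alpha> x - measure_op \<beta> x" for x
  have e: "halfline (exp_measure 1)" by (simp add: halfline_exp_measure)
  have quot: "resolvent_op 1 ((S h x - x) /\<^sub>R h) = - measure_op (\<theta> h) (B x)" if h: "h > 0" for h
  proof -
    have "measure_op (\<mu> h) (resolvent_op 1 x) - resolvent_op 1 x
      = - (h *\<^sub>R measure_op (\<theta> h) (1 *\<^sub>R measure_op \<alpha> x - 1 *\<^sub>R measure_op \<beta> x))"
      by (rule difference_quotient_identity[where \<psi> = \<psi>])
        (use h ab \<mu> \<theta> e in \<open>auto simp: laplace_exp_measure\<close>)
    then have "S h (resolvent_op 1 x) - resolvent_op 1 x = - (h *\<^sub>R measure_op (\<theta> h) (B x))"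
      by (simp add: S_def B_def)
    then show ?thesis using h e by (simp add: S_commute blinfun.scaleR_right blinfun.diff_right)
  qed
  show ?thesis
  proof
    assume "(x, - y) \<in> generator S"
    then have "((\<lambda>h. resolvent_op 1 ((S h x - x) /\<^sub>R h)) \<longlongrightarrow> resolvent_op 1 (- y)) (at_right 0)"
      by (intro blinfun.tendsto tendsto_const) (simp add: generator_def)
    moreover have "((\<lambda>h. resolvent_op 1 ((S h x - x) /\<^sub>R h)) \<longlongrightarrow> - B x) (at_right 0)"
    proof (rule Lim_transform_eventually[OF tendsto_minus[OF \<theta>_tendsto]])
      show "\<forall>\<^sub>F h in at_right 0. - measure_op (\<theta> h) (B x) = resolvent_op 1 ((S h x - x) /\<^sub>R h)"
        using eventually_at_right_less[of 0] by eventually_elim (use quot in auto)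
    qed
    ultimately have "resolvent_op 1 (- y) = - B x" by (rule tendsto_unique[rotated]) simp
    then have "B x = resolvent_op 1 y" by (simp only: blinfun.minus_right neg_equal_iff_equal)
    then show "measure_op \<alpha> x - measure_op \<beta> x = resolvent_op 1 y" by (simp add: B_def)
  next
    assume "measure_op \<alpha> x - measure_op \<beta> x = resolvent_op 1 y"
    then have "B x = resolvent_op 1 y" by (simp add: B_def)
    then have "resolvent_op 1 ((S h x - x) /\<^sub>R h) = resolvent_op 1 (- measure_op (\<theta> h) y)" if "h > 0" for h
      using quot[OF that] measure_op_commute[OF \<theta>(1) e, of h y] that by (simp add: blinfun.minus_right)
    then have eq: "(S h x - x) /\<^sub>R h = - measure_op (\<theta> h) y" if "h > 0" for h
      using resolvent_op_inj[of 1] that by simp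
    have "((\<lambda>h. (S h x - x) /\<^sub>R h) \<longlongrightarrow> - y) (at_right 0)"
    proof (rule Lim_transform_eventually[OF tendsto_minus[OF \<theta>_tendsto]])
      show "\<forall>\<^sub>F h in at_right 0. - measure_op (\<theta> h) y = (S h x - x) /\<^sub>R h"
        using eventually_at_right_less[of 0] by eventually_elim (use eq in auto)
    qed
    then show "(x, - y) \<in> generator S" by (simp add: generator_def)
  qed
qed

text \<open>The calculus quantifies over all representing semigroups and measures; uniqueness of semigroups and
of Laplace transforms makes the value independent of them.\<close>

lemma laplace_calculus_iff:
  assumes gen: "generator T = op_neg A"
    and ab: "halfline \<alpha>" "halfline \<beta>" "\<And>\<tau>. \<tau> > 0 \<Longrightarrow> laplace \<alpha> \<tau> - laplace \<beta> \<tau> = f \<tau>"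
  shows "(x, w) \<in> laplace_calculus f A \<longleftrightarrow> w = measure_op \<alpha> x - measure_op \<beta> x"
proof
  assume "(x, w) \<in> laplace_calculus f A"
  then obtain U m n u v where U: "bounded_C0_semigroup U" "generator U = op_neg A"
    and mn: "is_laplace_transform f m n"
    and u: "has_vec_integral m (\<lambda>s. U s x) u" and v: "has_vec_integral n (\<lambda>s. U s x) v" and w: "w = u - v"
    by (auto simp: laplace_calculus_def)
  have h: "halfline m" "halfline n" "\<And>\<tau>. \<tau> > 0 \<Longrightarrow> laplace m \<tau> - laplace n \<tau> = f \<tau>"
    using mn by (auto simp: is_laplace_transform_def laplace_def)
  have UT: "U s x = T s x" if "s \<ge> 0" for s
    by (rule semigroup_determined_by_generator[OF U(1) bounded_semigroup _ that]) (use U gen in simp)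
  have eq: "y = measure_op \<nu> x" if "halfline \<nu>" "has_vec_integral \<nu> (\<lambda>s. U s x) y" for \<nu> y
  proof (rule functional_eqI)
    fix \<phi> :: "'a \<Rightarrow>\<^sub>L real"
    have "\<phi> y = (\<integral>s. \<phi> (U s x) \<partial>\<nu>)"
      using has_vec_integral_functional[OF that(2), of \<phi>] by (simp add: has_bochner_integral_integral_eq)
    also have "\<dots> = (\<integral>s. \<phi> (T s x) \<partial>\<nu>)"
      by (rule Bochner_Integration.integral_cong) (auto simp: halfline_space[OF that(1)] UT)
    also have "\<dots> = \<phi> (measure_op \<nu> x)" by (rule measure_op_functional[OF that(1), symmetric])
    finally show "\<phi> y = \<phi> (measure_op \<nu> x)" .
  qed
  have "1 *\<^sub>R measure_op m x + (- 1) *\<^sub>R measure_op n x + (- 1) *\<^sub>R measure_op \<alpha> x + 1 *\<^sub>R measure_op \<beta> x = 0"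
  proof (rule measure_op_combination_eq_zero[OF h(1,2) ab(1,2)])
    fix \<tau> :: real assume "\<tau> > 0"
    from h(3)[OF this] ab(3)[OF this]
    show "1 * laplace m \<tau> + - 1 * laplace n \<tau> + - 1 * laplace \<alpha> \<tau> + 1 * laplace \<beta> \<tau> = 0" by simp
  qed
  then have "(measure_op m x - measure_op n x) - (measure_op \<alpha> x - measure_op \<beta> x) = 0"
    by (simp add: algebra_simps)
  then show "w = measure_op \<alpha> x - measure_op \<beta> x"
    unfolding w eq[OF h(1) u] eq[OF h(2) v] by (rule right_minus_eq[THEN iffD1])
next
  assume w: "w = measure_op \<alpha> x - measure_op \<beta> x"
  have "is_laplace_transform f \<alpha> \<beta>" using ab by (auto simp: is_laplace_transform_def laplace_def)
  then show "(x, w) \<in> laplace_calculus f A"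
    using bounded_semigroup gen measure_op_vec[OF ab(1), of x] measure_op_vec[OF ab(2), of x] w
    unfolding laplace_calculus_def by blast
qed

theorem generator_S:
  assumes gen: "generator T = op_neg A"
  shows "generator S = op_neg (bernstein_calculus \<psi> A)"
proof -
  obtain \<alpha> \<beta> where ab: "halfline \<alpha>" "halfline \<beta>" "\<And>\<tau>. \<tau> > 0 \<Longrightarrow> laplace \<alpha> \<tau> - laplace \<beta> \<tau> = \<psi> \<tau> / (1 + \<tau>)"
    using ex_resolvent_quotient[OF \<psi>] by blast
  have neg: "(x, - y) \<in> op_neg G \<longleftrightarrow> (x, y) \<in> G" for x y :: 'a and G
    by (auto simp: op_neg_def)
  have "(x, y) \<in> bernstein_calculus \<psi> A \<longleftrightarrow> measure_op \<alpha> x - measure_op \<beta> x = resolvent_op 1 y" for x y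
  proof -
    let ?w = "measure_op \<alpha> x - measure_op \<beta> x"
    have "(x, y) \<in> bernstein_calculus \<psi> A \<longleftrightarrow> (?w, y) \<in> op_one_plus A"
      unfolding bernstein_calculus_def using laplace_calculus_iff[OF gen ab] by auto
    also have "\<dots> \<longleftrightarrow> (?w, y - ?w) \<in> A"
      by (auto simp: op_one_plus_def) (metis add.commute diff_add_cancel)
    also have "\<dots> \<longleftrightarrow> (?w, - (y - ?w)) \<in> generator T" unfolding gen neg ..
    also have "\<dots> \<longleftrightarrow> ?w = resolvent_op 1 y"
      by (subst generator_iff_resolvent[of 1]) auto
    finally show ?thesis .
  qed
  then have "(x, - y) \<in> generator S \<longleftrightarrow> (x, - y) \<in> op_neg (bernstein_calculus \<psi> A)" for x y
    using generator_S_iff[OF ab] neg by blast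
  then show ?thesis by (metis (no_types, opaque_lifting) minus_minus subset_antisym subrelI)
qed

end

section \<open>Integrals of s/(s + u) against the subordinator\<close>

lemma ennreal_ratio_eq_nn_integral:
  fixes s u :: real
  assumes "s \<ge> 0" "u \<ge> 0"
  shows "ennreal (s / (s + u)) =
    (\<integral>\<^sup>+\<tau>. ennreal (s * exp (- s * \<tau>)) * ennreal (exp (- u * \<tau>)) * indicator {0<..} \<tau> \<partial>lborel)"
proof (cases "s = 0")
  case False
  then have c: "s + u > 0" using assms by simp
  have "ennreal s * ennreal (1 / (s + u))
    = (\<integral>\<^sup>+\<tau>. ennreal s * (ennreal (exp (- (s + u) * \<tau>)) * indicator {0..} \<tau>) \<partial>lborel)"
    by (subst nn_integral_cmult) (simp_all only: nn_integral_exp[OF c], measurable)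
  also have "\<dots> = (\<integral>\<^sup>+\<tau>. ennreal (s * exp (- s * \<tau>)) * ennreal (exp (- u * \<tau>)) * indicator {0<..} \<tau> \<partial>lborel)"
  proof (rule nn_integral_cong_AE)
    show "AE \<tau> in lborel. ennreal s * (ennreal (exp (- (s + u) * \<tau>)) * indicator {0..} \<tau>)
        = ennreal (s * exp (- s * \<tau>)) * ennreal (exp (- u * \<tau>)) * indicator {0<..} \<tau>"
      using AE_lborel_singleton[of 0]
    proof eventually_elim
      case (elim \<tau>)
      have "exp (- (s + u) * \<tau>) = exp (- s * \<tau>) * exp (- u * \<tau>)"
        unfolding exp_add[symmetric] by (simp add: algebra_simps)
      moreover have "indicator {0..} \<tau> = (indicator {0<..} \<tau> :: ennreal)"
        using elim by (auto split: split_indicator)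
      ultimately show ?case using assms by (simp add: ennreal_mult mult.assoc)
    qed
  qed
  finally show ?thesis using assms by (simp add: ennreal_mult[symmetric])
qed simp

lemma halfline_borel_fst_snd:
  assumes "halfline m"
  shows "fst \<in> borel_measurable (m \<Otimes>\<^sub>M N)" "snd \<in> borel_measurable (N \<Otimes>\<^sub>M m)"
proof -
  have "(\<lambda>s. s) \<in> borel_measurable m" by (rule halfline_measurable[OF assms]) simp
  from measurable_compose[OF measurable_fst this] measurable_compose[OF measurable_snd this]
  show "fst \<in> borel_measurable (m \<Otimes>\<^sub>M N)" "snd \<in> borel_measurable (N \<Otimes>\<^sub>M m)" by auto
qed

lemma nn_integral_exp_eq_laplace:
  assumes "halfline m" "\<tau> \<ge> 0"
  shows "(\<integral>\<^sup>+s. ennreal (exp (- s * \<tau>)) \<partial>m) = ennreal (laplace m \<tau>)"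
  unfolding laplace_def by (rule nn_integral_eq_integral[OF integrable_exp[OF assms]]) simp

text \<open>Tonelli's theorem applied to \<open>s/(s + u) = \<integral>\<^sub>0\<^sup>\<infinity> s exp (- s \<tau>) exp (- u \<tau>) d\<tau>\<close>. At \<open>u = 0 = s\<close> both sides are
\<open>0\<close>, so the formula also covers an atom of \<open>n\<close> at \<open>0\<close>.\<close>

lemma nn_integral_ratio:
  assumes m: "halfline m" and n: "halfline n"
  shows "(\<integral>\<^sup>+u. (\<integral>\<^sup>+s. ennreal (s / (s + u)) \<partial>m) \<partial>n) =
    (\<integral>\<^sup>+\<tau>. (\<integral>\<^sup>+s. ennreal (s * exp (- s * \<tau>)) \<partial>m) * ennreal (laplace n \<tau>) * indicator {0<..} \<tau> \<partial>lborel)"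
proof -
  interpret m: finite_measure m using m by (rule halfline_finite)
  interpret n: finite_measure n using n by (rule halfline_finite)
  interpret ml: pair_sigma_finite m lborel ..
  interpret nl: pair_sigma_finite n lborel ..
  note [measurable] = halfline_borel_fst_snd[OF m] halfline_borel_fst_snd[OF n]
  define L where "L \<tau> = (\<integral>\<^sup>+s. ennreal (s * exp (- s * \<tau>)) \<partial>m)" for \<tau>
  have "(\<lambda>p. ennreal (snd p * exp (- snd p * fst p))) \<in> borel_measurable (lborel \<Otimes>\<^sub>M m)"
    by measurable
  from m.borel_measurable_nn_integral_fst[OF this]
  have Lm [measurable]: "L \<in> borel_measurable lborel" by (simp add: L_def[abs_def])
  have sm: "(\<lambda>s. ennreal (s * exp (- s * \<tau>))) \<in> borel_measurable m" for \<tau>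
    by (intro measurable_compose[OF halfline_measurable[OF m] measurable_ennreal] continuous_intros)
  have um: "(\<lambda>u. ennreal (exp (- u * \<tau>))) \<in> borel_measurable n" for \<tau>
    by (intro measurable_compose[OF halfline_measurable[OF n] measurable_ennreal] continuous_intros)
  have inner: "(\<integral>\<^sup>+s. ennreal (s / (s + u)) \<partial>m)
      = (\<integral>\<^sup>+\<tau>. ennreal (exp (- u * \<tau>)) * (L \<tau> * indicator {0<..} \<tau>) \<partial>lborel)" if u: "u \<in> space n" for u
  proof -
    have u0: "u \<ge> 0" using u by (simp add: halfline_space[OF n])
    have "(\<integral>\<^sup>+s. ennreal (s / (s + u)) \<partial>m) = (\<integral>\<^sup>+s. (\<integral>\<^sup>+\<tau>. ennreal (s * exp (- s * \<tau>)) *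
        ennreal (exp (- u * \<tau>)) * indicator {0<..} \<tau> \<partial>lborel) \<partial>m)"
    proof (rule nn_integral_cong)
      fix s assume "s \<in> space m"
      then have "s \<ge> 0" by (simp add: halfline_space[OF m])
      then show "ennreal (s / (s + u)) = (\<integral>\<^sup>+\<tau>. ennreal (s * exp (- s * \<tau>)) *
          ennreal (exp (- u * \<tau>)) * indicator {0<..} \<tau> \<partial>lborel)"
        using u0 by (rule ennreal_ratio_eq_nn_integral)
    qed
    also have "\<dots> = (\<integral>\<^sup>+\<tau>. (\<integral>\<^sup>+s. ennreal (s * exp (- s * \<tau>)) *
        ennreal (exp (- u * \<tau>)) * indicator {0<..} \<tau> \<partial>m) \<partial>lborel)"
      by (rule ml.Fubini'[symmetric]) (unfold case_prod_beta, measurable)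
    also have "\<dots> = (\<integral>\<^sup>+\<tau>. ennreal (exp (- u * \<tau>)) * (L \<tau> * indicator {0<..} \<tau>) \<partial>lborel)"
    proof (rule nn_integral_cong)
      fix \<tau> :: real
      have "(\<integral>\<^sup>+s. ennreal (s * exp (- s * \<tau>)) * ennreal (exp (- u * \<tau>)) * indicator {0<..} \<tau> \<partial>m)
        = (\<integral>\<^sup>+s. ennreal (s * exp (- s * \<tau>)) * (ennreal (exp (- u * \<tau>)) * indicator {0<..} \<tau>) \<partial>m)"
        by (simp only: mult.assoc)
      also have "\<dots> = L \<tau> * (ennreal (exp (- u * \<tau>)) * indicator {0<..} \<tau>)"
        unfolding L_def by (rule nn_integral_multc[OF sm])
      finally show "(\<integral>\<^sup>+s. ennreal (s * exp (- s * \<tau>)) * ennreal (exp (- u * \<tau>)) * indicator {0<..} \<tau> \<partial>m)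
        = ennreal (exp (- u * \<tau>)) * (L \<tau> * indicator {0<..} \<tau>)"
        by (simp only: mult.left_commute)
    qed
    finally show ?thesis .
  qed
  have "(\<integral>\<^sup>+u. (\<integral>\<^sup>+s. ennreal (s / (s + u)) \<partial>m) \<partial>n)
      = (\<integral>\<^sup>+u. (\<integral>\<^sup>+\<tau>. ennreal (exp (- u * \<tau>)) * (L \<tau> * indicator {0<..} \<tau>) \<partial>lborel) \<partial>n)"
    by (rule nn_integral_cong[OF inner])
  also have "\<dots> = (\<integral>\<^sup>+\<tau>. (\<integral>\<^sup>+u. ennreal (exp (- u * \<tau>)) * (L \<tau> * indicator {0<..} \<tau>) \<partial>n) \<partial>lborel)"
    by (rule nl.Fubini'[symmetric]) (unfold case_prod_beta, measurable)
  also have "\<dots> = (\<integral>\<^sup>+\<tau>. L \<tau> * ennreal (laplace n \<tau>) * indicator {0<..} \<tau> \<partial>lborel)"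
  proof (rule nn_integral_cong)
    fix \<tau> :: real
    have "(\<integral>\<^sup>+u. ennreal (exp (- u * \<tau>)) * (L \<tau> * indicator {0<..} \<tau>) \<partial>n)
      = (\<integral>\<^sup>+u. ennreal (exp (- u * \<tau>)) \<partial>n) * (L \<tau> * indicator {0<..} \<tau>)"
      by (rule nn_integral_multc[OF um])
    also have "\<dots> = L \<tau> * ennreal (laplace n \<tau>) * indicator {0<..} \<tau>"
    proof (cases "\<tau> > 0")
      case True
      then show ?thesis
        unfolding nn_integral_exp_eq_laplace[OF n less_imp_le[OF True]] by (simp add: mult_ac)
    qed simp
    finally show "(\<integral>\<^sup>+u. ennreal (exp (- u * \<tau>)) * (L \<tau> * indicator {0<..} \<tau>) \<partial>n)
      = L \<tau> * ennreal (laplace n \<tau>) * indicator {0<..} \<tau>" .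
  qed
  finally show ?thesis by (simp only: L_def)
qed

text \<open>The fundamental theorem of calculus on the intervals \<open>[1/n, n]\<close>, followed by monotone convergence.\<close>

lemma nn_integral_derivative_le:
  fixes F f :: "real \<Rightarrow> real"
  assumes D: "\<And>x. x > 0 \<Longrightarrow> (F has_real_derivative f x) (at x)" and cont: "continuous_on {0<..} f"
    and nonneg: "\<And>x. x > 0 \<Longrightarrow> 0 \<le> f x" and K: "\<And>a b. 0 < a \<Longrightarrow> a \<le> b \<Longrightarrow> F b - F a \<le> K"
  shows "(\<integral>\<^sup>+x. ennreal (f x) * indicator {0<..} x \<partial>lborel) \<le> ennreal K"
proof -
  define g where "g x = indicator {0<..} x *\<^sub>R f x" for x
  have g [measurable]: "g \<in> borel_measurable borel"
    unfolding g_def using cont by (intro borel_measurable_continuous_on_indicator) auto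
  define u where "u n x = ennreal (g x) * indicator {1 / real (Suc n)..real (Suc n)} x" for n :: nat and x
  have "(\<lambda>n. integral\<^sup>N lborel (u n)) \<longlonglongrightarrow> (\<integral>\<^sup>+x. ennreal (f x) * indicator {0<..} x \<partial>lborel)"
  proof (rule nn_integral_LIMSEQ)
    show "incseq u"
    proof (rule incseq_SucI, rule le_funI)
      fix n x
      have "1 / real (Suc (Suc n)) \<le> 1 / real (Suc n)" by (intro divide_left_mono) auto
      then have "{1 / real (Suc n)..real (Suc n)} \<subseteq> {1 / real (Suc (Suc n))..real (Suc (Suc n))}" by auto
      then show "u n x \<le> u (Suc n) x"
        unfolding u_def by (intro mult_left_mono) (auto split: split_indicator)
    qed
    show "u i \<in> borel_measurable lborel" for i unfolding u_def by measurable
    show "(\<lambda>n. u n x) \<longlonglongrightarrow> ennreal (f x) * indicator {0<..} x" for x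
    proof (cases "x > 0")
      case False
      then show ?thesis by (simp add: u_def g_def)
    next
      case True
      obtain N where N: "real (Suc N) > x" "1 / real (Suc N) < x"
      proof -
        obtain N1 where N1: "1 / real (Suc N1) < x" using nat_approx_posE[OF True] by metis
        obtain N2 where N2: "x < real N2" using reals_Archimedean2 by blast
        have "1 / real (Suc (max N1 N2)) \<le> 1 / real (Suc N1)" by (intro divide_left_mono) auto
        then show thesis using N1 N2 by (intro that[of "max N1 N2"]) auto
      qed
      have "u n x = ennreal (f x)" if "n \<ge> N" for n
      proof -
        have "1 / real (Suc n) \<le> 1 / real (Suc N)" using that by (intro divide_left_mono) auto
        then have "x \<in> {1 / real (Suc n)..real (Suc n)}" using N that by auto
        then show ?thesis using True by (simp add: u_def g_def)
      qed
      then have "\<forall>\<^sub>F n in sequentially. u n x = ennreal (f x)" by (rule eventually_sequentiallyI)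
      then show ?thesis using True by (simp add: tendsto_eventually)
    qed
  qed
  moreover have "integral\<^sup>N lborel (u n) \<le> ennreal K" for n
  proof -
    have pos: "0 < 1 / real (Suc n)" by simp
    have le: "1 / real (Suc n) \<le> real (Suc n)" by (rule order_trans[of _ 1]) auto
    have "integral\<^sup>N lborel (u n) = ennreal (F (real (Suc n)) - F (1 / real (Suc n)))"
      unfolding u_def
    proof (rule nn_integral_FTC_Icc[OF g _ _ le])
      fix x assume "x \<in> {1 / real (Suc n)..real (Suc n)}"
      then have "x > 0" using less_le_trans[OF pos] by auto
      then show "(F has_real_derivative g x) (at x)" "0 \<le> g x" using D nonneg by (auto simp: g_def)
    qed
    also have "\<dots> \<le> ennreal K" by (rule ennreal_leI[OF K[OF pos le]])
    finally show ?thesis .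
  qed
  ultimately show ?thesis using LIMSEQ_le_const2 by blast
qed

context
  fixes \<psi> assumes \<psi>: "bernstein_fun \<psi>"
begin

lemma bf_deriv_nonneg: "\<tau> > 0 \<Longrightarrow> 0 \<le> deriv \<psi> \<tau>"
  using cm_nonneg[OF bf_cm[OF \<psi>]] .

lemma bf_deriv_continuous: "continuous_on {0<..} (deriv \<psi>)"
  using cm_derivative(1)[OF bf_cm[OF \<psi>]]
  by (auto intro!: continuous_at_imp_continuous_on DERIV_isCont)

lemma bf_continuous: "continuous_on {0<..} \<psi>"
  using bf_DERIV[OF \<psi>] by (auto intro!: continuous_at_imp_continuous_on DERIV_isCont)

text \<open>The integrand is the derivative of \<open>- exp (- k \<psi>)/k\<close>, whose values lie in \<open>[- 1/k, 0]\<close>.\<close>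

lemma nn_integral_deriv_exp_le:
  assumes k: "k > 0"
  shows "(\<integral>\<^sup>+\<tau>. ennreal (deriv \<psi> \<tau> * exp (- k * \<psi> \<tau>)) * indicator {0<..} \<tau> \<partial>lborel) \<le> ennreal (1 / k)"
proof (rule nn_integral_derivative_le[where F = "\<lambda>\<tau>. - exp (- k * \<psi> \<tau>) / k"])
  fix x :: real assume x: "x > 0"
  show "((\<lambda>\<tau>. - exp (- k * \<psi> \<tau>) / k) has_real_derivative deriv \<psi> x * exp (- k * \<psi> x)) (at x)"
    using k by (auto intro!: derivative_eq_intros bf_DERIV[OF \<psi> x])
  show "0 \<le> deriv \<psi> x * exp (- k * \<psi> x)" using bf_deriv_nonneg[OF x] by simp
next
  show "continuous_on {0<..} (\<lambda>\<tau>. deriv \<psi> \<tau> * exp (- k * \<psi> \<tau>))"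
    by (intro continuous_intros bf_deriv_continuous bf_continuous)
next
  fix a b :: real assume ab: "0 < a" "a \<le> b"
  have "exp (- k * \<psi> a) \<le> 1" using k bf_nonneg[OF \<psi> ab(1)] by simp
  moreover have "0 \<le> exp (- k * \<psi> b)" by simp
  ultimately have "exp (- k * \<psi> a) - exp (- k * \<psi> b) \<le> 1" by linarith
  then have "(exp (- k * \<psi> a) - exp (- k * \<psi> b)) / k \<le> 1 / k" using k by (intro divide_right_mono) auto
  then show "- exp (- k * \<psi> b) / k - - exp (- k * \<psi> a) / k \<le> 1 / k" by (simp add: diff_divide_distrib)
qed

lemma bf_linear_growth:
  assumes s: "s > 0" shows "\<psi> s \<le> \<psi> 1 + deriv \<psi> 1 * s"
proof (cases "s \<le> 1")
  case True
  then show ?thesis using bf_mono[OF \<psi> s, of 1] bf_deriv_nonneg[of 1] s by (simp add: add_increasing2)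
next
  case False
  have "\<exists>z>1. z < s \<and> \<psi> s - \<psi> 1 = (s - 1) * deriv \<psi> z"
    using False by (intro MVT2 bf_DERIV[OF \<psi>]) auto
  then obtain z where z: "1 < z" "z < s" "\<psi> s - \<psi> 1 = (s - 1) * deriv \<psi> z" by blast
  have "(s - 1) * deriv \<psi> z \<le> s * deriv \<psi> 1"
    using cm_antimono[OF bf_cm[OF \<psi>], of 1 z] z False bf_deriv_nonneg[of z] by (intro mult_mono) auto
  then show ?thesis using z(3) by (simp add: mult.commute)
qed

lemma C_const_nonneg: "0 \<le> C_const c \<psi>"
  unfolding C_const_def set_lebesgue_integral_def
  using bf_deriv_nonneg by (auto intro!: integral_nonneg_AE split: split_indicator)

text \<open>What has to be shown is that the integral is finite. By concavity \<open>\<psi>\<close> grows at most linearly, so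
\<open>exp (- s/c)\<close> is dominated by a multiple of \<open>exp (- k \<psi> s)\<close> for a small \<open>k\<close>.\<close>

lemma nn_integral_eq_C_const:
  assumes c: "c > 0"
  shows "(\<integral>\<^sup>+\<tau>. ennreal (deriv \<psi> \<tau> * exp (- \<tau> / c)) * indicator {0<..} \<tau> \<partial>lborel) = ennreal (C_const c \<psi>)"
proof -
  define g where "g s = indicator {0<..} s *\<^sub>R (exp (- s / c) * deriv \<psi> s)" for s
  have gm: "g \<in> borel_measurable lborel"
  proof -
    have "continuous_on {0<..} (\<lambda>s. exp (- s / c) * deriv \<psi> s)"
      using c by (intro continuous_intros bf_deriv_continuous) auto
    then have "g \<in> borel_measurable borel"
      unfolding g_def by (intro borel_measurable_continuous_on_indicator) auto
    then show ?thesis by simp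
  qed
  have g0: "g s \<ge> 0" for s using bf_deriv_nonneg by (auto simp: g_def split: split_indicator)
  have eq: "(\<integral>\<^sup>+\<tau>. ennreal (deriv \<psi> \<tau> * exp (- \<tau> / c)) * indicator {0<..} \<tau> \<partial>lborel) = (\<integral>\<^sup>+s. ennreal (g s) \<partial>lborel)"
    by (rule nn_integral_cong) (auto simp: g_def mult.commute split: split_indicator)
  \<comment> \<open>with this \<open>k\<close> the slope \<open>k * deriv \<psi> 1\<close> of the linear bound on \<open>k * \<psi>\<close> is at most \<open>1 / c\<close>\<close>
  define k where "k = 1 / (c * (deriv \<psi> 1 + 1))"
  have d1: "deriv \<psi> 1 \<ge> 0" by (rule bf_deriv_nonneg) simp
  have "c * (deriv \<psi> 1 + 1) > 0" using c d1 by simp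
  then have k: "k > 0" by (simp add: k_def)
  have "deriv \<psi> 1 / (deriv \<psi> 1 + 1) / c \<le> 1 / c" using c d1 by (intro divide_right_mono) auto
  then have k': "k * deriv \<psi> 1 \<le> 1 / c" by (simp add: k_def mult.commute)
  have "(\<integral>\<^sup>+s. ennreal (g s) \<partial>lborel)
    \<le> (\<integral>\<^sup>+s. ennreal (exp (k * \<psi> 1)) * (ennreal (deriv \<psi> s * exp (- k * \<psi> s)) * indicator {0<..} s) \<partial>lborel)"
  proof (rule nn_integral_mono)
    fix s :: real
    show "ennreal (g s) \<le> ennreal (exp (k * \<psi> 1)) * (ennreal (deriv \<psi> s * exp (- k * \<psi> s)) * indicator {0<..} s)"
    proof (cases "s > 0")
      case True
      have "k * \<psi> s \<le> k * (\<psi> 1 + deriv \<psi> 1 * s)"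
        using bf_linear_growth[OF True] k by (intro mult_left_mono) auto
      also have "\<dots> \<le> k * \<psi> 1 + s / c"
        using mult_right_mono[OF k', of s] True by (simp add: algebra_simps)
      finally have "exp (- s / c) \<le> exp (k * \<psi> 1 + - k * \<psi> s)" by simp
      also have "\<dots> = exp (k * \<psi> 1) * exp (- k * \<psi> s)" by (rule exp_add)
      finally have "exp (- s / c) * deriv \<psi> s \<le> exp (k * \<psi> 1) * exp (- k * \<psi> s) * deriv \<psi> s"
        using bf_deriv_nonneg[OF True] by (rule mult_right_mono)
      then have "g s \<le> exp (k * \<psi> 1) * (deriv \<psi> s * exp (- k * \<psi> s))"
        using True by (simp add: g_def mult_ac)
      then have "ennreal (g s) \<le> ennreal (exp (k * \<psi> 1) * (deriv \<psi> s * exp (- k * \<psi> s)))" by (rule ennreal_leI)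
      then show ?thesis using True bf_deriv_nonneg[OF True] by (simp add: ennreal_mult)
    qed (simp add: g_def)
  qed
  also have "\<dots> = ennreal (exp (k * \<psi> 1)) *
      (\<integral>\<^sup>+s. ennreal (deriv \<psi> s * exp (- k * \<psi> s)) * indicator {0<..} s \<partial>lborel)"
  proof (rule nn_integral_cmult)
    have "continuous_on {0<..} (\<lambda>s. deriv \<psi> s * exp (- k * \<psi> s))"
      by (intro continuous_intros bf_deriv_continuous bf_continuous)
    then have "(\<lambda>s. indicator {0<..} s *\<^sub>R (deriv \<psi> s * exp (- k * \<psi> s))) \<in> borel_measurable borel"
      by (intro borel_measurable_continuous_on_indicator) auto
    then have "(\<lambda>s. ennreal (indicator {0<..} s *\<^sub>R (deriv \<psi> s * exp (- k * \<psi> s)))) \<in> borel_measurable lborel"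
      by simp
    also have "(\<lambda>s. ennreal (indicator {0<..} s *\<^sub>R (deriv \<psi> s * exp (- k * \<psi> s))))
        = (\<lambda>s. ennreal (deriv \<psi> s * exp (- k * \<psi> s)) * indicator {0<..} s)"
      by (auto split: split_indicator)
    finally show "(\<lambda>s. ennreal (deriv \<psi> s * exp (- k * \<psi> s)) * indicator {0<..} s) \<in> borel_measurable lborel" .
  qed
  also have "\<dots> \<le> ennreal (exp (k * \<psi> 1)) * ennreal (1 / k)"
    by (rule mult_left_mono[OF nn_integral_deriv_exp_le[OF k]]) simp
  also have "\<dots> < \<infinity>" by (simp add: ennreal_mult_less_top)
  finally have "(\<integral>\<^sup>+s. ennreal (g s) \<partial>lborel) < \<infinity>" .
  then have "integrable lborel g" using gm g0 by (intro integrableI_nonneg) auto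
  then have "(\<integral>\<^sup>+s. ennreal (g s) \<partial>lborel) = ennreal (\<integral>s. g s \<partial>lborel)"
    by (rule nn_integral_eq_integral) (simp add: g0)
  then show ?thesis using c eq by (simp add: C_const_def set_lebesgue_integral_def g_def)
qed

text \<open>The right-hand side is minus the derivative of the transform \<open>exp (- h \<psi>)\<close>. Convexity gives
\<open>s exp (- s \<tau>) \<le> (exp (- s (\<tau> - \<epsilon>)) - exp (- s \<tau>))/\<epsilon>\<close>, and \<open>\<epsilon> \<rightarrow> 0\<close>.\<close>

lemma nn_integral_times_exp_le:
  assumes m: "halfline m" "\<And>\<tau>. \<tau> > 0 \<Longrightarrow> laplace m \<tau> = exp (- h * \<psi> \<tau>)" and h: "h \<ge> 0" and \<tau>: "\<tau> > 0"
  shows "(\<integral>\<^sup>+s. ennreal (s * exp (- s * \<tau>)) \<partial>m) \<le> ennreal (h * (deriv \<psi> \<tau> * exp (- h * \<psi> \<tau>)))"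
proof -
  define f where "f \<tau> = exp (- h * \<psi> \<tau>)" for \<tau>
  define D where "D = h * (deriv \<psi> \<tau> * exp (- h * \<psi> \<tau>))"
  have Df: "(f has_real_derivative - D) (at \<tau>)"
    unfolding f_def D_def by (auto intro!: derivative_eq_intros bf_DERIV[OF \<psi> \<tau>])
  have "((\<lambda>k. (f (\<tau> + k) - f \<tau>) / k) \<longlongrightarrow> - D) (at 0)" using Df by (simp add: DERIV_def)
  moreover have "filterlim (\<lambda>\<epsilon>. - \<epsilon>) (at (0::real)) (at_right 0)"
    unfolding filterlim_at by (auto simp: eventually_at_right_less intro!: tendsto_eq_intros eventually_mono[OF eventually_at_right_less[of 0]])
  ultimately have "((\<lambda>\<epsilon>. (f (\<tau> + - \<epsilon>) - f \<tau>) / - \<epsilon>) \<longlongrightarrow> - D) (at_right 0)"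
    by (rule filterlim_compose)
  from tendsto_minus[OF this] have "((\<lambda>\<epsilon>. (f (\<tau> - \<epsilon>) - f \<tau>) / \<epsilon>) \<longlongrightarrow> D) (at_right 0)" by simp
  then have lim: "((\<lambda>\<epsilon>. ennreal ((f (\<tau> - \<epsilon>) - f \<tau>) / \<epsilon>)) \<longlongrightarrow> ennreal D) (at_right 0)"
    by (rule tendsto_ennrealI)
  have le: "(\<integral>\<^sup>+s. ennreal (s * exp (- s * \<tau>)) \<partial>m) \<le> ennreal ((f (\<tau> - \<epsilon>) - f \<tau>) / \<epsilon>)"
    if \<epsilon>: "\<epsilon> \<in> {0<..<\<tau>}" for \<epsilon>
  proof -
    have i: "integrable m (\<lambda>s. (exp (- s * (\<tau> - \<epsilon>)) - exp (- s * \<tau>)) / \<epsilon>)"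
      using \<epsilon> integrable_exp[OF m(1), of "\<tau> - \<epsilon>"] integrable_exp[OF m(1), of \<tau>]
      by (intro integrable_divide Bochner_Integration.integrable_diff) auto
    have pt: "s * exp (- s * \<tau>) \<le> (exp (- s * (\<tau> - \<epsilon>)) - exp (- s * \<tau>)) / \<epsilon>" for s
    proof -
      have "exp (- s * (\<tau> - \<epsilon>)) = exp (s * \<epsilon>) * exp (- s * \<tau>)"
        unfolding exp_add[symmetric] by (simp add: algebra_simps)
      moreover have "(1 + s * \<epsilon>) * exp (- s * \<tau>) \<le> exp (s * \<epsilon>) * exp (- s * \<tau>)"
        by (rule mult_right_mono) (use exp_ge_add_one_self[of "s * \<epsilon>"] in auto)
      ultimately have "s * exp (- s * \<tau>) * \<epsilon> \<le> exp (- s * (\<tau> - \<epsilon>)) - exp (- s * \<tau>)"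
        by (simp add: algebra_simps)
      then show ?thesis using \<epsilon> by (simp add: pos_le_divide_eq)
    qed
    have "(\<integral>\<^sup>+s. ennreal (s * exp (- s * \<tau>)) \<partial>m)
      \<le> (\<integral>\<^sup>+s. ennreal ((exp (- s * (\<tau> - \<epsilon>)) - exp (- s * \<tau>)) / \<epsilon>) \<partial>m)"
      by (intro nn_integral_mono ennreal_leI pt)
    also have "\<dots> = ennreal (\<integral>s. (exp (- s * (\<tau> - \<epsilon>)) - exp (- s * \<tau>)) / \<epsilon> \<partial>m)"
    proof (rule nn_integral_eq_integral[OF i], rule halfline_AE[OF m(1)])
      fix s :: real assume "s \<ge> 0"
      then have "s * exp (- s * \<tau>) \<ge> 0" by simp
      then show "0 \<le> (exp (- s * (\<tau> - \<epsilon>)) - exp (- s * \<tau>)) / \<epsilon>" using pt[of s] by linarith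
    qed
    also have "(\<integral>s. (exp (- s * (\<tau> - \<epsilon>)) - exp (- s * \<tau>)) / \<epsilon> \<partial>m) = (laplace m (\<tau> - \<epsilon>) - laplace m \<tau>) / \<epsilon>"
      unfolding laplace_def integral_divide_zero using \<epsilon> \<tau>
      by (subst Bochner_Integration.integral_diff[OF integrable_exp[OF m(1)] integrable_exp[OF m(1)]]) auto
    also have "\<dots> = (f (\<tau> - \<epsilon>) - f \<tau>) / \<epsilon>" using \<epsilon> \<tau> m(2) by (simp add: f_def)
    finally show ?thesis .
  qed
  show ?thesis
    unfolding D_def[symmetric]
  proof (rule tendsto_lowerbound[OF lim])
    show "\<forall>\<^sub>F \<epsilon> in at_right 0. (\<integral>\<^sup>+s. ennreal (s * exp (- s * \<tau>)) \<partial>m) \<le> ennreal ((f (\<tau> - \<epsilon>) - f \<tau>) / \<epsilon>)"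
      using eventually_at_right_real[OF \<tau>] by eventually_elim (rule le)
  qed simp
qed

lemma nn_integral_ratio_le:
  assumes m: "halfline m" "\<And>\<tau>. \<tau> > 0 \<Longrightarrow> laplace m \<tau> = exp (- h * \<psi> \<tau>)" and h: "h \<ge> 0"
    and n: "halfline n" "\<And>\<tau>. \<tau> > 0 \<Longrightarrow> laplace n \<tau> = g \<tau>"
    and C: "(\<integral>\<^sup>+\<tau>. ennreal (deriv \<psi> \<tau> * g \<tau>) * indicator {0<..} \<tau> \<partial>lborel) \<le> ennreal C"
      and g: "continuous_on {0<..} g"
  shows "(\<integral>\<^sup>+u. (\<integral>\<^sup>+s. ennreal (s / (s + u)) \<partial>m) \<partial>n) \<le> ennreal (h * C)"
proof -
  have g0: "g \<tau> \<ge> 0" if "\<tau> > 0" for \<tau> using laplace_nonneg[of n \<tau>] n(2)[OF that] by simp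
  have "(\<integral>\<^sup>+u. (\<integral>\<^sup>+s. ennreal (s / (s + u)) \<partial>m) \<partial>n)
    \<le> (\<integral>\<^sup>+\<tau>. ennreal h * (ennreal (deriv \<psi> \<tau> * g \<tau>) * indicator {0<..} \<tau>) \<partial>lborel)"
    unfolding nn_integral_ratio[OF m(1) n(1)]
  proof (rule nn_integral_mono)
    fix \<tau> :: real
    show "(\<integral>\<^sup>+s. ennreal (s * exp (- s * \<tau>)) \<partial>m) * ennreal (laplace n \<tau>) * indicator {0<..} \<tau>
      \<le> ennreal h * (ennreal (deriv \<psi> \<tau> * g \<tau>) * indicator {0<..} \<tau>)"
    proof (cases "\<tau> > 0")
      case True
      have "(\<integral>\<^sup>+s. ennreal (s * exp (- s * \<tau>)) \<partial>m) \<le> ennreal (h * (deriv \<psi> \<tau> * exp (- h * \<psi> \<tau>)))"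
        by (rule nn_integral_times_exp_le[OF m h True])
      also have "\<dots> \<le> ennreal (h * deriv \<psi> \<tau>)"
        using h bf_deriv_nonneg[OF True] bf_nonneg[OF \<psi> True]
        by (intro ennreal_leI mult_left_mono) (auto intro: mult_left_le)
      finally have "(\<integral>\<^sup>+s. ennreal (s * exp (- s * \<tau>)) \<partial>m) * ennreal (g \<tau>) \<le> ennreal (h * deriv \<psi> \<tau>) * ennreal (g \<tau>)"
        by (rule mult_right_mono) simp
      then show ?thesis
        using True h g0[OF True] bf_deriv_nonneg[OF True] by (simp add: n(2) ennreal_mult mult.assoc)
    qed simp
  qed
  also have "\<dots> = ennreal h * (\<integral>\<^sup>+\<tau>. ennreal (deriv \<psi> \<tau> * g \<tau>) * indicator {0<..} \<tau> \<partial>lborel)"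
  proof (rule nn_integral_cmult)
    have "continuous_on {0<..} (\<lambda>s. deriv \<psi> s * g s)"
      by (intro continuous_intros bf_deriv_continuous g)
    then have "(\<lambda>s. indicator {0<..} s *\<^sub>R (deriv \<psi> s * g s)) \<in> borel_measurable borel"
      by (intro borel_measurable_continuous_on_indicator) auto
    then have "(\<lambda>s. ennreal (indicator {0<..} s *\<^sub>R (deriv \<psi> s * g s))) \<in> borel_measurable lborel"
      by simp
    also have "(\<lambda>s. ennreal (indicator {0<..} s *\<^sub>R (deriv \<psi> s * g s)))
        = (\<lambda>s. ennreal (deriv \<psi> s * g s) * indicator {0<..} s)"
      by (auto split: split_indicator)
    finally show "(\<lambda>s. ennreal (deriv \<psi> s * g s) * indicator {0<..} s) \<in> borel_measurable lborel" .
  qed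
  also have "\<dots> \<le> ennreal h * ennreal C" using C by (intro mult_left_mono) auto
  also have "\<dots> = ennreal (h * C)" using h by (simp add: ennreal_mult')
  finally show ?thesis .
qed

end

section \<open>The Yosida condition for the subordinate semigroup\<close>

text \<open>Uniformly bounded operators that converge on a sequence with limit \<open>x\<close> converge at \<open>x\<close>.\<close>

lemma dense_bounded_quotients_converge:
  fixes D :: "real \<Rightarrow> 'a::real_normed_vector \<Rightarrow> 'b::banach"
  assumes U: "\<And>h. h > 0 \<Longrightarrow> bounded_linear (D h)" "\<And>h x. h > 0 \<Longrightarrow> norm (D h x) \<le> K * norm x"
    and z: "z \<longlonglongrightarrow> x" "\<And>n. ((\<lambda>h. D h (z n)) \<longlongrightarrow> y n) (at_right 0)"
  obtains w where "((\<lambda>h. D h x) \<longlongrightarrow> w) (at_right 0)"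
proof -
  have diff: "norm (D h a - D h b) \<le> K * norm (a - b)" if "h > 0" for h a b
    using U(2)[OF that, of "a - b"] linear_diff[OF bounded_linear.linear[OF U(1)[OF that]], of a b] by simp
  have y: "norm (y n - y m) \<le> K * norm (z n - z m)" for n m
  proof (rule tendsto_upperbound)
    show "((\<lambda>h. norm (D h (z n) - D h (z m))) \<longlongrightarrow> norm (y n - y m)) (at_right 0)"
      by (intro tendsto_intros z(2))
    show "\<forall>\<^sub>F h in at_right 0. norm (D h (z n) - D h (z m)) \<le> K * norm (z n - z m)"
      using eventually_at_right_less[of 0] by eventually_elim (rule diff)
  qed simp
  have K1: "norm (y n - y m) \<le> (\<bar>K\<bar> + 1) * norm (z n - z m)" for n m
    by (rule order_trans[OF y mult_right_mono]) auto
  have "Cauchy y"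
  proof (rule metric_CauchyI)
    fix e :: real assume e: "e > 0"
    have "Cauchy z" using z(1) by (rule LIMSEQ_imp_Cauchy)
    then obtain N where N: "\<And>m n. m \<ge> N \<Longrightarrow> n \<ge> N \<Longrightarrow> dist (z m) (z n) < e / (\<bar>K\<bar> + 1)"
      using e by (meson CauchyD metric_CauchyD divide_pos_pos add_nonneg_pos abs_ge_zero zero_less_one)
    have "dist (y m) (y n) < e" if "m \<ge> N" "n \<ge> N" for m n
    proof -
      have "dist (y m) (y n) \<le> (\<bar>K\<bar> + 1) * dist (z m) (z n)" using K1 by (simp add: dist_norm)
      also have "\<dots> < (\<bar>K\<bar> + 1) * (e / (\<bar>K\<bar> + 1))"
        using N[OF that] by (intro mult_strict_left_mono) auto
      finally show ?thesis by simp
    qed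
    then show "\<exists>N. \<forall>m\<ge>N. \<forall>n\<ge>N. dist (y m) (y n) < e" by blast
  qed
  then obtain w where w: "y \<longlonglongrightarrow> w" using Cauchy_convergent convergent_def by blast
  have "((\<lambda>h. D h x) \<longlongrightarrow> w) (at_right 0)"
  proof (rule tendstoI)
    fix e :: real assume e: "e > 0"
    have "(\<lambda>n. (\<bar>K\<bar> + 1) * norm (x - z n) + norm (y n - w)) \<longlonglongrightarrow> (\<bar>K\<bar> + 1) * norm (x - x) + norm (w - w)"
      by (intro tendsto_intros z(1) w)
    then have "\<forall>\<^sub>F n in sequentially. (\<bar>K\<bar> + 1) * norm (x - z n) + norm (y n - w) < e / 2"
      using e by (intro order_tendstoD) auto
    then obtain n where n: "(\<bar>K\<bar> + 1) * norm (x - z n) + norm (y n - w) < e / 2"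
      by (auto dest: eventually_happens)
    have "\<forall>\<^sub>F h in at_right 0. dist (D h (z n)) (y n) < e / 2"
      using z(2)[of n] by (rule tendstoD) (use e in simp)
    then show "\<forall>\<^sub>F h in at_right 0. dist (D h x) w < e"
      using eventually_at_right_less[of 0]
    proof eventually_elim
      case (elim h)
      have "norm (D h x - D h (z n)) \<le> (\<bar>K\<bar> + 1) * norm (x - z n)"
        by (rule order_trans[OF diff[OF elim(2)] mult_right_mono]) auto
      moreover have "norm (D h x - w) \<le> norm (D h x - D h (z n)) + (norm (D h (z n) - y n) + norm (y n - w))"
        using norm_triangle_ineq[of "D h x - D h (z n)" "D h (z n) - w"]
          norm_triangle_ineq[of "D h (z n) - y n" "y n - w"] by simp
      ultimately show ?case using n elim(1) by (simp add: dist_norm)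
    qed
  qed
  then show thesis by (rule that)
qed

context bounded_semigroup
begin

lemma generator_T:
  assumes "(x, y) \<in> generator T" "t \<ge> 0" shows "(T t x, T t y) \<in> generator T"
  using generator_measure_op[OF assms(1) halfline_point_mass[OF assms(2)]]
  by (simp add: measure_op_point_mass assms(2))

text \<open>One has \<open>T s z - z = s \<theta>(A) w\<close> with a subprobability measure \<open>\<theta>\<close>. Integrating the bound on \<open>T r w\<close>, rather than
estimating \<open>\<theta>(A)\<close> by \<open>M\<close>, keeps the constant free of a factor \<open>M\<close>.\<close>

lemma increment_le:
  assumes gen: "(z, w) \<in> generator T" and K: "\<And>r. r \<ge> 0 \<Longrightarrow> norm (T r w) \<le> K" and s: "s \<ge> 0"
  shows "norm (T s z - z) \<le> s * K"
proof -
  obtain \<theta> where \<theta>: "halfline \<theta>" "\<And>\<tau>. \<tau> > 0 \<Longrightarrow> laplace \<theta> \<tau> = chi (s * \<tau>)" "measure \<theta> {0..} \<le> 1"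
    using ex_average[OF bernstein_fun_ident s] by blast
  have K0: "K \<ge> 0" using K[of 0] norm_ge_zero order_trans by blast
  define v where "v = z - w"
  have z: "z = resolvent_op 1 v" using gen generator_iff_resolvent[of 1 z w] by (simp add: v_def)
  have "measure_op (point_mass s) (resolvent_op 1 v) - resolvent_op 1 v
      = - (s *\<^sub>R measure_op \<theta> (1 *\<^sub>R measure_op (point_mass 0) v - 1 *\<^sub>R resolvent_op 1 v))"
  proof (rule difference_quotient_identity[where \<psi> = "\<lambda>\<tau>. \<tau>"])
    show "laplace (exp_measure 1) \<tau> * \<tau> = 1 * laplace (point_mass 0) \<tau> - 1 * laplace (exp_measure 1) \<tau>"
      if "\<tau> > 0" for \<tau>
      using that by (simp add: laplace_exp_measure laplace_point_mass field_simps)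
  qed (use s \<theta> in \<open>auto simp: halfline_exp_measure halfline_point_mass laplace_point_mass\<close>)
  then have "T s z - z = - (s *\<^sub>R measure_op \<theta> (v - z))"
    using s by (simp add: measure_op_point_mass T_0 z[symmetric])
  then have eq: "T s z - z = s *\<^sub>R measure_op \<theta> w" by (simp add: v_def blinfun.minus_right)
  have "norm (measure_op \<theta> w) \<le> K"
  proof (rule functional_norm_leI)
    fix \<phi> :: "'a \<Rightarrow>\<^sub>L real" assume \<phi>: "\<And>y. \<bar>\<phi> y\<bar> \<le> norm y"
    interpret finite_measure \<theta> using \<theta>(1) by (rule halfline_finite)
    have "(\<integral>r. \<phi> (T r w) \<partial>\<theta>) \<le> (\<integral>r. K \<partial>\<theta>)"
    proof (rule integral_mono_AE[OF orbit_integrable[OF \<theta>(1)]])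
      show "AE r in \<theta>. \<phi> (T r w) \<le> K"
        by (rule halfline_AE[OF \<theta>(1)]) (use \<phi> K in \<open>meson abs_le_D1 order_trans\<close>)
    qed simp
    also have "\<dots> = K * measure \<theta> {0..}" by (simp add: halfline_space[OF \<theta>(1)])
    also have "\<dots> \<le> K * 1" using \<theta>(3) K0 by (rule mult_left_mono)
    finally show "\<phi> (measure_op \<theta> w) \<le> K" by (simp add: measure_op_functional[OF \<theta>(1)])
  qed
  then show ?thesis unfolding eq using s by (simp add: mult_left_mono)
qed

end

context subordination
begin

text \<open>These vectors converge to \<open>x\<close> as \<open>k \<rightarrow> 0\<close>, so the domain of the generator is dense. Here \<open>\<kappa> = \<theta> k\<close> and
\<open>\<kappa> \<psi> = (1 - exp (- k \<psi>))/k\<close>.\<close>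

lemma average_in_domain:
  assumes k: "k > 0"
  shows "(measure_op (\<theta> k) x, - ((1 / k) *\<^sub>R (x - S k x))) \<in> generator S"
proof -
  have eq: "(S h (measure_op (\<theta> k) x) - measure_op (\<theta> k) x) /\<^sub>R h
      = - measure_op (\<theta> h) ((1 / k) *\<^sub>R (x - S k x))" if h: "h > 0" for h
  proof -
    have "measure_op (\<mu> h) (measure_op (\<theta> k) x) - measure_op (\<theta> k) x
      = - (h *\<^sub>R measure_op (\<theta> h) ((1 / k) *\<^sub>R measure_op (point_mass 0) x - (1 / k) *\<^sub>R measure_op (\<mu> k) x))"
    proof (rule difference_quotient_identity[where \<psi> = \<psi>])
      fix \<tau> :: real assume \<tau>: "\<tau> > 0"
      have "laplace (\<theta> k) \<tau> * \<psi> \<tau> = chi (k * \<psi> \<tau>) * (k * \<psi> \<tau>) / k" using k \<tau> by (simp add: \<theta>)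
      also have "\<dots> = (1 - exp (- (k * \<psi> \<tau>))) / k" by (simp only: chi_mult)
      finally show "laplace (\<theta> k) \<tau> * \<psi> \<tau> = 1 / k * laplace (point_mass 0) \<tau> - 1 / k * laplace (\<mu> k) \<tau>"
        using k \<tau> by (simp add: \<mu> laplace_point_mass diff_divide_distrib)
    qed (use h k \<mu> \<theta> in \<open>auto simp: halfline_point_mass\<close>)
    then have "S h (measure_op (\<theta> k) x) - measure_op (\<theta> k) x = - (h *\<^sub>R measure_op (\<theta> h) ((1 / k) *\<^sub>R (x - S k x)))"
      by (simp add: S_def measure_op_point_mass T_0 scaleR_right_diff_distrib)
    then show ?thesis using h by simp
  qed
  have "((\<lambda>h. (S h (measure_op (\<theta> k) x) - measure_op (\<theta> k) x) /\<^sub>R h) \<longlongrightarrow> - ((1 / k) *\<^sub>R (x - S k x))) (at_right 0)"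
  proof (rule Lim_transform_eventually[OF tendsto_minus[OF \<theta>_tendsto]])
    show "\<forall>\<^sub>F h in at_right 0. - measure_op (\<theta> h) ((1 / k) *\<^sub>R (x - S k x))
        = (S h (measure_op (\<theta> k) x) - measure_op (\<theta> k) x) /\<^sub>R h"
      using eventually_at_right_less[of 0] by eventually_elim (use eq in auto)
  qed
  then show ?thesis by (simp add: generator_def)
qed

text \<open>The quotients \<open>(S h - 1) S t/h\<close> are bounded uniformly in \<open>h\<close> and converge on the dense set of averages.\<close>

lemma S_range_in_domain:
  assumes t: "t \<ge> 0" and K: "\<And>h x. h > 0 \<Longrightarrow> norm (S h (S t x) - S t x) \<le> h * K * norm x"
  obtains y where "(S t x, y) \<in> generator S" "norm y \<le> K * norm x"
proof -
  define D where "D h x = (S h (S t x) - S t x) /\<^sub>R h" for h x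
  have Dle: "norm (D h x) \<le> K * norm x" if "h > 0" for h x
  proof -
    have "norm (D h x) = norm (S h (S t x) - S t x) / h"
      using that by (simp add: D_def divide_inverse mult.commute)
    also have "\<dots> \<le> h * K * norm x / h" using K[OF that] that by (intro divide_right_mono) auto
    finally show ?thesis using that by simp
  qed
  define z where "z n = measure_op (\<theta> (1 / real (Suc n))) x" for n
  have "filterlim (\<lambda>n. 1 / real (Suc n)) (at_right 0) sequentially"
    unfolding filterlim_at using LIMSEQ_inverse_real_of_nat by (auto simp: inverse_eq_divide)
  from filterlim_compose[OF \<theta>_tendsto this] have z: "z \<longlonglongrightarrow> x" by (simp add: z_def[abs_def])
  have gz: "(z n, - (real (Suc n) *\<^sub>R (x - S (1 / real (Suc n)) x))) \<in> generator S" for n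
    using average_in_domain[of "1 / real (Suc n)" x] by (simp add: z_def)
  obtain y where y: "((\<lambda>h. D h x) \<longlongrightarrow> y) (at_right 0)"
  proof (rule dense_bounded_quotients_converge[where D = D and K = K and z = z and x = x])
    show "bounded_linear (D h)" for h
      unfolding D_def by (intro bounded_linear_intros)
    show "norm (D h x) \<le> K * norm x" if "h > 0" for h x by (rule Dle[OF that])
    show "((\<lambda>h. D h (z n)) \<longlongrightarrow> S t (- (real (Suc n) *\<^sub>R (x - S (1 / real (Suc n)) x)))) (at_right 0)" for n
      using S.generator_T[OF gz t, of n] by (simp add: generator_def D_def)
  qed (use z in auto)
  show thesis
  proof (rule that)
    show "(S t x, y) \<in> generator S" using y by (simp add: generator_def D_def)
    show "norm y \<le> K * norm x"
    proof (rule tendsto_upperbound[OF tendsto_norm[OF y]])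
      show "\<forall>\<^sub>F h in at_right 0. norm (D h x) \<le> K * norm x"
        using eventually_at_right_less[of 0] by eventually_elim (rule Dle)
    qed simp
  qed
qed

text \<open>This is \<open>c0 s/(1 + c0 s)\<close>, in the form that matches \<open>s/(s + u)\<close> at \<open>u = 1/c0\<close>. The case \<open>c0 = 0\<close> is separate
because \<open>1/0 = 0\<close> would give the value \<open>1\<close> instead of \<open>0\<close>.\<close>

definition saturation :: "real \<Rightarrow> real \<Rightarrow> real"
  where "saturation c0 s = (if c0 = 0 then 0 else s / (s + 1 / c0))"

definition yosida_bound :: "real \<Rightarrow> real \<Rightarrow> real \<Rightarrow> real"
  where "yosida_bound c0 c1 t = M * (at_zero \<psi> + 4 * C_const c0 \<psi>) * exp (- t * at_zero \<psi>) + 2 * max (2 * M) c1 / t"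

context
  fixes A c0 c1
  assumes gen: "generator T = op_neg A" and yos: "yosida T A c0 c1"
begin

lemma yosida_generator:
  assumes u: "u > 0"
  obtains w where "(T u x, w) \<in> generator T" "norm w \<le> (c0 + c1 / u) * norm x"
proof -
  have iff: "(x, y) \<in> A \<longleftrightarrow> (x, - y) \<in> generator T" for x y
    unfolding gen by (auto simp: op_neg_def)
  have "range (T u) \<subseteq> Domain A" using yos u unfolding yosida_def by blast
  then have dom: "T u x \<in> Domain A" by blast
  have bl: "bounded_linear (\<lambda>x. op_apply A (T u x))"
    and on: "onorm (\<lambda>x. op_apply A (T u x)) \<le> c0 + c1 / u"
    using yos u by (auto simp: yosida_def op_comp_norm_le_def)
  obtain y where y: "(T u x, y) \<in> A" using dom by blast
  have "op_apply A (T u x) = y"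
    unfolding op_apply_def using y generator_unique unfolding iff by (metis (no_types, lifting) neg_equal_iff_equal the_equality)
  then have "norm y \<le> (c0 + c1 / u) * norm x"
    using onorm[OF bl, of x] mult_right_mono[OF on, of "norm x"] by simp
  then show thesis using y by (intro that[of "- y"]) (auto simp: iff)
qed

lemma yosida_increment_le:
  assumes s: "s \<ge> 0" and u: "u > 0"
  shows "norm (T u x - T (s + u) x) \<le> s * ((c0 + c1 / u) * norm x)"
proof -
  have c1: "c1 > 0" using yos by (simp add: yosida_def)
  obtain w where w: "(T u x, w) \<in> generator T" "norm w \<le> (c0 + c1 / u) * norm x"
    using yosida_generator[OF u] by blast
  have "norm (T s (T u x) - T u x) \<le> s * ((c0 + c1 / u) * norm x)"
  proof (rule increment_le[OF w(1) _ s])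
    fix r :: real assume r: "r \<ge> 0"
    obtain w' where w': "(T (r + u) x, w') \<in> generator T" "norm w' \<le> (c0 + c1 / (r + u)) * norm x"
      using yosida_generator[of "r + u"] u r by (metis add_nonneg_pos)
    have "(T (r + u) x, T r w) \<in> generator T"
      using generator_T[OF w(1) r] u r by (simp add: T_add)
    then have "T r w = w'" using w'(1) generator_unique by blast
    moreover have "c1 / (r + u) \<le> c1 / u" using r u c1 by (intro divide_left_mono) auto
    then have "(c0 + c1 / (r + u)) * norm x \<le> (c0 + c1 / u) * norm x"
      by (intro mult_right_mono) auto
    ultimately show "norm (T r w) \<le> (c0 + c1 / u) * norm x" using w'(2) by simp
  qed
  then show ?thesis using s u by (simp add: T_add norm_minus_commute)
qed

lemma saturation_zero: "c0 = 0 \<Longrightarrow> saturation c0 s = 0"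
  unfolding saturation_def by simp

text \<open>Beside the trivial bound \<open>2 M\<close> there is the bound \<open>s c0 + s c1/u\<close>. Each of the functions
\<open>s/(s + 1/c0)\<close> and \<open>s/(s + u)\<close> is at least \<open>1/2\<close> where its linear bound, \<open>c0 s\<close> and \<open>s/u\<close> respectively, is at least \<open>1\<close>,
and at least half of that linear bound elsewhere; this is the source of the factors \<open>4\<close> and \<open>2\<close>.\<close>

lemma increment_saturation_le:
  assumes s: "s \<ge> 0" and u: "u \<ge> 0"
  shows "norm (T u x - T (s + u) x)
    \<le> (4 * M * saturation c0 s + 2 * max (2 * M) c1 * (s / (s + u))) * norm x"
proof (cases "x = 0 \<or> s = 0")
  case True
  then show ?thesis by (auto simp: saturation_def)
next
  case False
  then have x: "x \<noteq> 0" and s0: "s > 0" using s by auto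
  have M1: "M \<ge> 1" using M_ge_1[OF x] .
  have c0: "c0 \<ge> 0" and c1: "c1 > 0" using yos by (auto simp: yosida_def)
  define m where "m = max (2 * M) c1"
  have m: "2 * M \<le> m" "c1 \<le> m" "m > 0" using c1 by (auto simp: m_def)
  have trivial: "norm (T u x - T (s + u) x) \<le> 2 * M * norm x"
    using norm_triangle_ineq4[of "T u x" "T (s + u) x"] norm_T_apply_le[of u x] norm_T_apply_le[of "s + u" x] s u
    by simp
  have sat0: "saturation c0 s \<ge> 0" using c0 s by (simp add: saturation_def)
  have q0: "s / (s + u) \<ge> 0" using s u by simp
  consider "u \<le> s" | "s < u" "s * c0 \<ge> 1" | "s < u" "s * c0 < 1" by linarith
  then have "\<exists>K. norm (T u x - T (s + u) x) \<le> K * norm x \<and> K \<le> 4 * M * saturation c0 s + 2 * m * (s / (s + u))"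
  proof cases
    case 1
    have "s / (s + u) \<ge> 1 / 2" using 1 s0 u by (simp add: field_simps)
    then have "2 * m * (1 / 2) \<le> 2 * m * (s / (s + u))" using m by (intro mult_left_mono) auto
    moreover have "0 \<le> 4 * M * saturation c0 s" using M1 sat0 by simp
    ultimately show ?thesis using trivial m by (intro exI[of _ "2 * M"]) auto
  next
    case 2
    then have c0': "c0 > 0" using c0 s0 by (cases "c0 = 0") auto
    have "1 / c0 \<le> s" using 2 c0' by (simp add: field_simps)
    then have "saturation c0 s \<ge> 1 / 2" using c0' s0 by (simp add: saturation_def field_simps add_pos_pos)
    then have "4 * M * (1 / 2) \<le> 4 * M * saturation c0 s" using M1 by (intro mult_left_mono) auto
    moreover have "0 \<le> 2 * m * (s / (s + u))" using m q0 by (intro mult_nonneg_nonneg) auto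
    ultimately show ?thesis using trivial by (intro exI[of _ "2 * M"]) auto
  next
    case 3
    have u0: "u > 0" using 3 s0 by simp
    have "norm (T u x - T (s + u) x) \<le> (s * c0 + s * (c1 / u)) * norm x"
      using yosida_increment_le[OF s u0, of x] by (simp add: algebra_simps)
    moreover have "s * c0 \<le> 4 * M * saturation c0 s"
    proof (cases "c0 = 0")
      case False
      then have c0': "c0 > 0" using c0 by simp
      have "s / (2 / c0) \<le> s / (s + 1 / c0)"
        using 3 c0' s0 by (intro divide_left_mono) (auto simp: field_simps add_pos_pos)
      then have "2 * (s / (2 / c0)) \<le> 2 * (s / (s + 1 / c0))" by (rule mult_left_mono) simp
      moreover have "2 * (s / (2 / c0)) = s * c0" using c0' by simp
      moreover have "saturation c0 s = s / (s + 1 / c0)" using False by (simp add: saturation_def)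
      ultimately have "s * c0 \<le> 2 * saturation c0 s" by simp
      also have "\<dots> \<le> 4 * M * saturation c0 s" using M1 sat0 by (intro mult_right_mono) auto
      finally show ?thesis .
    next
      case True
      then show ?thesis unfolding saturation_zero[OF True] by simp
    qed
    moreover have "s * (c1 / u) \<le> 2 * m * (s / (s + u))"
    proof -
      have "s / (2 * u) \<le> s / (s + u)" using 3 s0 u0 by (intro divide_left_mono) auto
      then have "2 * m * (s / (2 * u)) \<le> 2 * m * (s / (s + u))" using m by (intro mult_left_mono) auto
      moreover have "s * (c1 / u) \<le> s * (m / u)" using m u0 s by (intro mult_left_mono divide_right_mono) auto
      ultimately show ?thesis by (simp add: mult.commute)
    qed
    ultimately show ?thesis by (intro exI[of _ "s * c0 + s * (c1 / u)"]) auto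
  qed
  then obtain K where "norm (T u x - T (s + u) x) \<le> K * norm x" "K \<le> 4 * M * saturation c0 s + 2 * m * (s / (s + u))"
    by blast
  then show ?thesis unfolding m_def by (meson mult_right_mono norm_ge_zero order_trans)
qed

lemma saturation_nonneg: "s \<ge> 0 \<Longrightarrow> saturation c0 s \<ge> 0"
  using yos by (simp add: saturation_def yosida_def)

lemma saturation_measurable: "halfline m \<Longrightarrow> (\<lambda>s. ennreal (saturation c0 s)) \<in> borel_measurable m"
proof (rule measurable_compose[OF halfline_measurable measurable_ennreal])
  have "c0 \<ge> 0" using yos by (simp add: yosida_def)
  then show "continuous_on {0..} (saturation c0)"
    unfolding saturation_def[abs_def] by (cases "c0 = 0") (auto intro!: continuous_intros simp: add_nonneg_eq_0_iff)
qed

lemma nn_integral_saturation_le: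
  assumes h: "h \<ge> 0"
  shows "(\<integral>\<^sup>+s. ennreal (saturation c0 s) \<partial>\<mu> h) \<le> ennreal (h * C_const c0 \<psi>)"
proof (cases "c0 = 0")
  case True
  show ?thesis unfolding saturation_zero[OF True] by simp
next
  case False
  then have c0: "c0 > 0" using yos by (simp add: yosida_def)
  have "(\<integral>\<^sup>+u. (\<integral>\<^sup>+s. ennreal (s / (s + u)) \<partial>\<mu> h) \<partial>point_mass (1 / c0)) \<le> ennreal (h * C_const c0 \<psi>)"
  proof (rule nn_integral_ratio_le[OF \<psi> \<mu>(1)[OF h] \<mu>(2)[OF h] h])
    show "halfline (point_mass (1 / c0))" using c0 by (simp add: halfline_point_mass)
    show "laplace (point_mass (1 / c0)) \<tau> = exp (- \<tau> / c0)" for \<tau>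
      using c0 by (simp add: laplace_point_mass)
    show "(\<integral>\<^sup>+\<tau>. ennreal (deriv \<psi> \<tau> * exp (- \<tau> / c0)) * indicator {0<..} \<tau> \<partial>lborel) \<le> ennreal (C_const c0 \<psi>)"
      using nn_integral_eq_C_const[OF \<psi> c0] by simp
    show "continuous_on {0<..} (\<lambda>\<tau>. exp (- \<tau> / c0))" using c0 by (intro continuous_intros) auto
  qed
  moreover have "(\<integral>\<^sup>+u. (\<integral>\<^sup>+s. ennreal (s / (s + u)) \<partial>\<mu> h) \<partial>point_mass (1 / c0)) = (\<integral>\<^sup>+s. ennreal (saturation c0 s) \<partial>\<mu> h)"
  proof -
    interpret finite_measure "\<mu> h" by (rule halfline_finite[OF \<mu>(1)[OF h]])
    have "(\<lambda>p. ennreal (snd p / (snd p + fst p))) \<in> borel_measurable (point_mass (1 / c0) \<Otimes>\<^sub>M \<mu> h)"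
      using halfline_borel_fst_snd(1)[OF halfline_point_mass, of "1 / c0" "\<mu> h"]
        halfline_borel_fst_snd(2)[OF \<mu>(1)[OF h], of "point_mass (1 / c0)"] c0
      by (intro measurable_compose[OF _ measurable_ennreal] borel_measurable_divide borel_measurable_add) auto
    from borel_measurable_nn_integral_fst[OF this]
    have "(\<lambda>u. \<integral>\<^sup>+s. ennreal (s / (s + u)) \<partial>\<mu> h) \<in> borel_measurable (restrict_space borel {0..})"
      by (simp add: point_mass_def cong: measurable_cong_sets)
    then show ?thesis
      using c0 unfolding point_mass_def by (subst nn_integral_return) (auto simp: space_restrict_space saturation_def)
  qed
  ultimately show ?thesis by simp
qed

lemma nn_integral_ratio_inverse_time:
  assumes h: "h \<ge> 0" and t: "t > 0"
  shows "(\<integral>\<^sup>+u. (\<integral>\<^sup>+s. ennreal (s / (s + u)) \<partial>\<mu> h) \<partial>\<mu> t) \<le> ennreal (h * (1 / t))"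
proof (rule nn_integral_ratio_le[OF \<psi> \<mu>(1)[OF h] \<mu>(2)[OF h] h])
  show "halfline (\<mu> t)" "\<And>\<tau>. \<tau> > 0 \<Longrightarrow> laplace (\<mu> t) \<tau> = exp (- t * \<psi> \<tau>)" using t by (auto simp: \<mu>)
  show "(\<integral>\<^sup>+\<tau>. ennreal (deriv \<psi> \<tau> * exp (- t * \<psi> \<tau>)) * indicator {0<..} \<tau> \<partial>lborel) \<le> ennreal (1 / t)"
    by (rule nn_integral_deriv_exp_le[OF \<psi> t])
  show "continuous_on {0<..} (\<lambda>\<tau>. exp (- t * \<psi> \<tau>))" by (intro continuous_intros bf_continuous[OF \<psi>])
qed

text \<open>Up to the defect \<open>1 - exp (- h at_zero \<psi>)\<close> of the mass of \<open>\<mu> h\<close>, the vector \<open>S t x - S h (S t x)\<close> is the double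
integral of \<open>T u x - T (s + u) x\<close> against \<open>\<mu> h (ds)\<close> and \<open>\<mu> t (du)\<close>. The defect contributes the term with
\<open>at_zero \<psi>\<close>, the double integral the other two.\<close>

lemma S_increment_le:
  assumes h: "h > 0" and t: "t > 0"
  shows "norm (S h (S t x) - S t x) \<le> h * yosida_bound c0 c1 t * norm x"
  unfolding norm_minus_commute[of "S h (S t x)"]
proof (rule functional_norm_leI)
  fix \<phi> :: "'a \<Rightarrow>\<^sub>L real" assume \<phi>: "\<And>y. \<bar>\<phi> y\<bar> \<le> norm y"
  define a where "a = at_zero \<psi>"
  define m where "m = 2 * max (2 * M) c1"
  have m0: "m \<ge> 0" using M_nonneg by (simp add: m_def)
  have a0: "a \<ge> 0" by (simp add: a_def at_zero_nonneg[OF \<psi>])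
  have hl: "halfline (\<mu> h)" "halfline (\<mu> t)" using h t by (auto simp: \<mu>)
  interpret h: finite_measure "\<mu> h" by (rule halfline_finite[OF hl(1)])
  interpret t: finite_measure "\<mu> t" by (rule halfline_finite[OF hl(2)])
  have massh: "measure (\<mu> h) (space (\<mu> h)) = exp (- h * a)" and masst: "measure (\<mu> t) (space (\<mu> t)) = exp (- t * a)"
    using h t by (simp_all add: halfline_space[OF hl(1)] halfline_space[OF hl(2)] \<mu> a_def)
  define f where "f u = (\<integral>s. \<phi> (T u x) - \<phi> (T s (T u x)) \<partial>\<mu> h)" for u
  have f_eq: "f u = exp (- h * a) * \<phi> (T u x) - (\<phi> o\<^sub>L S h) (T u x)" for u
    unfolding f_def using orbit_integrable[OF hl(1), of \<phi> "T u x"]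
    by (simp add: massh S_def measure_op_functional[OF hl(1)])
  have f_int: "integrable (\<mu> t) f"
    unfolding f_eq[abs_def] by (intro Bochner_Integration.integrable_diff integrable_mult_right orbit_integrable hl)
  have f_total: "(\<integral>u. f u \<partial>\<mu> t) = exp (- h * a) * \<phi> (S t x) - \<phi> (S h (S t x))"
  proof -
    have i: "integrable (\<mu> t) (\<lambda>u. exp (- h * a) * \<phi> (T u x))" "integrable (\<mu> t) (\<lambda>u. (\<phi> o\<^sub>L S h) (T u x))"
      by (intro integrable_mult_right orbit_integrable[OF hl(2)], rule orbit_integrable[OF hl(2)])
    have "(\<integral>u. f u \<partial>\<mu> t) = exp (- h * a) * \<phi> (S t x) - (\<phi> o\<^sub>L S h) (S t x)"
      unfolding f_eq Bochner_Integration.integral_diff[OF i] integral_mult_right_zero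
        S_def[of t] measure_op_functional[OF hl(2)] ..
    then show ?thesis by simp
  qed
  define W where "W = (\<integral>\<^sup>+u. (\<integral>\<^sup>+s. ennreal (s / (s + u)) \<partial>\<mu> h) \<partial>\<mu> t)"
  define V where "V = (\<integral>\<^sup>+s. ennreal (saturation c0 s) \<partial>\<mu> h)"
  have "(\<integral>\<^sup>+u. ennreal \<bar>f u\<bar> \<partial>\<mu> t)
    \<le> (\<integral>\<^sup>+u. ennreal (4 * M * norm x) * V + ennreal (m * norm x) * (\<integral>\<^sup>+s. ennreal (s / (s + u)) \<partial>\<mu> h) \<partial>\<mu> t)"
  proof (rule nn_integral_mono)
    fix u assume "u \<in> space (\<mu> t)"
    then have u: "u \<ge> 0" by (simp add: halfline_space[OF hl(2)])
    have "ennreal \<bar>f u\<bar> \<le> (\<integral>\<^sup>+s. ennreal (norm (\<phi> (T u x) - \<phi> (T s (T u x)))) \<partial>\<mu> h)"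
      unfolding f_def real_norm_def[symmetric]
      by (intro integral_norm_bound_ennreal Bochner_Integration.integrable_diff orbit_integrable hl) simp
    also have "\<dots> \<le> (\<integral>\<^sup>+s. ennreal (4 * M * norm x) * ennreal (saturation c0 s) + ennreal (m * norm x) * ennreal (s / (s + u)) \<partial>\<mu> h)"
    proof (rule nn_integral_mono)
      fix s assume "s \<in> space (\<mu> h)"
      then have s: "s \<ge> 0" by (simp add: halfline_space[OF hl(1)])
      have "norm (\<phi> (T u x) - \<phi> (T s (T u x))) \<le> norm (T u x - T (s + u) x)"
        using \<phi>[of "T u x - T (s + u) x"] s u by (simp add: blinfun.diff_right T_add)
      also have "\<dots> \<le> (4 * M * saturation c0 s + m * (s / (s + u))) * norm x"
        using increment_saturation_le[OF s u, of x] by (simp add: m_def)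
      also have "\<dots> = 4 * M * norm x * saturation c0 s + m * norm x * (s / (s + u))" by (simp add: algebra_simps)
      finally show "ennreal (norm (\<phi> (T u x) - \<phi> (T s (T u x))))
          \<le> ennreal (4 * M * norm x) * ennreal (saturation c0 s) + ennreal (m * norm x) * ennreal (s / (s + u))"
        using M_nonneg m0 s u saturation_nonneg[OF s]
        by (simp add: ennreal_mult[symmetric] ennreal_plus[symmetric] ennreal_leI del: ennreal_plus)
    qed
    also have "\<dots> = ennreal (4 * M * norm x) * V + ennreal (m * norm x) * (\<integral>\<^sup>+s. ennreal (s / (s + u)) \<partial>\<mu> h)"
    proof -
      have sm: "(\<lambda>s. ennreal (s / (s + u))) \<in> borel_measurable (\<mu> h)"
        using halfline_measurable[OF hl(1), of "\<lambda>s. s"]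
        by (intro measurable_compose[OF _ measurable_ennreal] borel_measurable_divide borel_measurable_add) auto
      show ?thesis unfolding V_def
        using sm saturation_measurable[OF hl(1)] by (subst nn_integral_add) (auto simp: nn_integral_cmult)
    qed
    finally show "ennreal \<bar>f u\<bar> \<le> ennreal (4 * M * norm x) * V + ennreal (m * norm x) * (\<integral>\<^sup>+s. ennreal (s / (s + u)) \<partial>\<mu> h)" .
  qed
  also have "\<dots> = ennreal (4 * M * norm x) * V * ennreal (exp (- t * a)) + ennreal (m * norm x) * W"
  proof -
    have "(\<lambda>p. ennreal (snd p / (snd p + fst p))) \<in> borel_measurable (\<mu> t \<Otimes>\<^sub>M \<mu> h)"
      using halfline_borel_fst_snd(1)[OF hl(2), of "\<mu> h"] halfline_borel_fst_snd(2)[OF hl(1), of "\<mu> t"]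
      by (intro measurable_compose[OF _ measurable_ennreal] borel_measurable_divide borel_measurable_add) auto
    from h.borel_measurable_nn_integral_fst[OF this]
    have "(\<lambda>u. \<integral>\<^sup>+s. ennreal (s / (s + u)) \<partial>\<mu> h) \<in> borel_measurable (\<mu> t)" by simp
    then show ?thesis
      unfolding W_def by (subst nn_integral_add) (auto simp: nn_integral_cmult t.emeasure_eq_measure masst)
  qed
  also have "\<dots> \<le> ennreal (4 * M * norm x) * ennreal (h * C_const c0 \<psi>) * ennreal (exp (- t * a))
      + ennreal (m * norm x) * ennreal (h * (1 / t))"
    unfolding V_def W_def using h t nn_integral_saturation_le[of h] nn_integral_ratio_inverse_time[of h t]
    by (intro add_mono mult_mono) auto
  also have "\<dots> = ennreal (4 * M * norm x * (h * C_const c0 \<psi>) * exp (- t * a) + m * norm x * (h * (1 / t)))"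
  proof -
    have "ennreal p * ennreal q * ennreal r + ennreal v * ennreal w = ennreal (p * q * r + v * w)"
      if "0 \<le> p" "0 \<le> q" "0 \<le> r" "0 \<le> v" "0 \<le> w" for p q r v w
      using that by (simp add: ennreal_mult ennreal_plus)
    then show ?thesis using M_nonneg m0 h t C_const_nonneg[OF \<psi>, of c0] by (simp del: ennreal_plus)
  qed
  finally have "ennreal \<bar>\<integral>u. f u \<partial>\<mu> t\<bar> \<le> ennreal (4 * M * norm x * (h * C_const c0 \<psi>) * exp (- t * a) + m * norm x * (h * (1 / t)))"
    using order_trans[OF integral_norm_bound_ennreal[OF f_int]] by simp
  moreover have "0 \<le> 4 * M * norm x * (h * C_const c0 \<psi>) * exp (- t * a) + m * norm x * (h * (1 / t))"
    using M_nonneg m0 h t C_const_nonneg[OF \<psi>, of c0] by simp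
  ultimately have f_le: "(\<integral>u. f u \<partial>\<mu> t) \<le> 4 * M * norm x * (h * C_const c0 \<psi>) * exp (- t * a) + m * norm x * (h * (1 / t))"
    by (simp add: ennreal_le_iff)
  have "(1 - exp (- h * a)) * \<phi> (S t x) \<le> (1 - exp (- h * a)) * (M * exp (- t * a) * norm x)"
    using \<phi>[of "S t x"] norm_S_le[of t x] t h a0 by (intro mult_left_mono) (auto simp: a_def)
  also have "\<dots> \<le> h * a * (M * exp (- t * a) * norm x)"
    using exp_ge_add_one_self[of "- h * a"] M_nonneg by (intro mult_right_mono) auto
  finally have "\<phi> (S t x - S h (S t x)) \<le> h * a * (M * exp (- t * a) * norm x)
      + (4 * M * norm x * (h * C_const c0 \<psi>) * exp (- t * a) + m * norm x * (h * (1 / t)))"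
    using f_le unfolding f_total by (simp add: blinfun.diff_right left_diff_distrib)
  also have "\<dots> = h * yosida_bound c0 c1 t * norm x"
    unfolding yosida_bound_def a_def[symmetric] m_def[symmetric] by (simp add: algebra_simps)
  finally show "\<phi> (S t x - S h (S t x)) \<le> h * yosida_bound c0 c1 t * norm x" .
qed

end

end

section \<open>Vector-valued holomorphic functions\<close>

lemma bounded_linear_scaleC_left: "bounded_linear (\<lambda>c. c *\<^sub>C (x::'a::complex_banach))"
proof (rule bounded_linear_intro[where K = "norm x"])
  show "(r *\<^sub>R c) *\<^sub>C x = r *\<^sub>R (c *\<^sub>C x)" for r and c :: complex
    by (simp add: scaleR_conv_of_real scaleC_scaleC[symmetric] scaleC_of_real)
qed (simp_all add: scaleC_add_left norm_scaleC)

lemma scaleC_one: "1 *\<^sub>C (x::'a::complex_banach) = x"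
  using scaleC_of_real[of 1 x] by simp

lemma scaleC_diff_right: "c *\<^sub>C (x - y) = c *\<^sub>C x - c *\<^sub>C (y::'a::complex_banach)"
  using bounded_linear.linear[OF bounded_linear_scaleC, THEN linear_diff] by blast

lemma scaleC_diff_left: "(a - b) *\<^sub>C x = a *\<^sub>C x - b *\<^sub>C (x::'a::complex_banach)"
  using bounded_linear.linear[OF bounded_linear_scaleC_left, THEN linear_diff] by blast

lemma vec_holomorphic_on_subset: "vec_holomorphic_on F U \<Longrightarrow> V \<subseteq> U \<Longrightarrow> vec_holomorphic_on F V"
  unfolding vec_holomorphic_on_def by (meson subsetD tendsto_within_subset)

lemma summable_power_series_majorant:
  fixes a :: "nat \<Rightarrow> 'b::complex_banach"
  assumes a: "\<And>n. norm (a n) \<le> C * q ^ n" and z: "cmod z * q < 1" and q: "q \<ge> 0"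
  shows "summable (\<lambda>n. norm (z ^ n *\<^sub>C a n))" "norm (\<Sum>n. z ^ n *\<^sub>C a n) \<le> C / (1 - cmod z * q)"
proof -
  have le: "norm (z ^ n *\<^sub>C a n) \<le> C * (cmod z * q) ^ n" for n
  proof -
    have "norm (z ^ n *\<^sub>C a n) \<le> cmod z ^ n * (C * q ^ n)"
      unfolding norm_scaleC norm_power by (rule mult_left_mono[OF a]) simp
    then show ?thesis by (simp add: power_mult_distrib mult_ac)
  qed
  have geo: "(\<lambda>n. C * (cmod z * q) ^ n) sums (C * (1 / (1 - cmod z * q)))"
    using z q by (intro sums_mult geometric_sums) simp
  show s: "summable (\<lambda>n. norm (z ^ n *\<^sub>C a n))"
    by (rule summable_comparison_test'[OF sums_summable[OF geo], of 0]) (use le in simp)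
  have "norm (\<Sum>n. z ^ n *\<^sub>C a n) \<le> (\<Sum>n. norm (z ^ n *\<^sub>C a n))" by (rule summable_norm[OF s])
  also have "\<dots> \<le> (\<Sum>n. C * (cmod z * q) ^ n)" by (rule suminf_le[OF le s sums_summable[OF geo]])
  finally show "norm (\<Sum>n. z ^ n *\<^sub>C a n) \<le> C / (1 - cmod z * q)" using geo by (simp add: sums_iff)
qed

text \<open>The difference quotient at \<open>z\<close> is \<open>\<Sum> p\<^sub>n(w) a\<^sub>n\<close> with \<open>p\<^sub>n(w) = (w\<^sup>n - z\<^sup>n)/(w - z)\<close>, written for \<open>c = 0\<close>. Being a locally
uniform limit of polynomials in \<open>w\<close>, this sum is continuous at \<open>w = z\<close>.\<close>

lemma vec_holomorphic_power_series:
  fixes a :: "nat \<Rightarrow> 'b::complex_banach"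
  assumes a: "\<And>n. norm (a n) \<le> C * q ^ n" and q: "q > 0"
  shows "vec_holomorphic_on (\<lambda>z. \<Sum>n. (z - c) ^ n *\<^sub>C a n) (ball c (1 / q))"
  unfolding vec_holomorphic_on_def
proof
  fix z assume z: "z \<in> ball c (1 / q)"
  define F where "F z = (\<Sum>n. (z - c) ^ n *\<^sub>C a n)" for z
  have C: "C \<ge> 0" using order_trans[OF norm_ge_zero a[of 0]] by simp
  have "cmod (z - c) < 1 / q" using z by (simp add: dist_norm norm_minus_commute)
  then obtain r where r: "cmod (z - c) < r" "r < 1 / q" using dense by blast
  have r0: "r > 0" using r(1) norm_ge_zero le_less_trans by blast
  have rq: "r * q < 1" using r(2) q by (simp add: pos_less_divide_eq)
  define p where "p n w = (\<Sum>i<n. (z - c) ^ (n - Suc i) * (w - c) ^ i)" for n w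
  define g where "g w = (\<Sum>n. p n w *\<^sub>C a n)" for w
  have p: "cmod (p n w) \<le> real n * r ^ (n - 1)" if w: "w \<in> cball c r" for n w
  proof -
    have "cmod (p n w) \<le> (\<Sum>i<n. r ^ (n - 1))"
      unfolding p_def
    proof (rule sum_norm_le)
      fix i assume i: "i \<in> {..<n}"
      have "cmod ((z - c) ^ (n - Suc i) * (w - c) ^ i) \<le> r ^ (n - Suc i) * r ^ i"
        unfolding norm_mult norm_power using r(1) w r0
        by (intro mult_mono power_mono) (auto simp: dist_norm norm_minus_commute)
      also have "\<dots> = r ^ (n - 1)" using i by (simp add: power_add[symmetric])
      finally show "cmod ((z - c) ^ (n - Suc i) * (w - c) ^ i) \<le> r ^ (n - 1)" .
    qed
    then show ?thesis by simp
  qed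
  define B where "B n = real n * r ^ (n - 1) * (C * q ^ n)" for n
  have "summable (\<lambda>n. C * q * (real (Suc n) * (r * q) ^ n))"
    using geometric_deriv_sums[of "r * q"] rq r0 q by (intro summable_mult) (auto simp: sums_iff)
  moreover have "(\<lambda>n. B (Suc n)) = (\<lambda>n. C * q * (real (Suc n) * (r * q) ^ n))"
    by (simp add: B_def power_mult_distrib mult_ac)
  ultimately have "summable (\<lambda>n. B (Suc n))" by simp
  then have B: "summable B" by (simp only: summable_Suc_iff)
  have pa: "norm (p n w *\<^sub>C a n) \<le> B n" if "w \<in> cball c r" for n w
    unfolding norm_scaleC B_def using p[OF that] a r0 by (intro mult_mono) auto
  have unif: "uniform_limit (cball c r) (\<lambda>n w. \<Sum>i<n. p i w *\<^sub>C a i) g sequentially"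
    unfolding g_def by (rule Weierstrass_m_test[OF pa B])
  have cont: "continuous_on (cball c r) g"
  proof (rule uniform_limit_theorem[OF _ unif])
    have "continuous_on (cball c r) (\<lambda>w. p i w *\<^sub>C a i)" for i
      unfolding p_def
      by (rule bounded_linear.continuous_on[OF bounded_linear_scaleC_left]) (intro continuous_intros)
    then show "\<forall>\<^sub>F n in sequentially. continuous_on (cball c r) (\<lambda>w. \<Sum>i<n. p i w *\<^sub>C a i)"
      by (intro always_eventually allI continuous_on_sum)
  qed simp
  have zr: "z \<in> ball c r" using r(1) by (simp add: dist_norm norm_minus_commute)
  have "g \<midarrow>z\<rightarrow> g z"
  proof -
    have "continuous_on (ball c r) g" by (rule continuous_on_subset[OF cont]) auto
    then have "isCont g z" using zr by (simp add: continuous_on_eq_continuous_at)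
    then show ?thesis by (simp add: isCont_def)
  qed
  moreover have "\<forall>\<^sub>F w in at z. g w = inverse (w - z) *\<^sub>C (F w - F z)"
  proof -
    have "\<forall>\<^sub>F w in at z. w \<in> ball c r" using zr by (intro eventually_at_in_open') auto
    moreover have "\<forall>\<^sub>F w in at z. w \<noteq> z" by (simp add: eventually_at_filter)
    ultimately show ?thesis
    proof eventually_elim
      case (elim w)
      have sums: "summable (\<lambda>n. (v - c) ^ n *\<^sub>C a n)" if "v \<in> cball c r" for v
      proof -
        have "cmod (v - c) * q \<le> r * q"
          using that q by (intro mult_right_mono) (auto simp: dist_norm norm_minus_commute)
        then show ?thesis using rq q
          by (intro summable_norm_cancel[OF summable_power_series_majorant(1)[OF a le_less_trans[OF _ rq]]]) auto
      qed
      have "F w - F z = (\<Sum>n. (w - c) ^ n *\<^sub>C a n - (z - c) ^ n *\<^sub>C a n)"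
        unfolding F_def using elim zr by (intro suminf_diff sums) auto
      also have "\<dots> = (\<Sum>n. (w - z) *\<^sub>C (p n w *\<^sub>C a n))"
      proof (rule suminf_cong)
        fix n
        have "(w - c) ^ n - (z - c) ^ n = (w - z) * p n w"
          using power_diff_sumr2[of "w - c" n "z - c"] by (simp add: p_def)
        then show "(w - c) ^ n *\<^sub>C a n - (z - c) ^ n *\<^sub>C a n = (w - z) *\<^sub>C (p n w *\<^sub>C a n)"
          by (simp add: scaleC_diff_left[symmetric] scaleC_scaleC)
      qed
      also have "\<dots> = (w - z) *\<^sub>C g w"
      proof -
        have "summable (\<lambda>n. p n w *\<^sub>C a n)"
          by (rule summable_comparison_test'[OF B, of 0]) (use pa elim in auto)
        from bounded_linear.suminf[OF bounded_linear_scaleC this] show ?thesis by (simp add: g_def)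
      qed
      finally show ?case using elim by (simp add: scaleC_scaleC scaleC_one)
    qed
  qed
  ultimately have "((\<lambda>w. inverse (w - z) *\<^sub>C (F w - F z)) \<longlongrightarrow> g z) (at z)"
    by (rule Lim_transform_eventually)
  then have "((\<lambda>w. inverse (w - z) *\<^sub>C (F w - F z)) \<longlongrightarrow> g z) (at z within ball c (1 / q))"
    by (rule tendsto_within_subset) simp
  then show "\<exists>D. ((\<lambda>w. inverse (w - z) *\<^sub>C ((\<Sum>n. (w - c) ^ n *\<^sub>C a n) - (\<Sum>n. (z - c) ^ n *\<^sub>C a n))) \<longlongrightarrow> D)
      (at z within ball c (1 / q))"
    unfolding F_def by blast
qed

text \<open>The complex-linear functional with real part \<open>\<phi>\<close>.\<close>

definition complexify :: "('a::complex_banach \<Rightarrow>\<^sub>L real) \<Rightarrow> 'a \<Rightarrow> complex"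
  where "complexify \<phi> y = Complex (\<phi> y) (- \<phi> (\<i> *\<^sub>C y))"

lemma complexify_scaleC: "complexify \<phi> (c *\<^sub>C y) = c * complexify \<phi> y"
proof -
  have s: "\<phi> ((complex_of_real a + \<i> * complex_of_real b) *\<^sub>C y) = a * \<phi> y + b * \<phi> (\<i> *\<^sub>C y)" for a b y
  proof -
    have "(complex_of_real a + \<i> * complex_of_real b) *\<^sub>C y = a *\<^sub>R y + b *\<^sub>R (\<i> *\<^sub>C y)"
      by (simp only: scaleC_add_left scaleC_of_real[symmetric] scaleC_scaleC mult.commute)
    then show ?thesis by (simp add: blinfun.add_right blinfun.scaleR_right)
  qed
  have c: "c = complex_of_real (Re c) + \<i> * complex_of_real (Im c)" by (rule complex_eq)
  have ic: "\<i> * c = complex_of_real (- Im c) + \<i> * complex_of_real (Re c)" by (simp add: complex_eq_iff)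
  have "\<phi> (c *\<^sub>C y) = Re c * \<phi> y + Im c * \<phi> (\<i> *\<^sub>C y)" by (subst c) (rule s)
  moreover have "\<phi> (\<i> *\<^sub>C (c *\<^sub>C y)) = - Im c * \<phi> y + Re c * \<phi> (\<i> *\<^sub>C y)"
    unfolding scaleC_scaleC ic by (rule s)
  ultimately show ?thesis by (simp add: complexify_def complex_eq_iff)
qed

lemma complexify_diff: "complexify \<phi> (x - y) = complexify \<phi> x - complexify \<phi> y"
  by (simp add: complexify_def complex_eq_iff blinfun.diff_right scaleC_diff_right)

lemma norm_complexify_le:
  fixes \<phi> :: "'a::complex_banach \<Rightarrow>\<^sub>L real"
  assumes "\<And>y. \<bar>\<phi> y\<bar> \<le> norm y" shows "cmod (complexify \<phi> y) \<le> 2 * norm y"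
proof -
  have "cmod (complexify \<phi> y) \<le> \<bar>\<phi> y\<bar> + \<bar>\<phi> (\<i> *\<^sub>C y)\<bar>"
    using cmod_le[of "complexify \<phi> y"] by (simp add: complexify_def)
  then show ?thesis using assms[of y] assms[of "\<i> *\<^sub>C y"] by (simp add: norm_scaleC)
qed

lemma complexify_has_field_derivative:
  fixes F :: "complex \<Rightarrow> ('a::complex_banach \<Rightarrow>\<^sub>L 'a)" and \<phi> :: "'a \<Rightarrow>\<^sub>L real"
  assumes lim: "((\<lambda>w. inverse (w - z) *\<^sub>C (F w - F z)) \<longlongrightarrow> D) (at z within U)"
    and \<phi>: "\<And>y. \<bar>\<phi> y\<bar> \<le> norm y"
  shows "((\<lambda>w. complexify \<phi> (F w x)) has_field_derivative complexify \<phi> (D x)) (at z within U)"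
  unfolding has_field_derivative_iff
proof -
  have eq: "(complexify \<phi> (F w x) - complexify \<phi> (F z x)) / (w - z)
      = complexify \<phi> ((inverse (w - z) *\<^sub>C (F w - F z)) x)" for w
    by (simp add: scaleC_blinfun.rep_eq complexify_scaleC blinfun.diff_left complexify_diff divide_inverse mult.commute)
  have "((\<lambda>w. 2 * (norm (inverse (w - z) *\<^sub>C (F w - F z) - D) * norm x)) \<longlongrightarrow> 2 * (norm (D - D) * norm x)) (at z within U)"
    by (intro tendsto_intros lim)
  then have z0: "((\<lambda>w. 2 * (norm (inverse (w - z) *\<^sub>C (F w - F z) - D) * norm x)) \<longlongrightarrow> 0) (at z within U)" by simp
  have "((\<lambda>w. (complexify \<phi> (F w x) - complexify \<phi> (F z x)) / (w - z) - complexify \<phi> (D x)) \<longlongrightarrow> 0) (at z within U)"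
  proof (rule Lim_null_comparison[OF _ z0], rule always_eventually, rule allI)
    fix w
    have "cmod (complexify \<phi> ((inverse (w - z) *\<^sub>C (F w - F z) - D) x))
      \<le> 2 * norm ((inverse (w - z) *\<^sub>C (F w - F z) - D) x)" by (rule norm_complexify_le[OF \<phi>])
    also have "\<dots> \<le> 2 * (norm (inverse (w - z) *\<^sub>C (F w - F z) - D) * norm x)"
      by (intro mult_left_mono norm_blinfun) simp
    finally show "norm ((complexify \<phi> (F w x) - complexify \<phi> (F z x)) / (w - z) - complexify \<phi> (D x))
      \<le> 2 * (norm (inverse (w - z) *\<^sub>C (F w - F z) - D) * norm x)"
      unfolding eq by (simp add: blinfun.diff_left complexify_diff)
  qed
  then show "((\<lambda>w. (complexify \<phi> (F w x) - complexify \<phi> (F z x)) / (w - z)) \<longlongrightarrow> complexify \<phi> (D x)) (at z within U)"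
    by (rule Lim_null[THEN iffD2])
qed

lemma complexify_holomorphic:
  fixes F :: "complex \<Rightarrow> ('a::complex_banach \<Rightarrow>\<^sub>L 'a)" and \<phi> :: "'a \<Rightarrow>\<^sub>L real"
  assumes "vec_holomorphic_on F U" "\<And>y. \<bar>\<phi> y\<bar> \<le> norm y"
  shows "(\<lambda>w. complexify \<phi> (F w x)) holomorphic_on U"
  unfolding holomorphic_on_def field_differentiable_def
  using assms complexify_has_field_derivative unfolding vec_holomorphic_on_def by blast

text \<open>The scalar identity theorem applied to complexified norming functionals.\<close>

lemma vec_holomorphic_identity:
  fixes F G :: "complex \<Rightarrow> ('a::complex_banach \<Rightarrow>\<^sub>L 'a)"
  assumes F: "vec_holomorphic_on F U" and G: "vec_holomorphic_on G U" and U: "open U" "connected U"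
    and I: "a < b" "complex_of_real ` {a<..<b} \<subseteq> U" and eq: "\<And>t. t \<in> {a<..<b} \<Longrightarrow> F (of_real t) = G (of_real t)"
    and z: "z \<in> U"
  shows "F z = G z"
proof (rule blinfun_eqI, rule ccontr)
  fix x assume ne: "F z x \<noteq> G z x"
  obtain \<phi> :: "'a \<Rightarrow>\<^sub>L real" where \<phi>: "\<And>y. \<bar>\<phi> y\<bar> \<le> norm y" "\<phi> (F z x - G z x) = norm (F z x - G z x)"
    using ex_norming_functional[of "F z x - G z x"] by blast
  define f where "f w = complexify \<phi> (F w x) - complexify \<phi> (G w x)" for w
  define m where "m = (a + b) / 2"
  have m: "m \<in> {a<..<b}" using I by (auto simp: m_def)
  have "f z = 0"
  proof (rule analytic_continuation[of f U "complex_of_real ` {a<..<b}" "of_real m"])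
    show "f holomorphic_on U"
      unfolding f_def by (intro holomorphic_on_diff complexify_holomorphic[OF F \<phi>(1)] complexify_holomorphic[OF G \<phi>(1)])
    show "of_real m \<in> U" using m I by blast
    show "complex_of_real m islimpt complex_of_real ` {a<..<b}"
      unfolding islimpt_approachable
    proof (intro allI impI)
      fix e :: real assume e: "e > 0"
      define s where "s = min (m + e / 2) ((m + b) / 2)"
      have s: "m < s" "s < b" "s < m + e" using e m by (auto simp: s_def min_def)
      have "dist (complex_of_real s) (of_real m) < e"
        using s by (simp add: dist_norm flip: of_real_diff)
      then show "\<exists>x'\<in>complex_of_real ` {a<..<b}. x' \<noteq> complex_of_real m \<and> dist x' (complex_of_real m) < e"
        using s m by (intro bexI[of _ "complex_of_real s"]) auto
    qed
    show "f w = 0" if "w \<in> complex_of_real ` {a<..<b}" for w using that eq by (auto simp: f_def)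
  qed (use U I z in auto)
  then have "complexify \<phi> (F z x - G z x) = 0" by (simp add: f_def complexify_diff)
  then have "\<phi> (F z x - G z x) = 0" by (simp add: complexify_def complex_eq_iff)
  then show False using \<phi>(2) ne by simp
qed

text \<open>A sector is a cone, so a ball around \<open>1\<close> can be scaled.\<close>

lemma ex_ball_subset_sector:
  assumes "\<theta> > 0"
  obtains r where "r > 0" "\<And>t. t > 0 \<Longrightarrow> ball (complex_of_real t) (r * t) \<subseteq> sector \<theta>"
proof -
  have "isCont Arg 1" by (intro continuous_at_Arg) (simp add: complex_nonpos_Reals_iff)
  then have "Arg \<midarrow>1\<rightarrow> Arg 1" by (simp add: isCont_def)
  then have "\<forall>\<^sub>F z in at 1. dist (Arg z) (Arg 1) < \<theta>" using assms by (rule tendstoD)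
  then obtain d where d: "d > 0" "\<And>z. z \<noteq> 1 \<Longrightarrow> dist z 1 < d \<Longrightarrow> \<bar>Arg z\<bar> < \<theta>"
    by (auto simp: eventually_at dist_real_def)
  define r where "r = min d 1"
  have "z \<in> sector \<theta>" if t: "t > 0" and z: "z \<in> ball (complex_of_real t) (r * t)" for t z
  proof -
    \<comment> \<open>rescaling to the ball around \<open>1\<close>\<close>
    define w where "w = z / of_real t"
    have zw: "z = of_real t * w" using t by (simp add: w_def)
    have "z - of_real t = of_real t * (w - 1)" by (simp add: zw algebra_simps)
    then have "cmod (z - of_real t) = t * cmod (w - 1)" using t by (simp add: norm_mult)
    then have "t * cmod (w - 1) < r * t" using z by (simp add: dist_norm norm_minus_commute)
    then have w: "cmod (w - 1) < r" using t by (simp add: mult.commute)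
    have "\<bar>Arg w\<bar> < \<theta>"
      using d(2)[of w] w assms by (cases "w = 1") (auto simp: dist_norm r_def)
    moreover have "w \<noteq> 0" using w by (auto simp: r_def)
    ultimately show ?thesis using t by (simp add: sector_def zw Arg_times_of_real)
  qed
  then show thesis using d by (intro that[of r]) (auto simp: r_def)
qed

lemma sector_imp_cone:
  assumes \<rho>: "\<rho> > 0" and z: "z \<in> sector (arctan \<rho>)"
  shows "Re z > 0" "\<bar>Im z\<bar> \<le> \<rho> * Re z"
proof -
  have z0: "z \<noteq> 0" and A: "\<bar>Arg z\<bar> < arctan \<rho>" using z by (auto simp: sector_def)
  have R: "Re z = cmod z * cos (Arg z)" "Im z = cmod z * sin (Arg z)"
    using z0 by (simp_all add: cos_Arg sin_Arg)
  have pi2: "\<bar>Arg z\<bar> < pi / 2" using A arctan_ubound[of \<rho>] by linarith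
  then have c: "cos (Arg z) > 0" by (intro cos_gt_zero_pi) auto
  then show "Re z > 0" using R z0 by simp
  have "tan \<bar>Arg z\<bar> < tan (arctan \<rho>)"
    using A arctan_ubound[of \<rho>] by (intro tan_monotone) auto
  then have "tan \<bar>Arg z\<bar> < \<rho>" by (simp add: tan_arctan)
  moreover have "\<bar>tan (Arg z)\<bar> = tan \<bar>Arg z\<bar>"
    using pi2 tan_pos_pi2_le[of "Arg z"] tan_pos_pi2_le[of "- Arg z"] by (cases "Arg z \<ge> 0") auto
  ultimately have "\<bar>sin (Arg z)\<bar> / cos (Arg z) < \<rho>" using c by (simp add: tan_def)
  then have "\<bar>sin (Arg z)\<bar> \<le> \<rho> * cos (Arg z)" using c by (simp add: pos_divide_less_eq)
  from mult_left_mono[OF this norm_ge_zero[of z]] show "\<bar>Im z\<bar> \<le> \<rho> * Re z"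
    by (simp add: R abs_mult mult_ac)
qed

section \<open>Sectorially bounded holomorphic semigroups\<close>

lemma has_vector_derivativeI_quotient:
  fixes f :: "real \<Rightarrow> 'b::real_normed_vector"
  assumes "((\<lambda>h. (f (t + h) - f t) /\<^sub>R h) \<longlongrightarrow> D) (at 0)"
  shows "(f has_vector_derivative D) (at t)"
  unfolding has_vector_derivative_def has_derivative_at
proof
  show "bounded_linear (\<lambda>x. x *\<^sub>R D)" by (rule bounded_linear_scaleR_left)
  have "((\<lambda>h. norm ((f (t + h) - f t) /\<^sub>R h - D)) \<longlongrightarrow> norm (D - D)) (at 0)"
    by (intro tendsto_intros assms)
  then have "((\<lambda>h. norm ((f (t + h) - f t) /\<^sub>R h - D)) \<longlongrightarrow> 0) (at 0)" by simp
  moreover have "\<forall>\<^sub>F h in at 0. norm ((f (t + h) - f t) /\<^sub>R h - D) = norm (f (t + h) - f t - h *\<^sub>R D) / norm h"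
  proof (subst eventually_at_filter, rule always_eventually, intro allI impI)
    fix h :: real assume h: "h \<noteq> 0"
    have "f (t + h) - f t - h *\<^sub>R D = h *\<^sub>R ((f (t + h) - f t) /\<^sub>R h - D)"
      using h by (simp add: scaleR_right_diff_distrib)
    then have "norm (f (t + h) - f t - h *\<^sub>R D) = norm h * norm ((f (t + h) - f t) /\<^sub>R h - D)"
      by (simp only: norm_scaleR real_norm_def)
    then show "norm ((f (t + h) - f t) /\<^sub>R h - D) = norm (f (t + h) - f t - h *\<^sub>R D) / norm h"
      using h by simp
  qed
  ultimately show "((\<lambda>h. norm (f (t + h) - f t - h *\<^sub>R D) / norm h) \<longlongrightarrow> 0) (at 0)"
    by (rule Lim_transform_eventually)
qed

lemma self_power_le: "real n ^ n \<le> exp 1 ^ n * fact n"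
proof -
  have "real n ^ n / fact n \<le> exp (real n)"
  proof -
    have "(\<Sum>k<Suc n. real n ^ k /\<^sub>R fact k) \<le> exp (real n)"
      unfolding exp_def by (rule sum_le_suminf[OF summable_exp_generic]) auto
    moreover have "real n ^ n /\<^sub>R fact n \<le> (\<Sum>k<Suc n. real n ^ k /\<^sub>R fact k)"
      by (rule member_le_sum) auto
    ultimately show ?thesis by (simp add: divide_inverse mult.commute)
  qed
  then show ?thesis by (simp add: pos_divide_le_eq exp_of_nat_mult[symmetric])
qed

context bounded_semigroup
begin

lemma generator_add: "(x, y) \<in> generator T \<Longrightarrow> (x', y') \<in> generator T \<Longrightarrow> (x + x', y + y') \<in> generator T"
proof -
  assume "(x, y) \<in> generator T" "(x', y') \<in> generator T"
  then have "((\<lambda>h. (T h x - x) /\<^sub>R h + (T h x' - x') /\<^sub>R h) \<longlongrightarrow> y + y') (at_right 0)"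
    unfolding generator_def by (auto intro: tendsto_add)
  moreover have "(T h x - x) /\<^sub>R h + (T h x' - x') /\<^sub>R h = (T h (x + x') - (x + x')) /\<^sub>R h" for h
    by (simp add: blinfun.add_right algebra_simps)
  ultimately show ?thesis by (simp add: generator_def)
qed

lemma generator_scaleC: "(x, y) \<in> generator T \<Longrightarrow> (c *\<^sub>C x, c *\<^sub>C y) \<in> generator T"
proof -
  assume "(x, y) \<in> generator T"
  then have "((\<lambda>h. c *\<^sub>C ((T h x - x) /\<^sub>R h)) \<longlongrightarrow> c *\<^sub>C y) (at_right 0)"
    unfolding generator_def by (auto intro: bounded_linear.tendsto[OF bounded_linear_scaleC])
  then have "((\<lambda>h. (T h (c *\<^sub>C x) - c *\<^sub>C x) /\<^sub>R h) \<longlongrightarrow> c *\<^sub>C y) (at_right 0)"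
  proof (rule Lim_transform_eventually)
    show "\<forall>\<^sub>F h in at_right 0. c *\<^sub>C ((T h x - x) /\<^sub>R h) = (T h (c *\<^sub>C x) - c *\<^sub>C x) /\<^sub>R h"
      using eventually_at_right_less[of 0]
    proof eventually_elim
      case (elim h)
      have "c *\<^sub>C ((T h x - x) /\<^sub>R h) = (c *\<^sub>C (T h x - x)) /\<^sub>R h"
        by (rule linear_scale[OF bounded_linear.linear[OF bounded_linear_scaleC]])
      then show ?case using elim by (simp add: T_clinear scaleC_diff_right)
    qed
  qed
  then show ?thesis by (simp add: generator_def)
qed

lemma generator_scaleR: "(x, y) \<in> generator T \<Longrightarrow> (r *\<^sub>R x, r *\<^sub>R y) \<in> generator T"
  using generator_scaleC[of x y "complex_of_real r"] by (simp add: scaleC_of_real)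

lemma op_comp_norm_leI:
  assumes gen: "generator T = op_neg A" and K: "K \<ge> 0"
    and w: "\<And>x. \<exists>w. (T t x, w) \<in> generator T \<and> norm w \<le> K * norm x"
  shows "range (T t) \<subseteq> Domain A" "op_comp_norm_le A (T t) K"
proof -
  have iff: "(x, y) \<in> A \<longleftrightarrow> (x, - y) \<in> generator T" for x y
    unfolding gen by (auto simp: op_neg_def)
  define f where "f x = op_apply A (T t x)" for x
  have f: "(T t x, - f x) \<in> generator T" "norm (f x) \<le> K * norm x" for x
  proof -
    obtain w where w: "(T t x, w) \<in> generator T" "norm w \<le> K * norm x" using w by blast
    have "op_apply A (T t x) = - w"
      unfolding op_apply_def
    proof (rule the_equality)
      show "(T t x, - w) \<in> A" using w by (simp add: iff)
      fix y assume "(T t x, y) \<in> A"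
      then have "- y = w" using generator_unique w(1) iff by blast
      then show "y = - w" by (metis minus_minus)
    qed
    then show "(T t x, - f x) \<in> generator T" "norm (f x) \<le> K * norm x" using w by (simp_all add: f_def)
  qed
  show "range (T t) \<subseteq> Domain A"
  proof clarify
    fix x show "T t x \<in> Domain A" using f(1)[of x] unfolding iff[symmetric] by blast
  qed
  have "bounded_linear f"
  proof (rule bounded_linear_intro[where K = K])
    fix x y :: 'a and r :: real
    have "(T t (x + y), - f x + - f y) \<in> generator T"
      using generator_add[OF f(1)[of x] f(1)[of y]] by (simp add: blinfun.add_right)
    then have "- f (x + y) = - f x + - f y" using generator_unique f(1) by blast
    then have "- f (x + y) = - (f x + f y)" by simp
    then show "f (x + y) = f x + f y" by (simp only: neg_equal_iff_equal)
    have "(T t (r *\<^sub>R x), r *\<^sub>R (- f x)) \<in> generator T"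
      using generator_scaleR[OF f(1)[of x]] by (simp add: blinfun.scaleR_right)
    then have "- f (r *\<^sub>R x) = r *\<^sub>R (- f x)" using generator_unique f(1) by blast
    then show "f (r *\<^sub>R x) = r *\<^sub>R f x" by simp
  qed (use f(2) in \<open>simp add: mult.commute\<close>)
  moreover have "onorm f \<le> K" using K f(2) by (rule onorm_bound)
  ultimately show "op_comp_norm_le A (T t) K" by (simp add: op_comp_norm_le_def f_def[abs_def])
qed

text \<open>At \<open>t > 0\<close> the holomorphic extension is bounded on a ball of radius proportional to \<open>t\<close>, so Cauchy's
estimate bounds its derivative, the value of the generator, by a multiple of \<open>1/t\<close>.\<close>

theorem sectorial_imp_yosida:
  assumes sec: "sectorially_bounded_holomorphic T" and gen: "generator T = op_neg A"
  obtains c1 where "yosida T A 0 c1"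
proof -
  obtain \<beta> H where \<beta>: "\<beta> > 0" and HT: "\<And>t. t > 0 \<Longrightarrow> H (complex_of_real t) = T t"
    and hol: "vec_holomorphic_on H (sector \<beta>)"
    and bdd: "\<And>\<theta>. 0 < \<theta> \<Longrightarrow> \<theta> < \<beta> \<Longrightarrow> bounded (H ` sector \<theta>)"
    using sec unfolding sectorially_bounded_holomorphic_def by blast
  define \<theta> where "\<theta> = \<beta> / 2"
  have \<theta>: "0 < \<theta>" "\<theta> < \<beta>" using \<beta> by (auto simp: \<theta>_def)
  obtain B0 where B0: "\<And>z. z \<in> sector \<theta> \<Longrightarrow> norm (H z) \<le> B0" using bdd[OF \<theta>] by (auto simp: bounded_iff)
  define B where "B = max B0 1"
  have B: "B > 0" "\<And>z. z \<in> sector \<theta> \<Longrightarrow> norm (H z) \<le> B" using B0 by (auto simp: B_def intro: le_max_iff_disj[THEN iffD2])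
  obtain r where r: "r > 0" "\<And>t. t > 0 \<Longrightarrow> ball (complex_of_real t) (r * t) \<subseteq> sector \<theta>"
    using ex_ball_subset_sector[OF \<theta>(1)] by blast
  have sub: "sector \<theta> \<subseteq> sector \<beta>" using \<theta> by (auto simp: sector_def)
  define c1 where "c1 = 4 * B / r"
  have key: "\<exists>w. (T t x, w) \<in> generator T \<and> norm w \<le> c1 / t * norm x" if t: "t > 0" for t x
  proof -
    define z where "z = complex_of_real t"
    define U where "U = ball z (r * t)"
    have U: "U \<subseteq> sector \<theta>" "z \<in> U" "open U" using r t by (auto simp: U_def z_def)
    have holU: "vec_holomorphic_on H U" using vec_holomorphic_on_subset[OF hol] U sub by blast
    then obtain D where D: "((\<lambda>w. inverse (w - z) *\<^sub>C (H w - H z)) \<longlongrightarrow> D) (at z within U)"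
      using U(2) unfolding vec_holomorphic_on_def by blast
    have "filterlim (\<lambda>h. z + complex_of_real h) (at z within U) (at_right 0)"
      unfolding filterlim_at
    proof
      have "((\<lambda>h. z + complex_of_real h) \<longlongrightarrow> z + complex_of_real 0) (at_right 0)" by (intro tendsto_intros)
      then show *: "((\<lambda>h. z + complex_of_real h) \<longlongrightarrow> z) (at_right 0)" by simp
      have "\<forall>\<^sub>F h in at_right 0. z + complex_of_real h \<in> U"
        using topological_tendstoD[OF * U(3,2)] .
      then show "\<forall>\<^sub>F h in at_right 0. z + complex_of_real h \<in> U \<and> z + complex_of_real h \<noteq> z"
        using eventually_at_right_less[of 0] by eventually_elim auto
    qed
    from filterlim_compose[OF D this]
    have "((\<lambda>h. (inverse (complex_of_real h) *\<^sub>C (H (z + complex_of_real h) - H z)) x) \<longlongrightarrow> D x) (at_right 0)"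
      by (intro blinfun.tendsto tendsto_const) simp
    then have "((\<lambda>h. (T h (T t x) - T t x) /\<^sub>R h) \<longlongrightarrow> D x) (at_right 0)"
    proof (rule Lim_transform_eventually)
      show "\<forall>\<^sub>F h in at_right 0. (inverse (complex_of_real h) *\<^sub>C (H (z + complex_of_real h) - H z)) x
          = (T h (T t x) - T t x) /\<^sub>R h"
        using eventually_at_right_less[of 0]
      proof eventually_elim
        case (elim h)
        have "H (z + complex_of_real h) = T (h + t)" using HT[of "h + t"] elim t by (simp add: z_def add.commute)
        moreover have "H z = T t" using HT[OF t] by (simp add: z_def)
        moreover have "inverse (complex_of_real h) = complex_of_real (inverse h)" by simp
        ultimately show ?case
          using elim t by (simp only: scaleC_of_real) (simp add: T_add blinfun.scaleR_left blinfun.diff_left)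
      qed
    qed
    then have genD: "(T t x, D x) \<in> generator T" by (simp add: generator_def)
    have "norm (D x) \<le> c1 / t * norm x"
    proof (rule functional_norm_leI)
      fix \<phi> :: "'a \<Rightarrow>\<^sub>L real" assume \<phi>: "\<And>y. \<bar>\<phi> y\<bar> \<le> norm y"
      define f where "f w = complexify \<phi> (H w x)" for w
      have fU: "f holomorphic_on U" unfolding f_def by (rule complexify_holomorphic[OF holU \<phi>])
      have "(f has_field_derivative complexify \<phi> (D x)) (at z within U)"
        unfolding f_def by (rule complexify_has_field_derivative[OF D \<phi>])
      then have "(f has_field_derivative complexify \<phi> (D x)) (at z)"
        unfolding at_within_open[OF U(2,3)] .
      then have df: "deriv f z = complexify \<phi> (D x)" by (rule DERIV_imp_deriv)
      have "r * t > 0" using r t by simp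
      then have c: "cball z (r * t / 2) \<subseteq> U" by (auto simp: U_def)
      have "norm ((deriv ^^ 1) f z) \<le> fact 1 * (2 * B * norm x) / (r * t / 2) ^ 1"
      proof (rule Cauchy_inequality)
        show "f holomorphic_on ball z (r * t / 2)" by (rule holomorphic_on_subset[OF fU]) (use c in auto)
        show "continuous_on (cball z (r * t / 2)) f"
          by (rule holomorphic_on_imp_continuous_on[OF holomorphic_on_subset[OF fU c]])
        show "0 < r * t / 2" using r t by simp
        fix w assume "cmod (z - w) = r * t / 2"
        then have "w \<in> U" using c by (auto simp: dist_norm)
        then have "norm (H w) \<le> B" using U B by blast
        then have "2 * norm (H w x) \<le> 2 * (B * norm x)"
          using norm_blinfun[of "H w" x] mult_right_mono[of "norm (H w)" B "norm x"] by simp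
        then show "norm (f w) \<le> 2 * B * norm x"
          using norm_complexify_le[of \<phi>, OF \<phi>, of "H w x"] by (simp add: f_def)
      qed
      then have "cmod (complexify \<phi> (D x)) \<le> c1 / t * norm x"
        using df r t by (simp add: c1_def field_simps)
      moreover have "\<phi> (D x) \<le> cmod (complexify \<phi> (D x))"
        using complex_Re_le_cmod[of "complexify \<phi> (D x)"] by (simp add: complexify_def)
      ultimately show "\<phi> (D x) \<le> c1 / t * norm x" by linarith
    qed
    with genD show ?thesis by blast
  qed
  have c1: "c1 > 0" using B r by (simp add: c1_def)
  have "yosida T A 0 c1"
    unfolding yosida_def
  proof (intro conjI allI impI)
    fix t :: real assume t: "t > 0"
    have nn: "0 \<le> c1 / t" using c1 t by simp
    show "range (T t) \<subseteq> Domain A" by (rule op_comp_norm_leI(1)[OF gen nn key[OF t]])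
    show "op_comp_norm_le A (T t) (0 + c1 / t)" using op_comp_norm_leI(2)[OF gen nn key[OF t]] by simp
  qed (use c1 in auto)
  then show thesis by (rule that)
qed

end

text \<open>\<open>A T t\<close> is \<open>O(1/t)\<close> for all \<open>t > 0\<close>, the real-variable description of sectorially bounded holomorphic
semigroups.\<close>

locale analytic_semigroup = bounded_semigroup T
  for T :: "real \<Rightarrow> ('a::complex_banach \<Rightarrow>\<^sub>L 'a)" +
  fixes K :: real
  assumes K: "K > 0"
    and smoothing: "\<And>t x. t > 0 \<Longrightarrow> \<exists>w. (T t x, w) \<in> generator T \<and> norm w \<le> K / t * norm x"
begin

definition gen_T :: "real \<Rightarrow> 'a \<Rightarrow>\<^sub>L 'a"
  where "gen_T t = Blinfun (\<lambda>x. THE w. (T t x, w) \<in> generator T)"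

lemma gen_T:
  assumes t: "t > 0"
  shows "(T t x, gen_T t x) \<in> generator T" "norm (gen_T t) \<le> K / t"
proof -
  define f where "f x = (THE w. (T t x, w) \<in> generator T)" for x
  have f: "(T t x, f x) \<in> generator T" "norm (f x) \<le> K / t * norm x" for x
  proof -
    obtain w where w: "(T t x, w) \<in> generator T" "norm w \<le> K / t * norm x" using smoothing[OF t] by blast
    have "f x = w" unfolding f_def using w generator_unique by blast
    then show "(T t x, f x) \<in> generator T" "norm (f x) \<le> K / t * norm x" using w by auto
  qed
  have "bounded_linear f"
  proof (rule bounded_linear_intro[where K = "K / t"])
    fix x y :: 'a and r :: real
    have "(T t (x + y), f x + f y) \<in> generator T"
      using generator_add[OF f(1)[of x] f(1)[of y]] by (simp add: blinfun.add_right)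
    then show "f (x + y) = f x + f y" using generator_unique f(1) by blast
    have "(T t (r *\<^sub>R x), r *\<^sub>R f x) \<in> generator T"
      using generator_scaleR[OF f(1)[of x]] by (simp add: blinfun.scaleR_right)
    then show "f (r *\<^sub>R x) = r *\<^sub>R f x" using generator_unique f(1) by blast
  qed (use f(2) in \<open>simp add: mult.commute\<close>)
  then have Pf: "gen_T t x = f x" for x by (simp add: gen_T_def f_def[abs_def] bounded_linear_Blinfun_apply)
  show "(T t x, gen_T t x) \<in> generator T" using f by (simp add: Pf)
  show "norm (gen_T t) \<le> K / t" using f(2) K t by (intro norm_blinfun_bound) (auto simp: Pf)
qed

lemma gen_T_add:
  assumes t: "t > 0" and s: "s \<ge> 0"
  shows "gen_T (t + s) x = T s (gen_T t x)" "gen_T t (T s x) = T s (gen_T t x)"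
proof -
  have g: "(T s (T t x), T s (gen_T t x)) \<in> generator T" by (rule generator_T[OF gen_T(1)[OF t] s])
  have "T s (T t x) = T (t + s) x" using T_add[of s t x] t s by (simp add: add.commute)
  then show "gen_T (t + s) x = T s (gen_T t x)" using generator_unique g gen_T(1)[of "t + s" x] t s by auto
  have "T s (T t x) = T t (T s x)" using T_add[of s t x] T_add[of t s x] t s by (simp add: add.commute)
  then show "gen_T t (T s x) = T s (gen_T t x)" using generator_unique g gen_T(1)[OF t, of "T s x"] by auto
qed

lemma gen_T_clinear: "t > 0 \<Longrightarrow> gen_T t (c *\<^sub>C x) = c *\<^sub>C gen_T t x"
  using generator_unique[OF gen_T(1)[of t "c *\<^sub>C x"]] generator_scaleC[OF gen_T(1)[of t x], of c]
  by (simp add: T_clinear)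

lemma T_has_vector_derivative:
  assumes t: "t > 0" shows "((\<lambda>s. T s x) has_vector_derivative gen_T t x) (at t)"
proof (rule has_vector_derivativeI_quotient, rule filterlim_split_at)
  show "((\<lambda>h. (T (t + h) x - T t x) /\<^sub>R h) \<longlongrightarrow> gen_T t x) (at_right 0)"
  proof (rule Lim_transform_eventually)
    show "((\<lambda>h. (T h (T t x) - T t x) /\<^sub>R h) \<longlongrightarrow> gen_T t x) (at_right 0)"
      using gen_T(1)[OF t] by (simp add: generator_def)
    show "\<forall>\<^sub>F h in at_right 0. (T h (T t x) - T t x) /\<^sub>R h = (T (t + h) x - T t x) /\<^sub>R h"
      using eventually_at_right_less[of 0]
      by eventually_elim (use t T_add[of _ t x] in \<open>simp add: add.commute\<close>)
  qed
next
  define r where "r = t / 2"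
  have r: "r > 0" "t = r + r" using t by (auto simp: r_def)
  define quot where "quot h = (T h (T r x) - T r x) /\<^sub>R h" for h
  have quot: "((\<lambda>h. quot h) \<longlongrightarrow> gen_T r x) (at_right 0)" using gen_T(1)[OF r(1)] by (simp add: quot_def generator_def)
  have "((\<lambda>h. T (r - h) (quot h)) \<longlongrightarrow> T r (gen_T r x)) (at_right 0)"
  proof -
    have ev: "\<forall>\<^sub>F h in at_right 0. 0 < h \<and> h < r"
      using eventually_at_right_real[OF r(1)] by (auto elim: eventually_mono)
    have "((\<lambda>h. T (r - h) (gen_T r x)) \<longlongrightarrow> T r (gen_T r x)) (at_right 0)"
    proof (rule continuous_on_tendsto_compose[OF T_continuous])
      have "((\<lambda>h. r - h) \<longlongrightarrow> r - 0) (at_right 0)" by (intro tendsto_intros)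
      then show "((\<lambda>h. r - h) \<longlongrightarrow> r) (at_right 0)" by simp
      show "\<forall>\<^sub>F h in at_right 0. r - h \<in> {0..}" using ev by eventually_elim simp
    qed (use r in simp)
    moreover have "((\<lambda>h. T (r - h) (quot h - gen_T r x)) \<longlongrightarrow> 0) (at_right 0)"
    proof (rule Lim_null_comparison)
      show "\<forall>\<^sub>F h in at_right 0. norm (T (r - h) (quot h - gen_T r x)) \<le> M * norm (quot h - gen_T r x)"
        using ev by eventually_elim (rule norm_T_apply_le, simp)
      have "((\<lambda>h. M * norm (quot h - gen_T r x)) \<longlongrightarrow> M * norm (gen_T r x - gen_T r x)) (at_right 0)"
        by (intro tendsto_intros quot)
      then show "((\<lambda>h. M * norm (quot h - gen_T r x)) \<longlongrightarrow> 0) (at_right 0)" by simp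
    qed
    ultimately have "((\<lambda>h. T (r - h) (gen_T r x) + T (r - h) (quot h - gen_T r x)) \<longlongrightarrow> T r (gen_T r x) + 0) (at_right 0)"
      by (rule tendsto_add)
    then show ?thesis by (simp add: blinfun.diff_right)
  qed
  moreover have "T r (gen_T r x) = gen_T t x" unfolding r(2) by (rule gen_T_add(1)[symmetric]) (use r in auto)
  ultimately have lim: "((\<lambda>h. T (r - h) (quot h)) \<longlongrightarrow> gen_T t x) (at_right 0)" by simp
  have "((\<lambda>h. (T (t + - h) x - T t x) /\<^sub>R - h) \<longlongrightarrow> gen_T t x) (at_right 0)"
    using lim
  proof (rule Lim_transform_eventually)
    show "\<forall>\<^sub>F h in at_right 0. T (r - h) (quot h) = (T (t + - h) x - T t x) /\<^sub>R - h"
      using eventually_at_right_real[OF r(1)]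
    proof eventually_elim
      case (elim h)
      have "T (r - h) (T h (T r x)) = T t x"
        using T_add[of "r - h" h "T r x"] T_add[of r r x] elim r by simp
      moreover have "T (r - h) (T r x) = T (t + - h) x"
        using T_add[of "r - h" r x] elim r by (simp add: algebra_simps)
      ultimately have "T (r - h) (quot h) = (T t x - T (t + - h) x) /\<^sub>R h"
        by (simp add: quot_def blinfun.scaleR_right blinfun.diff_right)
      also have "\<dots> = (T (t + - h) x - T t x) /\<^sub>R - h"
        by (simp add: scaleR_right_diff_distrib)
      finally show ?case .
    qed
  qed
  then show "((\<lambda>h. (T (t + h) x - T t x) /\<^sub>R h) \<longlongrightarrow> gen_T t x) (at_left 0)"
    by (simp add: filterlim_at_left_to_right)
qed

primrec gen_T_pow :: "real \<Rightarrow> nat \<Rightarrow> 'a \<Rightarrow>\<^sub>L 'a" where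
  "gen_T_pow u 0 = id_blinfun"
| "gen_T_pow u (Suc n) = gen_T u o\<^sub>L gen_T_pow u n"

text \<open>The \<open>n\<close>-th derivative of the semigroup at \<open>t\<close>: the \<open>n\<close>-th power of the generator times \<open>T t\<close> is distributed
over \<open>n\<close> factors at time \<open>t/n\<close>, which gives the bound \<open>(K n/t)\<^sup>n\<close>.\<close>

definition deriv_T :: "nat \<Rightarrow> real \<Rightarrow> 'a \<Rightarrow>\<^sub>L 'a"
  where "deriv_T n t = (if n = 0 then T t else gen_T_pow (t / n) n)"

lemma gen_T_pow_T: "u > 0 \<Longrightarrow> w \<ge> 0 \<Longrightarrow> gen_T_pow u n (T w x) = T w (gen_T_pow u n x)"
  by (induction n) (simp_all add: gen_T_add)

lemma gen_T_pow_gen_T: "gen_T_pow u n (gen_T u x) = gen_T u (gen_T_pow u n x)"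
  by (induction n) simp_all

lemma gen_T_pow_add:
  assumes u: "u > 0" and w: "w \<ge> 0" shows "gen_T_pow (u + w) n x = gen_T_pow u n (T (real n * w) x)"
proof (induction n)
  case (Suc n)
  have "gen_T_pow (u + w) (Suc n) x = gen_T u (T w (gen_T_pow u n (T (real n * w) x)))"
    using Suc gen_T_add[OF u w] by simp
  also have "\<dots> = gen_T u (gen_T_pow u n (T w (T (real n * w) x)))" by (simp add: gen_T_pow_T[OF u w])
  also have "T w (T (real n * w) x) = T (real (Suc n) * w) x"
    using T_add[of w "real n * w" x] w by (simp add: algebra_simps)
  finally show ?case by simp
qed (simp add: T_0)

lemma deriv_T_split:
  assumes u: "u > 0" and v: "v \<ge> 0" shows "deriv_T n (real n * u + v) x = gen_T_pow u n (T v x)"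
proof (cases "n = 0")
  case False
  then have "(real n * u + v) / real n = u + v / real n" by (simp add: add_divide_distrib)
  then show ?thesis using gen_T_pow_add[OF u, of "v / real n" n x] v False by (simp add: deriv_T_def)
qed (simp add: deriv_T_def)

lemma deriv_T_has_vector_derivative:
  assumes t: "t > 0" shows "((\<lambda>s. deriv_T n s x) has_vector_derivative deriv_T (Suc n) t x) (at t)"
proof -
  define u where "u = t / real (Suc n)"
  have "t = real (Suc n) * u" by (simp add: u_def)
  also have "\<dots> = real n * u + u" by (simp add: algebra_simps)
  finally have u: "u > 0" "t = real n * u + u" using t by (simp_all add: u_def)
  have "((\<lambda>s. T s x) \<circ> (\<lambda>s. s - real n * u) has_vector_derivative 1 *\<^sub>R gen_T u x) (at t)"
  proof (rule vector_diff_chain_at)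
    show "((\<lambda>s. s - real n * u) has_vector_derivative 1) (at t)"
      by (auto intro!: derivative_eq_intros)
    show "((\<lambda>s. T s x) has_vector_derivative gen_T u x) (at (t - real n * u))"
      using T_has_vector_derivative[OF u(1)] u(2) by simp
  qed
  then have "((\<lambda>s. gen_T_pow u n (T (s - real n * u) x)) has_vector_derivative gen_T_pow u n (gen_T u x)) (at t)"
    by (intro bounded_linear.has_vector_derivative[OF blinfun.bounded_linear_right]) (simp add: comp_def)
  moreover have "gen_T_pow u n (gen_T u x) = deriv_T (Suc n) t x" by (simp add: gen_T_pow_gen_T deriv_T_def u_def)
  ultimately have "((\<lambda>s. gen_T_pow u n (T (s - real n * u) x)) has_vector_derivative deriv_T (Suc n) t x) (at t)" by simp
  then show ?thesis
  proof (rule has_vector_derivative_transform_within_open)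
    show "open {real n * u<..}" "t \<in> {real n * u<..}" using u by auto
    show "gen_T_pow u n (T (s - real n * u) x) = deriv_T n s x" if "s \<in> {real n * u<..}" for s
      using deriv_T_split[OF u(1), of "s - real n * u" n x] that by simp
  qed
qed

lemma norm_gen_T_pow_le: "u > 0 \<Longrightarrow> norm (gen_T_pow u n) \<le> (K / u) ^ n"
proof (induction n)
  case 0
  then show ?case using norm_blinfun_id_le by simp
next
  case (Suc n)
  have "norm (gen_T_pow u (Suc n)) \<le> norm (gen_T u) * norm (gen_T_pow u n)" by (simp add: norm_blinfun_compose)
  also have "\<dots> \<le> (K / u) * (K / u) ^ n" using Suc gen_T(2)[of u] K by (intro mult_mono) auto
  finally show ?case by simp
qed

lemma norm_D_le:
  assumes t: "t > 0" shows "norm (deriv_T n t) \<le> (M + 1) * (K * exp 1 / t) ^ n * fact n"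
proof (cases "n = 0")
  case True
  then show ?thesis using norm_T_le[of t] t by (simp add: deriv_T_def)
next
  case False
  have "norm (deriv_T n t) \<le> (K / (t / n)) ^ n" using norm_gen_T_pow_le[of "t / n" n] False t by (simp add: deriv_T_def)
  also have "\<dots> = (K / t) ^ n * real n ^ n" by (simp add: power_mult_distrib[symmetric])
  also have "\<dots> \<le> (K / t) ^ n * (exp 1 ^ n * fact n)" using K t by (intro mult_left_mono self_power_le) auto
  also have "\<dots> = 1 * ((K * exp 1 / t) ^ n * fact n)" by (simp add: power_mult_distrib power_divide)
  also have "\<dots> \<le> (M + 1) * ((K * exp 1 / t) ^ n * fact n)"
    using K t M_nonneg by (intro mult_right_mono) auto
  finally show ?thesis by (simp add: mult.assoc)
qed

definition coeff :: "real \<Rightarrow> nat \<Rightarrow> 'a \<Rightarrow>\<^sub>L 'a"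
  where "coeff c n = deriv_T n c /\<^sub>R fact n"

definition taylor_ext :: "real \<Rightarrow> complex \<Rightarrow> 'a \<Rightarrow>\<^sub>L 'a"
  where "taylor_ext c z = (\<Sum>n. (z - of_real c) ^ n *\<^sub>C coeff c n)"

definition \<rho> :: real where "\<rho> = 1 / (K * exp 1)"

lemma \<rho>: "\<rho> > 0" "1 / (K * exp 1 / c) = \<rho> * c"
  using K by (auto simp: \<rho>_def)

lemma norm_coeff_le: "c > 0 \<Longrightarrow> norm (coeff c n) \<le> (M + 1) * (K * exp 1 / c) ^ n"
proof -
  assume c: "c > 0"
  have "norm (coeff c n) = norm (deriv_T n c) / fact n" by (simp add: coeff_def divide_inverse mult.commute)
  also have "\<dots> \<le> (M + 1) * (K * exp 1 / c) ^ n * fact n / fact n"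
    by (rule divide_right_mono[OF norm_D_le[OF c]]) simp
  finally show ?thesis by simp
qed

lemma taylor_ext_holomorphic: "c > 0 \<Longrightarrow> vec_holomorphic_on (taylor_ext c) (ball (of_real c) (\<rho> * c))"
  unfolding taylor_ext_def[abs_def] \<rho>(2)[symmetric]
  by (rule vec_holomorphic_power_series[OF norm_coeff_le]) (use K in auto)

text \<open>The remainder after \<open>p\<close> terms is at most a multiple of \<open>p y\<^sup>p\<close> with \<open>y < 1\<close>, because \<open>p\<^sup>p \<le> e\<^sup>p p!\<close>.\<close>

lemma taylor_ext_real:
  assumes c: "c > 0" and b: "c \<le> b" "b < c + \<rho> * c"
  shows "taylor_ext c (of_real b) = T b"
proof (rule blinfun_eqI)
  fix x
  define y where "y = (b - c) * (K * exp 1 / c)"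
  have y: "0 \<le> y" "y < 1"
  proof -
    show "0 \<le> y" using b c K by (simp add: y_def)
    have "(b - c) * (K * exp 1 / c) < (\<rho> * c) * (K * exp 1 / c)"
      using b c K by (intro mult_strict_right_mono) auto
    then show "y < 1" using c K by (simp add: y_def \<rho>_def)
  qed
  have rem: "norm (T b x - (\<Sum>i<p. ((b - c) ^ i / fact i) *\<^sub>R deriv_T i c x)) \<le> (M + 1) * norm x * (real p * y ^ p)"
    if p: "p > 0" for p
  proof -
    define B where "B = (b - c) ^ (p - 1) / fact (p - 1) * ((M + 1) * (K * exp 1 / c) ^ p * fact p * norm x)"
    have "((\<lambda>s. ((b - s) ^ (p - 1) / fact (p - 1)) *\<^sub>R deriv_T p s x) has_integral
        T b x - (\<Sum>i<p. ((b - c) ^ i / fact i) *\<^sub>R deriv_T i c x)) {c..b}"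
    proof (rule Taylor_has_integral[OF p])
      show "(\<lambda>s. deriv_T 0 s x) = (\<lambda>s. T s x)" by (simp add: deriv_T_def)
      show "((\<lambda>s. deriv_T m s x) has_vector_derivative deriv_T (Suc m) s x) (at s within {c..b})"
        if "m < p" "c \<le> s" "s \<le> b" for m s
        by (rule has_vector_derivative_at_within[OF deriv_T_has_vector_derivative]) (use that c in simp)
    qed (rule b)
    then have hi: "((\<lambda>s. ((b - s) ^ (p - 1) / fact (p - 1)) *\<^sub>R deriv_T p s x) has_integral
        T b x - (\<Sum>i<p. ((b - c) ^ i / fact i) *\<^sub>R deriv_T i c x)) (cbox c b)" by simp
    have "norm (T b x - (\<Sum>i<p. ((b - c) ^ i / fact i) *\<^sub>R deriv_T i c x)) \<le> B * measure lborel (cbox c b)"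
    proof (rule has_integral_bound[OF _ hi])
      show "0 \<le> B" using b c K M_nonneg by (simp add: B_def)
      fix s assume s: "s \<in> cbox c b"
      then have s0: "s > 0" "c \<le> s" "s \<le> b" using c by auto
      have "norm (deriv_T p s x) \<le> norm (deriv_T p s) * norm x" by (rule norm_blinfun)
      also have "\<dots> \<le> (M + 1) * (K * exp 1 / s) ^ p * fact p * norm x"
        by (rule mult_right_mono[OF norm_D_le[OF s0(1)]]) simp
      also have "\<dots> \<le> (M + 1) * (K * exp 1 / c) ^ p * fact p * norm x"
        using s0 c K M_nonneg by (intro mult_right_mono mult_left_mono power_mono divide_left_mono) auto
      finally have n: "norm (deriv_T p s x) \<le> (M + 1) * (K * exp 1 / c) ^ p * fact p * norm x" .
      have "(b - s) ^ (p - 1) / fact (p - 1) \<le> (b - c) ^ (p - 1) / fact (p - 1)"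
        using s0 by (intro divide_right_mono power_mono) auto
      then show "norm (((b - s) ^ (p - 1) / fact (p - 1)) *\<^sub>R deriv_T p s x) \<le> B"
        unfolding norm_scaleR B_def using n s0 b by (intro mult_mono) auto
    qed
    also have "measure lborel (cbox c b) = b - c" using b by simp
    also have "B * (b - c) = (M + 1) * norm x * (real p * y ^ p)"
    proof -
      obtain q where q: "p = Suc q" using p gr0_implies_Suc by blast
      have "e ^ q / fact q * (N * k ^ Suc q * fact (Suc q) * X) * e = N * X * (real (Suc q) * (e * k) ^ Suc q)"
        for e k N X :: real
        by (simp add: power_mult_distrib field_simps)
      then show ?thesis unfolding B_def y_def q diff_Suc_1 .
    qed
    finally show ?thesis .
  qed
  have z0: "(\<lambda>p. (M + 1) * norm x * (real p * y ^ p)) \<longlonglongrightarrow> (M + 1) * norm x * 0"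
    using powser_times_n_limit_0[of y] y by (intro tendsto_mult_left) simp
  have "(\<lambda>p. T b x - (\<Sum>i<p. ((b - c) ^ i / fact i) *\<^sub>R deriv_T i c x)) \<longlonglongrightarrow> 0"
  proof (rule Lim_null_comparison)
    show "\<forall>\<^sub>F p in sequentially. norm (T b x - (\<Sum>i<p. ((b - c) ^ i / fact i) *\<^sub>R deriv_T i c x))
        \<le> (M + 1) * norm x * (real p * y ^ p)"
      using eventually_gt_at_top[of 0] by eventually_elim (rule rem)
  qed (use z0 in simp)
  from tendsto_diff[OF tendsto_const[of "T b x"] this]
  have T: "(\<lambda>p. \<Sum>i<p. ((b - c) ^ i / fact i) *\<^sub>R deriv_T i c x) \<longlonglongrightarrow> T b x" by simp
  have "summable (\<lambda>n. (complex_of_real b - of_real c) ^ n *\<^sub>C coeff c n)"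
  proof (rule summable_norm_cancel, rule summable_power_series_majorant(1)[OF norm_coeff_le[OF c]])
    show "cmod (complex_of_real b - of_real c) * (K * exp 1 / c) < 1"
      using y b by (simp add: y_def flip: of_real_diff)
  qed (use K c in simp)
  then have "(\<lambda>n. (complex_of_real b - of_real c) ^ n *\<^sub>C coeff c n) sums taylor_ext c (of_real b)"
    unfolding taylor_ext_def by (rule summable_sums)
  from bounded_linear.sums[OF blinfun.bounded_linear_left this, of x]
  have "(\<lambda>n. ((complex_of_real b - of_real c) ^ n *\<^sub>C coeff c n) x) sums taylor_ext c (of_real b) x" .
  moreover have "((complex_of_real b - of_real c) ^ n *\<^sub>C coeff c n) x = ((b - c) ^ n / fact n) *\<^sub>R deriv_T n c x" for n
  proof -
    have "(complex_of_real b - of_real c) ^ n = complex_of_real ((b - c) ^ n)" by simp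
    then show ?thesis
      by (simp only: scaleC_of_real) (simp add: coeff_def blinfun.scaleR_left divide_inverse)
  qed
  ultimately show "taylor_ext c (of_real b) x = T b x" using T unfolding sums_def by (simp add: LIMSEQ_unique)
qed

text \<open>Both series represent \<open>T\<close> on the interval \<open>(d, c + \<rho> c)\<close> of the real line, which lies in the intersection of
the two discs. The identity theorem does the rest.\<close>

lemma taylor_ext_consistent:
  assumes c: "0 < c" "c < d" "d < c + \<rho> * c"
    and z: "z \<in> ball (of_real c) (\<rho> * c)" "z \<in> ball (of_real d) (\<rho> * d)"
  shows "taylor_ext c z = taylor_ext d z"
proof (rule vec_holomorphic_identity)
  \<comment> \<open>an intersection of two convex sets is connected\<close>
  define U where "U = ball (complex_of_real c) (\<rho> * c) \<inter> ball (complex_of_real d) (\<rho> * d)"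
  have d0: "d > 0" using c by simp
  have rc: "\<rho> * c < \<rho> * d" using c \<rho> by simp
  show "vec_holomorphic_on (taylor_ext c) U" by (rule vec_holomorphic_on_subset[OF taylor_ext_holomorphic]) (use c in \<open>auto simp: U_def\<close>)
  show "vec_holomorphic_on (taylor_ext d) U" by (rule vec_holomorphic_on_subset[OF taylor_ext_holomorphic]) (use d0 in \<open>auto simp: U_def\<close>)
  show "open U" by (simp add: U_def open_Int)
  show "connected U" unfolding U_def by (intro convex_connected convex_Int convex_ball)
  show "d < c + \<rho> * c" by (rule c)
  show "complex_of_real ` {d<..<c + \<rho> * c} \<subseteq> U"
  proof clarify
    fix s assume "s \<in> {d<..<c + \<rho> * c}"
    then have "\<bar>s - c\<bar> < \<rho> * c" "\<bar>s - d\<bar> < \<rho> * d" using c rc by auto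
    moreover have "cmod (of_real s - of_real v) = \<bar>s - v\<bar>" for v
      by (metis norm_of_real of_real_diff)
    ultimately show "complex_of_real s \<in> U" by (simp add: U_def dist_norm norm_minus_commute)
  qed
  show "taylor_ext c (of_real s) = taylor_ext d (of_real s)" if "s \<in> {d<..<c + \<rho> * c}" for s
    using taylor_ext_real[of c s] taylor_ext_real[of d s] that c d0 rc by simp
  show "z \<in> U" using z by (simp add: U_def)
qed

lemma taylor_ext_consistent':
  assumes "0 < c" "0 < d" "\<bar>c - d\<bar> < \<rho> * c" "\<bar>c - d\<bar> < \<rho> * d"
    and "z \<in> ball (of_real c) (\<rho> * c)" "z \<in> ball (of_real d) (\<rho> * d)"
  shows "taylor_ext c z = taylor_ext d z"
proof (cases c d rule: linorder_cases)
  case less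
  then have "d < c + \<rho> * c" using assms(3) by linarith
  with less show ?thesis using assms by (intro taylor_ext_consistent)
next
  case greater
  then have "c < d + \<rho> * d" using assms(4) by linarith
  with greater have "taylor_ext d z = taylor_ext c z" using assms by (intro taylor_ext_consistent)
  then show ?thesis by simp
qed simp

theorem sectorially_bounded_holomorphic: "sectorially_bounded_holomorphic T"
proof -
  \<comment> \<open>in the sector of this angle \<open>\<bar>Im z\<bar> \<le> (\<rho>/2) Re z\<close>, so that \<open>z\<close> lies well inside the disc around \<open>Re z\<close>\<close>
  define \<beta> where "\<beta> = arctan (\<rho> / 2)"
  define H where "H z = taylor_ext (Re z) z" for z
  have \<beta>: "0 < \<beta>" "\<beta> \<le> pi / 2" using \<rho> arctan_ubound[of "\<rho> / 2"] by (auto simp: \<beta>_def)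
  have cone: "Re z > 0" "cmod (z - of_real (Re z)) \<le> \<rho> / 2 * Re z" if "z \<in> sector \<beta>" for z
  proof -
    have "z - of_real (Re z) = \<i> * of_real (Im z)" by (simp add: complex_eq_iff)
    then have "cmod (z - of_real (Re z)) = \<bar>Im z\<bar>" by (simp add: norm_mult)
    then show "Re z > 0" "cmod (z - of_real (Re z)) \<le> \<rho> / 2 * Re z"
      using sector_imp_cone[of "\<rho> / 2" z] that \<rho> by (auto simp: \<beta>_def)
  qed
  have maj: "cmod (z - of_real (Re z)) * (K * exp 1 / Re z) \<le> 1 / 2" if "z \<in> sector \<beta>" for z
  proof -
    have "cmod (z - of_real (Re z)) * (K * exp 1 / Re z) \<le> \<rho> / 2 * Re z * (K * exp 1 / Re z)"
      using cone[OF that] K by (intro mult_right_mono) auto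
    then show ?thesis using cone(1)[OF that] K by (simp add: \<rho>_def)
  qed
  have maj1: "cmod (z - of_real (Re z)) * (K * exp 1 / Re z) < 1" if "z \<in> sector \<beta>" for z
    by (rule le_less_trans[OF maj[OF that]]) simp
  have HT: "H (of_real t) = T t" if "t > 0" for t
    using taylor_ext_real[of t t] that \<rho> by (simp add: H_def)
  have lin: "clinear_op (H z)" if z: "z \<in> sector \<beta>" for z
    unfolding clinear_op_def
  proof (intro allI)
    fix k x
    have "summable (\<lambda>n. (z - of_real (Re z)) ^ n *\<^sub>C coeff (Re z) n)"
      using cone(1)[OF z] K
      by (intro summable_norm_cancel[OF summable_power_series_majorant(1)[OF norm_coeff_le maj1[OF z]]]) auto
    then have s: "(\<lambda>n. (z - of_real (Re z)) ^ n *\<^sub>C coeff (Re z) n) sums H z"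
      unfolding H_def taylor_ext_def by (rule summable_sums)
    have app: "(\<lambda>n. ((z - of_real (Re z)) ^ n *\<^sub>C coeff (Re z) n) y) sums H z y" for y
      by (rule bounded_linear.sums[OF blinfun.bounded_linear_left s])
    have gen_T_pow: "gen_T_pow u n (k *\<^sub>C x) = k *\<^sub>C gen_T_pow u n x" if "u > 0" for u n
      using that by (induction n) (simp_all add: gen_T_clinear)
    have "deriv_T n t (k *\<^sub>C x) = k *\<^sub>C deriv_T n t x" if "t > 0" for n t
      using that gen_T_pow[of "t / n" n] by (simp add: deriv_T_def T_clinear)
    then have co: "coeff (Re z) n (k *\<^sub>C x) = k *\<^sub>C coeff (Re z) n x" for n
      using cone(1)[OF z]
      by (simp add: coeff_def blinfun.scaleR_left linear_scale[OF bounded_linear.linear[OF bounded_linear_scaleC]])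
    have "((z - of_real (Re z)) ^ n *\<^sub>C coeff (Re z) n) (k *\<^sub>C x) = k *\<^sub>C (((z - of_real (Re z)) ^ n *\<^sub>C coeff (Re z) n) x)" for n
      by (simp add: scaleC_blinfun.rep_eq co scaleC_scaleC mult.commute)
    with app[of "k *\<^sub>C x"] bounded_linear.sums[OF bounded_linear_scaleC app[of x], of k]
    show "H z (k *\<^sub>C x) = k *\<^sub>C H z x" by (simp add: sums_unique2)
  qed
  have bd: "norm (H z) \<le> 2 * (M + 1)" if z: "z \<in> sector \<beta>" for z
  proof -
    define y where "y = cmod (z - of_real (Re z)) * (K * exp 1 / Re z)"
    have y: "y \<le> 1 / 2" using maj[OF z] by (simp only: y_def)
    have "norm (H z) \<le> (M + 1) / (1 - y)"
      unfolding H_def taylor_ext_def y_def using K cone(1)[OF z]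
      by (intro summable_power_series_majorant(2)[OF norm_coeff_le maj1[OF z]]) auto
    also have "\<dots> \<le> (M + 1) / (1 / 2)" using y M_nonneg by (intro divide_left_mono) auto
    finally show ?thesis by simp
  qed
  have hol: "vec_holomorphic_on H (sector \<beta>)"
    unfolding vec_holomorphic_on_def
  proof
    fix z0 assume z0: "z0 \<in> sector \<beta>"
    define c where "c = Re z0"
    have c: "c > 0" "cmod (z0 - of_real c) \<le> \<rho> / 2 * c" using cone[OF z0] by (auto simp: c_def)
    have rc: "\<rho> * c > 0" using \<rho> c by simp
    \<comment> \<open>so close to \<open>z0\<close> the centre \<open>Re z\<close> is admissible for \<open>taylor_ext_consistent'\<close>\<close>
    define \<delta> where "\<delta> = min (c / 2) (\<rho> * c / 4)"
    have \<delta>: "\<delta> > 0" using c rc by (simp add: \<delta>_def)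
    have eq: "H z = taylor_ext c z" if z: "z \<in> sector \<beta>" "dist z z0 < \<delta>" for z
    proof -
      have "\<bar>Re z - c\<bar> \<le> cmod (z - z0)" using abs_Re_le_cmod[of "z - z0"] by (simp add: c_def)
      then have d: "\<bar>Re z - c\<bar> < c / 2" "\<bar>Re z - c\<bar> < \<rho> * c / 4" using z by (auto simp: dist_norm \<delta>_def)
      then have "c / 2 < Re z" by linarith
      then have "\<rho> * (c / 2) < \<rho> * Re z" using \<rho> by simp
      then have d2: "\<bar>Re z - c\<bar> < \<rho> * Re z" "\<bar>Re z - c\<bar> < \<rho> * c" using d rc by (auto simp: field_simps)
      have "cmod (z - of_real c) \<le> cmod (z - z0) + cmod (z0 - of_real c)"
        using norm_triangle_ineq[of "z - z0" "z0 - of_real c"] by simp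
      also have "\<dots> < \<rho> * c" using z(2) c(2) rc by (simp add: dist_norm \<delta>_def)
      finally have "z \<in> ball (of_real c) (\<rho> * c)" by (simp add: dist_norm norm_minus_commute)
      moreover have "cmod (z - of_real (Re z)) < \<rho> * Re z"
        using cone(2)[OF z(1)] mult_pos_pos[OF \<rho>(1) cone(1)[OF z(1)]] by linarith
      then have "z \<in> ball (of_real (Re z)) (\<rho> * Re z)" by (simp add: dist_norm norm_minus_commute)
      ultimately show ?thesis
        unfolding H_def using d2 c cone(1)[OF z(1)] by (intro taylor_ext_consistent') auto
    qed
    have zb: "z0 \<in> ball (of_real c) (\<rho> * c)" using c rc by (simp add: dist_norm norm_minus_commute)
    obtain L where "((\<lambda>w. inverse (w - z0) *\<^sub>C (taylor_ext c w - taylor_ext c z0)) \<longlongrightarrow> L) (at z0 within ball (of_real c) (\<rho> * c))"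
      using taylor_ext_holomorphic[OF c(1)] zb unfolding vec_holomorphic_on_def by blast
    then have "((\<lambda>w. inverse (w - z0) *\<^sub>C (taylor_ext c w - taylor_ext c z0)) \<longlongrightarrow> L) (at z0)"
      unfolding at_within_open[OF zb open_ball] .
    then have "((\<lambda>w. inverse (w - z0) *\<^sub>C (taylor_ext c w - taylor_ext c z0)) \<longlongrightarrow> L) (at z0 within sector \<beta>)"
      by (rule tendsto_within_subset) simp
    then have "((\<lambda>w. inverse (w - z0) *\<^sub>C (H w - H z0)) \<longlongrightarrow> L) (at z0 within sector \<beta>)"
    proof (rule Lim_transform_eventually)
      show "\<forall>\<^sub>F w in at z0 within sector \<beta>. inverse (w - z0) *\<^sub>C (taylor_ext c w - taylor_ext c z0) = inverse (w - z0) *\<^sub>C (H w - H z0)"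
        unfolding eventually_at using \<delta> eq eq[OF z0] by (intro exI[of _ \<delta>]) auto
    qed
    then show "\<exists>L. ((\<lambda>w. inverse (w - z0) *\<^sub>C (H w - H z0)) \<longlongrightarrow> L) (at z0 within sector \<beta>)" by blast
  qed
  have "bounded (H ` sector \<theta>)" if "\<theta> < \<beta>" for \<theta>
  proof -
    have "sector \<theta> \<subseteq> sector \<beta>" using that by (auto simp: sector_def)
    then show ?thesis unfolding bounded_iff using bd by blast
  qed
  moreover have "C0_semigroup T" using bounded_semigroup by (simp add: bounded_C0_semigroup_def)
  ultimately show ?thesis
    unfolding sectorially_bounded_holomorphic_def using \<beta> HT lin hol by blast
qed

end

context subordination
begin

lemma yosida_bound_nonneg: "t > 0 \<Longrightarrow> c1 > 0 \<Longrightarrow> 0 \<le> yosida_bound c0 c1 t"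
  unfolding yosida_bound_def using M_nonneg at_zero_nonneg[OF \<psi>] C_const_nonneg[OF \<psi>, of c0] by simp

lemma S_smoothing:
  assumes "generator T = op_neg A" "yosida T A c0 c1" "t > 0"
  shows "\<exists>w. (S t x, w) \<in> generator S \<and> norm w \<le> yosida_bound c0 c1 t * norm x"
proof (rule S_range_in_domain[of t "yosida_bound c0 c1 t" x])
  show "norm (S h (S t x) - S t x) \<le> h * yosida_bound c0 c1 t * norm x" if "h > 0" for h x
    by (rule S_increment_le[OF assms(1,2) that assms(3)])
qed (use assms(3) in auto)

text \<open>For \<open>c0 = 0\<close> the constant \<open>C[c0; \<psi>]\<close> vanishes and \<open>a exp (- t a) \<le> 1/t\<close> for \<open>a = at_zero \<psi>\<close>, so the Yosida bound for
\<open>S\<close> is a multiple of \<open>1/t\<close>.\<close>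

theorem S_sectorial:
  assumes gen: "generator T = op_neg A" and sec: "sectorially_bounded_holomorphic T"
  shows "sectorially_bounded_holomorphic S"
proof -
  obtain c1 where yos: "yosida T A 0 c1" using sectorial_imp_yosida[OF sec gen] by blast
  have c1: "c1 > 0" using yos by (simp add: yosida_def)
  define K where "K = M + 2 * max (2 * M) c1"
  have Kpos: "K > 0" using c1 M_nonneg by (simp add: K_def add_nonneg_pos)
  have le: "yosida_bound 0 c1 t \<le> K / t" if t: "t > 0" for t
  proof -
    define a where "a = at_zero \<psi>"
    have "t * a * exp (- t * a) \<le> 1"
    proof -
      have "t * a \<le> exp (t * a)" using exp_ge_add_one_self[of "t * a"] by linarith
      then have "t * a * exp (- (t * a)) \<le> exp (t * a) * exp (- (t * a))" by (rule mult_right_mono) simp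
      then show ?thesis by (simp add: exp_minus)
    qed
    then have "M * (t * a * exp (- t * a)) \<le> M * 1" using M_nonneg by (rule mult_left_mono)
    then have "yosida_bound 0 c1 t * t \<le> K"
      using t unfolding yosida_bound_def K_def a_def[symmetric] C_const_def by (simp add: algebra_simps)
    then show ?thesis using t by (simp add: pos_le_divide_eq)
  qed
  interpret S': analytic_semigroup S K
  proof
    show "K > 0" by (rule Kpos)
    show "\<exists>w. (S t x, w) \<in> generator S \<and> norm w \<le> K / t * norm x" if t: "t > 0" for t x
      using S_smoothing[OF gen yos t, of x] mult_right_mono[OF le[OF t], of "norm x"] by (meson norm_ge_zero order_trans)
  qed
  show ?thesis by (rule S'.sectorially_bounded_holomorphic)
qed

end

theorem corollary3p5:
  fixes \<psi> :: "real \<Rightarrow> real"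
    and A :: "('a::complex_banach \<times> 'a) set"
    and T :: "real \<Rightarrow> ('a \<Rightarrow>\<^sub>L 'a)"
  assumes "bernstein \<psi>"
    and "bounded_C0_semigroup T"
    and "generator T = op_neg A"
  shows "(\<forall>c0 c1. yosida T A c0 c1 \<longrightarrow>
      (\<exists>S. bounded_C0_semigroup S \<and>
        generator S = op_neg (bernstein_calculus \<psi> A) \<and>
        (\<forall>t>0. range (S t) \<subseteq> Domain (bernstein_calculus \<psi> A) \<and>
          op_comp_norm_le (bernstein_calculus \<psi> A) (S t)
            (sg_bound T * (at_zero \<psi> + 4 * C_const c0 \<psi>) * exp (- t * at_zero \<psi>)
              + 2 * max (2 * sg_bound T) c1 / t))))
    \<and> (sectorially_bounded_holomorphic T \<longrightarrow>
      (\<exists>S. generator S = op_neg (bernstein_calculus \<psi> A) \<and> sectorially_bounded_holomorphic S))"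
proof -
  interpret subordination T \<psi>
    using assms by unfold_locales (auto intro: bernstein_imp_bernstein_fun)
  have gS: "generator S = op_neg (bernstein_calculus \<psi> A)" by (rule generator_S[OF assms(3)])
  have "range (S t) \<subseteq> Domain (bernstein_calculus \<psi> A) \<and> op_comp_norm_le (bernstein_calculus \<psi> A) (S t) (yosida_bound c0 c1 t)"
    if yos: "yosida T A c0 c1" and t: "t > 0" for c0 c1 t
  proof -
    have "c1 > 0" using yos by (simp add: yosida_def)
    note b = yosida_bound_nonneg[OF t this]
    have w: "\<exists>w. (S t x, w) \<in> generator S \<and> norm w \<le> yosida_bound c0 c1 t * norm x" for x
      by (rule S_smoothing[OF assms(3) yos t])
    show ?thesis
    proof
      show "range (S t) \<subseteq> Domain (bernstein_calculus \<psi> A)"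
        using gS b w by (rule S.op_comp_norm_leI(1))
      show "op_comp_norm_le (bernstein_calculus \<psi> A) (S t) (yosida_bound c0 c1 t)"
        using gS b w by (rule S.op_comp_norm_leI(2))
    qed
  qed
  note * = this[unfolded yosida_bound_def]
  show ?thesis
  proof (intro conjI allI impI)
    show "\<exists>S. bounded_C0_semigroup S \<and> generator S = op_neg (bernstein_calculus \<psi> A) \<and>
        (\<forall>t>0. range (S t) \<subseteq> Domain (bernstein_calculus \<psi> A) \<and>
          op_comp_norm_le (bernstein_calculus \<psi> A) (S t)
            (sg_bound T * (at_zero \<psi> + 4 * C_const c0 \<psi>) * exp (- t * at_zero \<psi>)
              + 2 * max (2 * sg_bound T) c1 / t))" if "yosida T A c0 c1" for c0 c1
      using S_bounded_C0_semigroup gS *[OF that] by (intro exI[of _ S]) simp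
    show "\<exists>S. generator S = op_neg (bernstein_calculus \<psi> A) \<and> sectorially_bounded_holomorphic S"
      if "sectorially_bounded_holomorphic T"
      using gS S_sectorial[OF assms(3) that] by (intro exI[of _ S]) simp
  qed
qed

end
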